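(* Let $I\subset\mathbb{R}$ be an interval, let $\xi\in\mathbb{R}^3$ be a non-zero vector, and let $\alpha,U:I\to\mathbb{R}^3$ be an admissible pair of curves for $\xi$, that is, $\alpha$ and $U$ are regular analytic curves and there is an analytic positive function $\lambda:I\to\mathbb{R}^+$ such that on $I$ $$\langle\alpha',U\rangle=0,\qquad \langle\xi,U\rangle=1,\qquad \lambda=\langle\alpha'',U\rangle=-\langle\alpha',U'\rangle .$$ Then there exists a unique indefinite improper affine sphere $\psi$ with affine normal $\xi$ containing $\alpha(I)$ and having affine conormal $U(s)$ at $\alpha(s)$ for all $s\in I$.
   Context: $\langle\cdot,\cdot\rangle$ is the standard inner product of $\mathbb{R}^3$, $[\cdot,\cdot,\cdot]$ the determinant, and a prime denotes $d/ds$. An indefinite improper affine sphere with (constant) affine normal $\xi$ is an immersion $\psi:\Sigma\to\mathbb{R}^3$ of a surface, transversal to the constant vector $\xi\neq0$, such that the symmetric bilinear form $h$ (the affine metric) defined by $D_X d\psi(Y)=d\psi(\nabla_XY)+h(X,Y)\xi$, with $D$ the flat connection of $\mathbb{R}^3$, is a Lorentzian (indefinite, nondegenerate) metric and the volume element of $h$ coincides with the one induced by $\xi$: $\sqrt{h(X,Y)^2-h(X,X)h(Y,Y)}=|[d\psi(X),d\psi(Y),\xi]|$ for all tangent vectors $X,Y$. For $\xi=(0,0,1)$ such a surface is locally the graph of a solution of $f_{xx}f_{yy}-f_{xy}^2=-1$. The affine conormal is the map $N:\Sigma\to\mathbb{R}^3$ determined by $\langle N,\xi\rangle=1$, $\langle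 N,d\psi\rangle=0$; one has $h=-\langle dN,d\psi\rangle$. "$\psi$ contains $\alpha(I)$ with affine conormal $U(s)$ at $\alpha(s)$" means that there is a regular analytic curve $\beta:I\to\Sigma$ with $\psi\circ\beta=\alpha$ and $N\circ\beta=U$. The problem is local around the curve: existence means existence of such a surface on some neighborhood of the curve, and uniqueness means that any two solutions agree (up to reparametrization) in a neighborhood of the curve. *)

theory Defs
  imports "HOL-Analysis.Analysis"
begin

section \<open>Analytic and smooth functions\<close>

text \<open>The set \<open>S\<close> is an interval or a relatively open part of one; at an end point that belongs to
  \<open>S\<close> the expansion forces an analytic extension beyond the end point.\<close>

definition real_analytic_on :: "real set \<Rightarrow> (real \<Rightarrow> 'b::real_normed_vector) \<Rightarrow> bool" where
  "real_analytic_on S f \<longleftrightarrow>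
     (\<forall>s\<in>S. \<exists>r>0. \<exists>a::nat \<Rightarrow> 'b. \<forall>t\<in>S. \<bar>t - s\<bar> < r \<longrightarrow>
        (\<lambda>n. (t - s) ^ n *\<^sub>R a n) sums f t)"

text \<open>Two variables, used on open sets only.\<close>

definition real_analytic2_on :: "(real \<times> real) set \<Rightarrow> (real \<times> real \<Rightarrow> 'b::real_normed_vector) \<Rightarrow> bool" where
  "real_analytic2_on S f \<longleftrightarrow>
     (\<forall>p\<in>S. \<exists>r>0. \<exists>a::nat \<Rightarrow> nat \<Rightarrow> 'b. \<forall>q\<in>S.
        \<bar>fst q - fst p\<bar> < r \<and> \<bar>snd q - snd p\<bar> < r \<longrightarrow>
        ((\<lambda>(i, j). ((fst q - fst p) ^ i * (snd q - snd p) ^ j) *\<^sub>R a i j) has_sum f q) UNIV)"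

primrec higher_differentiable_on ::
    "nat \<Rightarrow> 'a set \<Rightarrow> ('a::real_normed_vector \<Rightarrow> 'b::real_normed_vector) \<Rightarrow> bool" where
  "higher_differentiable_on 0 S f \<longleftrightarrow> continuous_on S f"
| "higher_differentiable_on (Suc n) S f \<longleftrightarrow>
     (\<forall>x\<in>S. f differentiable (at x)) \<and>
     (\<forall>v. higher_differentiable_on n S (\<lambda>x. frechet_derivative f (at x) v))"

definition smooth_on :: "'a set \<Rightarrow> ('a::real_normed_vector \<Rightarrow> 'b::real_normed_vector) \<Rightarrow> bool" where
  "smooth_on S f \<longleftrightarrow> (\<forall>n. higher_differentiable_on n S f)"


section \<open>Abstract surfaces\<close>

text \<open>A chart is a pair of a coordinate domain and a coordinate map; the values of the map outside
  the domain are irrelevant. The analytic structure of a surface is only needed to speak of analytic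
  curves in it.\<close>

type_synonym 'a chart = "'a set \<times> ('a \<Rightarrow> real \<times> real)"

definition chart_range :: "'a chart \<Rightarrow> (real \<times> real) set" where
  "chart_range c = snd c ` fst c"

definition in_chart :: "'a chart \<Rightarrow> ('a \<Rightarrow> 'b) \<Rightarrow> real \<times> real \<Rightarrow> 'b" where
  "in_chart c f = f \<circ> inv_into (fst c) (snd c)"

definition is_chart :: "'a topology \<Rightarrow> 'a chart \<Rightarrow> bool" where
  "is_chart X c \<longleftrightarrow> openin X (fst c) \<and> open (chart_range c) \<and>
     homeomorphic_map (subtopology X (fst c)) (top_of_set (chart_range c)) (snd c)"

definition analytic_surface :: "'a topology \<Rightarrow> 'a chart set \<Rightarrow> bool" where
  "analytic_surface X A \<longleftrightarrow>
     Hausdorff_space X \<and> second_countable X \<and>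
     (\<forall>c\<in>A. is_chart X c) \<and> topspace X = (\<Union>c\<in>A. fst c) \<and>
     (\<forall>c\<in>A. \<forall>d\<in>A. real_analytic2_on (snd c ` (fst c \<inter> fst d)) (in_chart c (snd d)))"

definition smooth_map :: "'a chart set \<Rightarrow> ('a \<Rightarrow> 'b::real_normed_vector) \<Rightarrow> bool" where
  "smooth_map A f \<longleftrightarrow> (\<forall>c\<in>A. smooth_on (chart_range c) (in_chart c f))"

definition analytic_map :: "'a chart set \<Rightarrow> ('a \<Rightarrow> 'b::real_normed_vector) \<Rightarrow> bool" where
  "analytic_map A f \<longleftrightarrow> (\<forall>c\<in>A. real_analytic2_on (chart_range c) (in_chart c f))"

definition regular_analytic_curve ::
    "real set \<Rightarrow> 'a topology \<Rightarrow> 'a chart set \<Rightarrow> (real \<Rightarrow> 'a) \<Rightarrow> bool" where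
  "regular_analytic_curve I X A \<beta> \<longleftrightarrow>
     continuous_map (top_of_set I) X \<beta> \<and>
     (\<forall>c\<in>A. real_analytic_on {s\<in>I. \<beta> s \<in> fst c} (snd c \<circ> \<beta>) \<and>
        (\<forall>s\<in>I. \<beta> s \<in> fst c \<longrightarrow> vector_derivative (snd c \<circ> \<beta>) (at s within I) \<noteq> 0))"

text \<open>A map from an open subset of the plane into a surface that is smooth with invertible
  differential.\<close>

definition local_diffeo ::
    "(real \<times> real) set \<Rightarrow> 'a topology \<Rightarrow> 'a chart set \<Rightarrow> (real \<times> real \<Rightarrow> 'a) \<Rightarrow> bool" where
  "local_diffeo W X A \<Phi> \<longleftrightarrow>
     open W \<and> continuous_map (top_of_set W) X \<Phi> \<and>
     (\<forall>c\<in>A. smooth_on {p\<in>W. \<Phi> p \<in> fst c} (snd c \<circ> \<Phi>) \<and>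
        (\<forall>p\<in>W. \<Phi> p \<in> fst c \<longrightarrow> inj (frechet_derivative (snd c \<circ> \<Phi>) (at p))))"


section \<open>Indefinite improper affine spheres\<close>

definition triple_det :: "real^3 \<Rightarrow> real^3 \<Rightarrow> real^3 \<Rightarrow> real" where
  "triple_det a b c = det (vector [a, b, c] :: real^3^3)"

text \<open>\<open>F\<close> is the expression of an immersion in a chart, and \<open>v\<close>, \<open>w\<close> are tangent vectors at \<open>p\<close> in
  that chart, extended to coordinate vector fields with constant coefficients. Then
  \<open>D\<^sub>v dF(w)\<close> is the second derivative on the left-hand side, and \<open>z\<close> is the value at \<open>p\<close> of
  \<open>\<nabla>\<^sub>v w\<close>. Transversality makes the coefficient of \<open>\<xi>\<close> unique, and as it is tensorial in both
  arguments the choice of the extensions does not matter.\<close>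

definition affine_metric ::
    "real^3 \<Rightarrow> (real \<times> real \<Rightarrow> real^3) \<Rightarrow> real \<times> real \<Rightarrow> real \<times> real \<Rightarrow> real \<times> real \<Rightarrow> real" where
  "affine_metric \<xi> F p v w =
     (THE h. \<exists>z. frechet_derivative (\<lambda>q. frechet_derivative F (at q) w) (at p) v
                 = frechet_derivative F (at p) z + h *\<^sub>R \<xi>)"

definition lorentzian :: "(real \<times> real \<Rightarrow> real \<times> real \<Rightarrow> real) \<Rightarrow> bool" where
  "lorentzian h \<longleftrightarrow>
     bilinear h \<and> (\<forall>v w. h v w = h w v) \<and>
     (\<forall>v. v \<noteq> 0 \<longrightarrow> (\<exists>w. h v w \<noteq> 0)) \<and>
     (\<exists>v. h v v > 0) \<and> (\<exists>v. h v v < 0)"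

definition indefinite_improper_affine_sphere ::
    "real^3 \<Rightarrow> 'a topology \<Rightarrow> 'a chart set \<Rightarrow> ('a \<Rightarrow> real^3) \<Rightarrow> bool" where
  "indefinite_improper_affine_sphere \<xi> X A \<psi> \<longleftrightarrow>
     \<xi> \<noteq> 0 \<and> analytic_surface X A \<and> smooth_map A \<psi> \<and>
     (\<forall>c\<in>A. \<forall>p\<in>chart_range c.
        let d\<psi> = frechet_derivative (in_chart c \<psi>) (at p);
            h = affine_metric \<xi> (in_chart c \<psi>) p
        in inj d\<psi> \<and> \<xi> \<notin> range d\<psi> \<and> lorentzian h \<and>
           (\<forall>v w. sqrt ((h v w)\<^sup>2 - h v v * h w w) = \<bar>triple_det (d\<psi> v) (d\<psi> w) \<xi>\<bar>))"

definition affine_conormal :: "real^3 \<Rightarrow> 'a chart set \<Rightarrow> ('a \<Rightarrow> real^3) \<Rightarrow> 'a \<Rightarrow> real^3" where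
  "affine_conormal \<xi> A \<psi> x =
     (THE n. n \<bullet> \<xi> = 1 \<and>
        (\<forall>c\<in>A. x \<in> fst c \<longrightarrow>
           (\<forall>v. n \<bullet> frechet_derivative (in_chart c \<psi>) (at (snd c x)) v = 0)))"


section \<open>The Cauchy problem\<close>

definition regular_analytic_space_curve :: "real set \<Rightarrow> (real \<Rightarrow> real^3) \<Rightarrow> bool" where
  "regular_analytic_space_curve I \<alpha> \<longleftrightarrow>
     real_analytic_on I \<alpha> \<and> (\<forall>s\<in>I. vector_derivative \<alpha> (at s within I) \<noteq> 0)"

definition admissible_pair ::
    "real^3 \<Rightarrow> real set \<Rightarrow> (real \<Rightarrow> real^3) \<Rightarrow> (real \<Rightarrow> real^3) \<Rightarrow> bool" where
  "admissible_pair \<xi> I \<alpha> U \<longleftrightarrow>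
     regular_analytic_space_curve I \<alpha> \<and> regular_analytic_space_curve I U \<and>
     (let D = (\<lambda>f s. vector_derivative f (at s within I))
      in \<exists>L::real \<Rightarrow> real. real_analytic_on I L \<and>
           (\<forall>s\<in>I. L s > 0 \<and> D \<alpha> s \<bullet> U s = 0 \<and> \<xi> \<bullet> U s = 1 \<and>
                  L s = D (D \<alpha>) s \<bullet> U s \<and> L s = - (D \<alpha> s \<bullet> D U s)))"

text \<open>The immersion \<open>\<psi>\<close> contains \<open>\<alpha>(I)\<close> with affine conormal \<open>U\<close>, along the curve \<open>\<beta>\<close> of the
  surface.\<close>

definition cauchy_solution ::
    "real^3 \<Rightarrow> real set \<Rightarrow> (real \<Rightarrow> real^3) \<Rightarrow> (real \<Rightarrow> real^3) \<Rightarrow>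
     'a topology \<Rightarrow> 'a chart set \<Rightarrow> ('a \<Rightarrow> real^3) \<Rightarrow> (real \<Rightarrow> 'a) \<Rightarrow> bool" where
  "cauchy_solution \<xi> I \<alpha> U X A \<psi> \<beta> \<longleftrightarrow>
     indefinite_improper_affine_sphere \<xi> X A \<psi> \<and>
     regular_analytic_curve I X A \<beta> \<and>
     (\<forall>s\<in>I. \<psi> (\<beta> s) = \<alpha> s \<and> affine_conormal \<xi> A \<psi> (\<beta> s) = U s)"

text \<open>Equality up to reparametrization in a neighbourhood of the curve. As \<open>\<beta>\<^sub>1\<close> and \<open>\<beta>\<^sub>2\<close> need not be
  injective (over a closed curve \<open>\<alpha>\<close> one surface may be an annulus and the other one a strip), a
  neighbourhood of the curve is a strip \<open>W\<close> around \<open>I \<times> {0}\<close> that is mapped to both surfaces by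
  local diffeomorphisms; where these are injective the reparametrization is \<open>\<Phi>\<^sub>2 \<circ> \<Phi>\<^sub>1\<^sup>-\<^sup>1\<close>.
  If \<open>I\<close> contains one of its end points, solutions that are merely smooth need not agree in this
  sense: one of them can be altered outside the domain of dependence of the curve, which comes
  arbitrarily close to the end point. For analytic solutions the end points are harmless.\<close>

definition agree_near_curve ::
    "real set \<Rightarrow> 'a topology \<Rightarrow> 'a chart set \<Rightarrow> ('a \<Rightarrow> real^3) \<Rightarrow> (real \<Rightarrow> 'a) \<Rightarrow>
     'b topology \<Rightarrow> 'b chart set \<Rightarrow> ('b \<Rightarrow> real^3) \<Rightarrow> (real \<Rightarrow> 'b) \<Rightarrow> bool" where
  "agree_near_curve I X\<^sub>1 A\<^sub>1 \<psi>\<^sub>1 \<beta>\<^sub>1 X\<^sub>2 A\<^sub>2 \<psi>\<^sub>2 \<beta>\<^sub>2 \<longleftrightarrow>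
     (\<exists>W \<Phi>\<^sub>1 \<Phi>\<^sub>2. I \<times> {0} \<subseteq> W \<and> local_diffeo W X\<^sub>1 A\<^sub>1 \<Phi>\<^sub>1 \<and> local_diffeo W X\<^sub>2 A\<^sub>2 \<Phi>\<^sub>2 \<and>
        (\<forall>s\<in>I. \<Phi>\<^sub>1 (s, 0) = \<beta>\<^sub>1 s \<and> \<Phi>\<^sub>2 (s, 0) = \<beta>\<^sub>2 s) \<and>
        (\<forall>p\<in>W. \<psi>\<^sub>1 (\<Phi>\<^sub>1 p) = \<psi>\<^sub>2 (\<Phi>\<^sub>2 p)))"

end

theory Submission
  imports Defs "HOL-Complex_Analysis.Complex_Analysis"
begin

text \<open>In null coordinates \<open>(u, v)\<close> the conormal of an indefinite improper affine sphere splits as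
  \<open>N = a(u) + b(v)\<close>, and Lelieuvre's formulas \<open>\<psi>\<^sub>u = N \<times> a'\<close>, \<open>\<psi>\<^sub>v = - N \<times> b'\<close> integrate to
  \<open>\<psi> = P(u) + Q(v) + b(v) \<times> a(u)\<close> with \<open>P' = a \<times> a'\<close> and \<open>Q' = - b \<times> b'\<close>. Since moreover
  \<open>\<psi> \<times> \<xi> = a(u) - b(v)\<close>, Cauchy data on the diagonal \<open>u = v = s\<close> force
  \<open>a = (U + \<alpha> \<times> \<xi>) / 2\<close> and \<open>b = (U - \<alpha> \<times> \<xi>) / 2\<close>, and conversely these choices solve the problem.

  For uniqueness no characteristic equation has to be integrated: on every solution the maps
  \<open>(N + \<psi> \<times> \<xi>) / 2\<close> and \<open>(N - \<psi> \<times> \<xi>) / 2\<close> have rank one, so near the curve they take only the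
  values of \<open>a\<close> and of \<open>b\<close>. Inverting the projection along \<open>\<xi>\<close> lifts the \<open>(u, v)\<close>-plane
  locally to the solution, and there \<open>N = a(u) + b(v)\<close>, hence \<open>\<psi>\<close> is the surface above. The local
  lifts agree on overlaps because \<open>\<psi>\<close> is an immersion, and they glue to a lift of a strip around the
  curve.\<close>

section \<open>Functions of class \<open>C\<^sup>n\<close>\<close>

text \<open>The obstacle is regularity. A competing solution is only smooth, so power series say
  nothing about it, and null coordinates on it would have to be found by integrating its null
  directions. The rank condition avoids this because it is algebraic in first derivatives: in the
  cross product of two derivatives of \<open>N + \<psi> \<times> \<xi>\<close>, or of
  \<open>N - \<psi> \<times> \<xi>\<close>, all four terms are multiples of \<xi>, and they cancel.
  The function \<lambda> enters through the metric: on the diagonal its density in null coordinates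
  is \<lambda>/2. Hence the curve is nowhere tangent to a null direction, \<open>a'\<close> and
  \<open>b'\<close> do not vanish on it, and the two rank-one maps sweep out their curves. End
  points of \<open>I\<close> shape the analytic half. The data are given on one side there, while
  the rank argument uses \<open>a\<close> and \<open>b\<close> on both sides. So the data are
  continued to an open interval \<open>J\<close>, and for an analytic solution the identity theorem
  carries the relations between N, \<psi>, \<open>a\<close> and \<open>b\<close> to the continued
  curve. Real analyticity is expressed by holomorphic extensions, which brings in the theorems of
  complex analysis.\<close>

abbreviation fderiv :: "('a::real_normed_vector \<Rightarrow> 'b::real_normed_vector) \<Rightarrow> 'a \<Rightarrow> 'a \<Rightarrow> 'b" where
  "fderiv f x \<equiv> frechet_derivative f (at x)"

lemma fderiv_eq: "(f has_derivative f') (at x) \<Longrightarrow> fderiv f x = f'"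
  using frechet_derivative_at by metis

abbreviation hdiff_on :: "nat \<Rightarrow> 'a set \<Rightarrow> ('a::real_normed_vector \<Rightarrow> 'b::real_normed_vector) \<Rightarrow> bool" where
  "hdiff_on \<equiv> higher_differentiable_on"

lemma hdiff_on_cong:
  assumes "open S" and "\<And>x. x \<in> S \<Longrightarrow> f x = g x" and "hdiff_on n S f"
  shows "hdiff_on n S g"
  using assms(2,3)
proof (induction n arbitrary: f g)
  case 0
  then show ?case by (simp cong: continuous_on_cong)
next
  case (Suc n)
  have der: "(g has_derivative fderiv f x) (at x)" if "x \<in> S" for x
  proof -
    have "(f has_derivative fderiv f x) (at x)"
      using Suc.prems(2) that by (simp add: frechet_derivative_works)
    then show ?thesis
      by (rule has_derivative_transform_within_open[OF _ assms(1) that]) (use Suc.prems(1) in auto)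
  qed
  have "hdiff_on n S (\<lambda>x. fderiv g x v)" for v
    by (rule Suc.IH[of "\<lambda>x. fderiv f x v"]) (use Suc.prems(2) fderiv_eq[OF der] in auto)
  then show ?case
    using der by (auto simp: differentiable_def)
qed

text \<open>The derivative may be supplied as an explicit formula \<open>f'\<close>. The definition
  speaks of \<open>frechet_derivative\<close>, a choice operator, which on the open set is
  identified with that formula.\<close>

lemma hdiff_on_SucI:
  assumes "open S" and "\<And>x. x \<in> S \<Longrightarrow> (f has_derivative f' x) (at x)"
    and "\<And>v. hdiff_on n S (\<lambda>x. f' x v)"
  shows "hdiff_on (Suc n) S f"
proof -
  have "hdiff_on n S (\<lambda>x. fderiv f x v)" for v
    by (rule hdiff_on_cong[OF assms(1) _ assms(3)]) (use fderiv_eq[OF assms(2)] in auto)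
  then show ?thesis
    using assms(2) by (auto simp: differentiable_def)
qed

lemma hdiff_on_SucD:
  assumes "hdiff_on (Suc n) S f"
  shows "x \<in> S \<Longrightarrow> (f has_derivative fderiv f x) (at x)"
    and "hdiff_on n S (\<lambda>x. fderiv f x v)"
  using assms by (auto simp: frechet_derivative_works)

lemma hdiff_on_Suc_imp:
  "hdiff_on (Suc n) S f \<Longrightarrow> hdiff_on n S f"
proof (induction n arbitrary: f)
  case 0
  then show ?case
    by (auto intro!: continuous_at_imp_continuous_on differentiable_imp_continuous_within)
next
  case (Suc n)
  then show ?case
    by (metis higher_differentiable_on.simps(2))
qed

lemma hdiff_on_subset:
  "hdiff_on n S f \<Longrightarrow> T \<subseteq> S \<Longrightarrow> hdiff_on n T f"
  by (induction n arbitrary: f) (auto intro: continuous_on_subset)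

lemma hdiff_on_const: "hdiff_on n S (\<lambda>x. c)"
proof (induction n arbitrary: c)
  case (Suc n)
  have "fderiv (\<lambda>x::'a. c) x = (\<lambda>v. 0)" for x
    by (rule fderiv_eq) simp
  then show ?case
    using Suc by simp
qed simp

lemma hdiff_on_linear:
  assumes "bounded_linear L" shows "hdiff_on n S L"
proof (cases n)
  case 0
  then show ?thesis using linear_continuous_on[OF assms] by simp
next
  case (Suc m)
  have "fderiv L x = L" for x
    by (rule fderiv_eq) (rule bounded_linear_imp_has_derivative[OF assms])
  then show ?thesis
    using Suc bounded_linear_imp_differentiable[OF assms]
    by (simp add: hdiff_on_const)
qed

lemma hdiff_on_bounded_linear:
  assumes "open S" and L: "bounded_linear L"
  shows "hdiff_on n S f \<Longrightarrow> hdiff_on n S (\<lambda>x. L (f x))"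
proof (induction n arbitrary: f)
  case 0
  then show ?case by (simp add: bounded_linear.continuous_on[OF L])
next
  case (Suc n)
  show ?case
    by (rule hdiff_on_SucI[OF assms(1), where f'="\<lambda>x v. L (fderiv f x v)"])
      (use hdiff_on_SucD[OF Suc.prems] Suc.IH 
        in \<open>auto intro: bounded_linear.has_derivative[OF L]\<close>)
qed

lemma hdiff_on_add:
  assumes "open S"
  shows "hdiff_on n S f \<Longrightarrow> hdiff_on n S g \<Longrightarrow>
    hdiff_on n S (\<lambda>x. f x + g x)"
proof (induction n arbitrary: f g)
  case 0
  then show ?case by (auto intro: continuous_intros)
next
  case (Suc n)
  show ?case
    by (rule hdiff_on_SucI[OF assms(1), where f'="\<lambda>x v. fderiv f x v + fderiv g x v"])
      (use hdiff_on_SucD[OF Suc.prems(1)] hdiff_on_SucD[OF Suc.prems(2)] Suc.IH 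
        in \<open>auto intro: has_derivative_add\<close>)
qed

lemma hdiff_on_sum:
  assumes "open S" "finite B" "\<And>b. b \<in> B \<Longrightarrow> hdiff_on n S (f b)"
  shows "hdiff_on n S (\<lambda>x. \<Sum>b\<in>B. f b x)"
  using assms(2,3)
  by (induction B rule: finite_induct)
    (auto intro: hdiff_on_add[OF assms(1)] hdiff_on_const)

lemma hdiff_on_bilinear:
  assumes "open S" and B: "bounded_bilinear B"
  shows "hdiff_on n S f \<Longrightarrow> hdiff_on n S g \<Longrightarrow>
    hdiff_on n S (\<lambda>x. B (f x) (g x))"
proof (induction n arbitrary: f g)
  case 0
  then show ?case by (simp add: bounded_bilinear.continuous_on[OF B])
next
  case (Suc n)
  show ?case
    by (rule hdiff_on_SucI[OF assms(1),
          where f'="\<lambda>x v. B (f x) (fderiv g x v) + B (fderiv f x v) (g x)"])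
      (use hdiff_on_SucD[OF Suc.prems(1)] hdiff_on_SucD[OF Suc.prems(2)] 
         Suc.IH hdiff_on_Suc_imp[OF Suc.prems(1)] hdiff_on_Suc_imp[OF Suc.prems(2)]
        in \<open>auto intro!: bounded_bilinear.FDERIV[OF B] hdiff_on_add[OF assms(1)]\<close>)
qed

lemma hdiff_on_inverse:
  fixes f :: "'a::real_normed_vector \<Rightarrow> real"
  assumes "open S" and nz: "\<And>x. x \<in> S \<Longrightarrow> f x \<noteq> 0"
  shows "hdiff_on n S f \<Longrightarrow> hdiff_on n S (\<lambda>x. inverse (f x))"
proof (induction n)
  case 0
  then show ?case using nz by (auto intro: continuous_intros)
next
  case (Suc n)
  note IH = Suc.IH[OF hdiff_on_Suc_imp[OF Suc.prems]]
  note * = hdiff_on_bilinear[OF assms(1) bounded_bilinear_mult]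
  show ?case
    by (rule hdiff_on_SucI[OF assms(1),
          where f'="\<lambda>x v. - (inverse (f x) * fderiv f x v * inverse (f x))"])
      (use hdiff_on_SucD[OF Suc.prems] IH nz
        in \<open>auto intro!: has_derivative_inverse * hdiff_on_bounded_linear[OF assms(1) bounded_linear_minus[OF bounded_linear_ident]]\<close>)
qed

text \<open>The definition tests derivatives in a fixed direction, but the chain rule produces
  \<open>fderiv g (f x)\<close> in the direction \<open>fderiv f x v\<close>, which moves with
  \<open>x\<close>. Expanding this direction in \<open>Basis\<close> leaves a finite sum of
  products, to which the induction hypothesis applies; this is why the inner function has values in
  a Euclidean space.\<close>

lemma hdiff_on_compose:
  fixes f :: "'a::real_normed_vector \<Rightarrow> 'b::euclidean_space"
  assumes "open S" "open T" "f ` S \<subseteq> T"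
  shows "hdiff_on n T g \<Longrightarrow> hdiff_on n S f \<Longrightarrow>
    hdiff_on n S (\<lambda>x. g (f x))"
proof (induction n arbitrary: g)
  case 0
  then show ?case using assms(3) by (auto intro: continuous_on_compose2)
next
  case (Suc n)
  note g = hdiff_on_SucD[OF Suc.prems(1)]
  note f = hdiff_on_SucD[OF Suc.prems(2)]
  have lin: "fderiv g (f x) w = (\<Sum>b\<in>Basis. (w \<bullet> b) *\<^sub>R fderiv g (f x) b)" if "x \<in> S" for x w
  proof -
    have "linear (fderiv g (f x))"
      using g(1)[of "f x"] that assms(3) has_derivative_linear by blast
    then show ?thesis
      by (subst euclidean_representation[symmetric, of w]) 
        (simp only: linear_sum linear_scale)
  qed
  show ?case
  proof (rule hdiff_on_SucI[OF assms(1), where f'="\<lambda>x v. fderiv g (f x) (fderiv f x v)"])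
    show "((\<lambda>x. g (f x)) has_derivative (\<lambda>v. fderiv g (f x) (fderiv f x v))) (at x)" if "x \<in> S" for x
      by (rule has_derivative_compose[OF f(1)[OF that] g(1)]) (use that assms(3) in auto)
    fix v
    have "hdiff_on n S (\<lambda>x. \<Sum>b\<in>Basis. (fderiv f x v \<bullet> b) *\<^sub>R fderiv g (f x) b)"
      by (intro hdiff_on_sum[OF assms(1) finite_Basis]
          hdiff_on_bilinear[OF assms(1) bounded_bilinear_scaleR]
          hdiff_on_bounded_linear[OF assms(1) bounded_linear_inner_left] f
          Suc.IH g hdiff_on_Suc_imp[OF Suc.prems(2)])
    then show "hdiff_on n S (\<lambda>x. fderiv g (f x) (fderiv f x v))"
      by (rule hdiff_on_cong[OF assms(1), rotated]) (metis lin)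
  qed
qed

section \<open>Smoothness as the conjunction of all finite orders of differentiability\<close>

lemma smooth_on_fderiv: "smooth_on S f \<Longrightarrow> smooth_on S (\<lambda>x. fderiv f x v)"
  unfolding smooth_on_def using hdiff_on_SucD(2) by blast

lemma smooth_on_has_derivative: "smooth_on S f \<Longrightarrow> x \<in> S \<Longrightarrow> (f has_derivative fderiv f x) (at x)"
  unfolding smooth_on_def using hdiff_on_SucD(1) by blast

lemma smooth_on_continuous_on: "smooth_on S f \<Longrightarrow> continuous_on S f"
  unfolding smooth_on_def using higher_differentiable_on.simps(1) by blast

lemma smooth_on_cong: "open S \<Longrightarrow> smooth_on S f \<Longrightarrow> (\<And>x. x \<in> S \<Longrightarrow> f x = g x) \<Longrightarrow> smooth_on S g"
  unfolding smooth_on_def using hdiff_on_cong[of S f g] by blast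

lemma smooth_on_subset: "smooth_on S f \<Longrightarrow> T \<subseteq> S \<Longrightarrow> smooth_on T f"
  unfolding smooth_on_def using hdiff_on_subset by blast

lemma smooth_on_const: "smooth_on S (\<lambda>x. c)"
  by (simp add: smooth_on_def hdiff_on_const)

lemma smooth_on_linear: "bounded_linear L \<Longrightarrow> smooth_on S L"
  by (simp add: smooth_on_def hdiff_on_linear)

lemma smooth_on_bounded_linear: "open S \<Longrightarrow> bounded_linear L \<Longrightarrow> smooth_on S f \<Longrightarrow> smooth_on S (\<lambda>x. L (f x))"
  by (simp add: smooth_on_def hdiff_on_bounded_linear)

lemma smooth_on_add: "open S \<Longrightarrow> smooth_on S f \<Longrightarrow> smooth_on S g \<Longrightarrow> smooth_on S (\<lambda>x. f x + g x)"
  by (simp add: smooth_on_def hdiff_on_add)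

lemma smooth_on_bilinear:
  "open S \<Longrightarrow> bounded_bilinear B \<Longrightarrow> smooth_on S f \<Longrightarrow> smooth_on S g \<Longrightarrow> smooth_on S (\<lambda>x. B (f x) (g x))"
  by (simp add: smooth_on_def hdiff_on_bilinear)

lemma smooth_on_inverse:
  fixes f :: "'a::real_normed_vector \<Rightarrow> real"
  shows "open S \<Longrightarrow> smooth_on S f \<Longrightarrow> (\<And>x. x \<in> S \<Longrightarrow> f x \<noteq> 0) \<Longrightarrow> smooth_on S (\<lambda>x. inverse (f x))"
  by (simp add: smooth_on_def hdiff_on_inverse)

lemma smooth_on_compose:
  fixes f :: "'a::real_normed_vector \<Rightarrow> 'b::euclidean_space"
  shows "open S \<Longrightarrow> open T \<Longrightarrow> f ` S \<subseteq> T \<Longrightarrow> smooth_on T g \<Longrightarrow> smooth_on S f \<Longrightarrow> smooth_on S (\<lambda>x. g (f x))"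
  by (simp add: smooth_on_def hdiff_on_compose)

section \<open>Real-analytic germs in one variable\<close>

text \<open>Analyticity at a point, encoded as being the restriction of a holomorphic function.
  Zeros, derivatives, primitives and compositions can then be treated in the complex plane. Since
  agreement is asked only near \<open>s\<close>, the values of \<open>f\<close> elsewhere are
  irrelevant.\<close>

definition real_germ :: "(real \<Rightarrow> real) \<Rightarrow> real \<Rightarrow> bool" where
  "real_germ f s \<longleftrightarrow>
     (\<exists>F. F analytic_on {complex_of_real s} \<and>
        (\<forall>\<^sub>F t in nhds s. F (of_real t) = of_real (f t)))"

lemma real_germI:
  "F analytic_on {complex_of_real s} \<Longrightarrow> (\<forall>\<^sub>F t in nhds s. F (of_real t) = of_real (f t)) \<Longrightarrow> real_germ f s"
  unfolding real_germ_def by blast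

lemma real_germ_ball:
  assumes "real_germ f s"
  obtains F r where "r > 0" "F holomorphic_on ball (of_real s) r"
    "\<And>t. \<bar>t - s\<bar> < r \<Longrightarrow> F (complex_of_real t) = of_real (f t)"
proof -
  obtain F where F: "F analytic_on {complex_of_real s}"
    and e: "\<forall>\<^sub>F t in nhds s. F (of_real t) = of_real (f t)"
    using assms unfolding real_germ_def by blast
  obtain r1 where r1: "r1 > 0" "F holomorphic_on ball (of_real s) r1"
    using F unfolding analytic_at_ball by blast
  obtain r2 where r2: "r2 > 0" "\<And>t. dist t s < r2 \<Longrightarrow> F (of_real t) = of_real (f t)"
    using e unfolding eventually_nhds_metric by blast
  show ?thesis
    by (rule that[of "min r1 r2" F]) (use r1 r2 in \<open>auto simp: dist_real_def intro: holomorphic_on_subset\<close>)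
qed

lemma real_germ_cong:
  assumes "real_germ f s" "\<forall>\<^sub>F t in nhds s. f t = g t" shows "real_germ g s"
proof -
  obtain F where F: "F analytic_on {complex_of_real s}"
    and e: "\<forall>\<^sub>F t in nhds s. F (of_real t) = of_real (f t)"
    using assms unfolding real_germ_def by blast
  have "\<forall>\<^sub>F t in nhds s. F (of_real t) = of_real (g t)"
    using e assms(2) by eventually_elim simp
  then show ?thesis using F real_germI by blast
qed

lemma real_germ_eventually: 
  assumes "real_germ f s" shows "\<forall>\<^sub>F t in nhds s. real_germ f t"
proof -
  obtain F r where F: "r > 0" "F holomorphic_on ball (of_real s) r"
    "\<And>t. \<bar>t - s\<bar> < r \<Longrightarrow> F (complex_of_real t) = of_real (f t)"
    by (rule real_germ_ball[OF assms]) blast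
  have "real_germ f t" if "dist t s < r" for t
  proof (rule real_germI)
    show "F analytic_on {complex_of_real t}"
      by (rule analytic_on_subset[of _ "ball (of_real s) r"])
        (use F that in \<open>auto simp: analytic_on_open dist_commute\<close>)
    have "\<forall>\<^sub>F u in nhds t. u \<in> ball s r"
      by (rule eventually_nhds_in_open) (use that in \<open>auto simp: dist_commute\<close>)
    then show "\<forall>\<^sub>F u in nhds t. F (complex_of_real u) = complex_of_real (f u)"
      by eventually_elim (use F(3) in \<open>auto simp: dist_real_def abs_minus_commute\<close>)
  qed
  then show ?thesis
    using F(1) unfolding eventually_nhds_metric by blast
qed

lemma real_germ_const: "real_germ (\<lambda>t. c) s"
  by (rule real_germI[of "\<lambda>z. of_real c"]) auto

lemma real_germ_ident: "real_germ (\<lambda>t. t) s"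
  by (rule real_germI[of "\<lambda>z. z"]) auto

lemma real_germ_add:
  assumes "real_germ f s" "real_germ g s" shows "real_germ (\<lambda>t. f t + g t) s"
proof -
  obtain F G where F: "F analytic_on {complex_of_real s}" "\<forall>\<^sub>F t in nhds s. F (of_real t) = of_real (f t)"
    and G: "G analytic_on {complex_of_real s}" "\<forall>\<^sub>F t in nhds s. G (of_real t) = of_real (g t)"
    using assms unfolding real_germ_def by blast
  show ?thesis
    by (rule real_germI[of "\<lambda>z. F z + G z"])
      (use F(1) G(1) eventually_conj[OF F(2) G(2)] in \<open>auto intro: analytic_intros elim: eventually_mono\<close>)
qed

lemma real_germ_mult:
  assumes "real_germ f s" "real_germ g s" shows "real_germ (\<lambda>t. f t * g t) s"
proof -
  obtain F G where F: "F analytic_on {complex_of_real s}" "\<forall>\<^sub>F t in nhds s. F (of_real t) = of_real (f t)"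
    and G: "G analytic_on {complex_of_real s}" "\<forall>\<^sub>F t in nhds s. G (of_real t) = of_real (g t)"
    using assms unfolding real_germ_def by blast
  show ?thesis
    by (rule real_germI[of "\<lambda>z. F z * G z"])
      (use F(1) G(1) eventually_conj[OF F(2) G(2)] in \<open>auto intro: analytic_intros elim: eventually_mono\<close>)
qed

lemma real_germ_minus: "real_germ f s \<Longrightarrow> real_germ (\<lambda>t. - f t) s"
  using real_germ_mult[OF real_germ_const[of "-1"]] by simp

lemma real_germ_diff: "real_germ f s \<Longrightarrow> real_germ g s \<Longrightarrow> real_germ (\<lambda>t. f t - g t) s"
  using real_germ_add[OF _ real_germ_minus] by simp

lemma real_germ_sum:
  "(\<And>i. i \<in> B \<Longrightarrow> real_germ (f i) s) \<Longrightarrow> real_germ (\<lambda>t. \<Sum>i\<in>B. f i t) s"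
  by (induction B rule: infinite_finite_induct) (auto intro: real_germ_add real_germ_const)

text \<open>At real points the complex derivative of the extension is the derivative of the curve
  \<open>of_real (f t)\<close>. Its imaginary part is therefore zero, its real part is the
  derivative of \<open>f\<close>, and \<open>deriv F\<close> is again a holomorphic
  extension.\<close>

lemma real_germ_deriv:
  assumes "real_germ f s"
  obtains f' where "real_germ f' s" "\<forall>\<^sub>F t in nhds s. (f has_real_derivative f' t) (at t)"
proof -
  obtain F r where F: "r > 0" "F holomorphic_on ball (of_real s) r"
    "\<And>t. \<bar>t - s\<bar> < r \<Longrightarrow> F (complex_of_real t) = of_real (f t)"
    by (rule real_germ_ball[OF assms]) blast
  have der: "((\<lambda>t. complex_of_real (f t)) has_vector_derivative deriv F (of_real t)) (at t)"
    if "\<bar>t - s\<bar> < r" for t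
  proof -
    have "of_real t \<in> ball (complex_of_real s) r"
      using that by (simp add: dist_of_real dist_real_def abs_minus_commute)
    then have "(F has_field_derivative deriv F (of_real t)) (at (of_real t))"
      using F(2) holomorphic_derivI[of F "ball (complex_of_real s) r"] by blast
    then have "((\<lambda>t. F (of_real t)) has_vector_derivative deriv F (of_real t)) (at t)"
      by (rule has_vector_derivative_real_field)
    then show ?thesis
      by (rule has_vector_derivative_transform_within_open[of _ _ _ "ball s r"])
        (use that F in \<open>auto simp: dist_real_def abs_minus_commute\<close>)
  qed
  have re: "(f has_real_derivative Re (deriv F (of_real t))) (at t)" if "\<bar>t - s\<bar> < r" for t
    using bounded_linear.has_vector_derivative[OF bounded_linear_Re der[OF that]]
    by (simp add: has_real_derivative_iff_has_vector_derivative)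
  have im: "Im (deriv F (of_real t)) = 0" if "\<bar>t - s\<bar> < r" for t
    using bounded_linear.has_vector_derivative[OF bounded_linear_Im der[OF that]]
    by (simp) (metis has_vector_derivative_const vector_derivative_unique_at)
  have ev: "\<forall>\<^sub>F t in nhds s. \<bar>t - s\<bar> < r"
    using F(1) unfolding eventually_nhds_metric dist_real_def by blast
  show ?thesis
  proof (rule that[of "\<lambda>t. Re (deriv F (of_real t))"])
    show "real_germ (\<lambda>t. Re (deriv F (complex_of_real t))) s"
    proof (rule real_germI[of "deriv F"])
      show "deriv F analytic_on {complex_of_real s}"
        by (rule analytic_on_subset[OF analytic_deriv[of _ "ball (of_real s) r"]])
          (use F in \<open>auto simp: analytic_on_open\<close>)
      show "\<forall>\<^sub>F t in nhds s. deriv F (complex_of_real t) = complex_of_real (Re (deriv F (complex_of_real t)))"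
        using ev by eventually_elim (use im in \<open>auto simp: complex_eq_iff\<close>)
    qed
    show "\<forall>\<^sub>F t in nhds s. (f has_real_derivative Re (deriv F (complex_of_real t))) (at t)"
      using ev by eventually_elim (rule re)
  qed
qed

lemma real_germ_of_deriv:
  assumes "real_germ f s" "\<forall>\<^sub>F t in nhds s. (f has_real_derivative f' t) (at t)"
  shows "real_germ f' s"
proof -
  obtain g where g: "real_germ g s" "\<forall>\<^sub>F t in nhds s. (f has_real_derivative g t) (at t)"
    by (rule real_germ_deriv[OF assms(1)])
  have "\<forall>\<^sub>F t in nhds s. g t = f' t"
    using g(2) assms(2) by eventually_elim (rule DERIV_unique)
  then show ?thesis using g(1) real_germ_cong by blast
qed

text \<open>On a disc, which is convex, the extension of \<open>f\<close> has a holomorphic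
  primitive. Along the real axis it differs from \<open>g\<close> by a constant, a priori a complex
  one, which is subtracted.\<close>

lemma real_germ_primitive:
  assumes "real_germ f s" "\<forall>\<^sub>F t in nhds s. (g has_real_derivative f t) (at t)"
  shows "real_germ g s"
proof -
  obtain F r1 where F: "r1 > 0" "F holomorphic_on ball (of_real s) r1"
    "\<And>t. \<bar>t - s\<bar> < r1 \<Longrightarrow> F (complex_of_real t) = of_real (f t)"
    by (rule real_germ_ball[OF assms(1)]) blast
  obtain r2 where r2: "r2 > 0" "\<And>t. dist t s < r2 \<Longrightarrow> (g has_real_derivative f t) (at t)"
    using assms(2) unfolding eventually_nhds_metric by blast
  define r where "r = min r1 r2"
  obtain G where G: "\<And>z. z \<in> ball (of_real s) r1 \<Longrightarrow> (G has_field_derivative F z) (at z)"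
  proof (rule holomorphic_convex_primitive'[OF convex_ball open_ball F(2)])
    fix G assume G: "\<And>x. x \<in> ball (of_real s) r1 \<Longrightarrow> (G has_field_derivative F x) (at x within ball (of_real s) r1)"
    show thesis
      by (rule that[of G]) (use G in \<open>simp add: at_within_open[OF _ open_ball]\<close>)
  qed
  have "\<exists>c. \<forall>t\<in>ball s r. G (of_real t) - of_real (g t) = c"
  proof (rule has_derivative_zero_constant)
    fix t assume "t \<in> ball s r"
    then have t: "\<bar>t - s\<bar> < r1" "dist t s < r2"
      by (auto simp: r_def dist_real_def)
    then have "of_real t \<in> ball (complex_of_real s) r1"
      by (simp add: dist_of_real dist_real_def abs_minus_commute)
    from has_vector_derivative_real_field[OF G[OF this]]
    have 1: "((\<lambda>t. G (of_real t)) has_vector_derivative of_real (f t)) (at t)"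
      using F(3)[OF t(1)] by simp
    have 2: "((\<lambda>t. complex_of_real (g t)) has_vector_derivative of_real (f t)) (at t)"
      using r2(2)[OF t(2)] by (simp add: has_real_derivative_iff_has_vector_derivative has_vector_derivative_of_real)
    from has_vector_derivative_diff[OF 1 2]
    have "((\<lambda>t. G (of_real t) - of_real (g t)) has_vector_derivative 0) (at t)" by simp
    then show "((\<lambda>t. G (of_real t) - of_real (g t)) has_derivative (\<lambda>h. 0)) (at t within ball s r)"
      by (simp add: has_vector_derivative_def has_derivative_at_withinI)
  qed simp
  then obtain c where c: "\<And>t. t \<in> ball s r \<Longrightarrow> G (of_real t) - of_real (g t) = c" by blast
  show ?thesis
  proof (rule real_germI[of "\<lambda>z. G z - c"])
    have "G holomorphic_on ball (of_real s) r1"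
      using G unfolding holomorphic_on_open[OF open_ball] by blast
    then show "(\<lambda>z. G z - c) analytic_on {complex_of_real s}"
      using F(1) by (intro analytic_on_diff analytic_on_const holomorphic_on_imp_analytic_at[of _ "ball (of_real s) r1"]) auto
    have "\<forall>\<^sub>F t in nhds s. t \<in> ball s r"
      by (rule eventually_nhds_in_open) (use F(1) r2(1) in \<open>auto simp: r_def\<close>)
    then show "\<forall>\<^sub>F t in nhds s. G (complex_of_real t) - c = complex_of_real (g t)"
      by eventually_elim (metis c add_diff_cancel_left' diff_add_cancel diff_diff_eq2)
  qed
qed

text \<open>The holomorphic extension of the difference has zeros accumulating at \<open>s\<close>.
  Accumulation from one side is enough, so the lemma can be applied at an end point of an
  interval.\<close>

lemma real_germ_identity:
  assumes "real_germ f s" "real_germ g s" "\<exists>\<^sub>F t in at s. f t = g t"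
  shows "\<forall>\<^sub>F t in nhds s. f t = g t"
proof -
  obtain F r where F: "r > 0" "F holomorphic_on ball (of_real s) r"
    "\<And>t. \<bar>t - s\<bar> < r \<Longrightarrow> F (complex_of_real t) = of_real (f t - g t)"
    by (rule real_germ_ball[OF real_germ_diff[OF assms(1,2)]]) blast
  let ?Z = "{z \<in> ball (complex_of_real s) r. F z = 0}"
  have "of_real s islimpt ?Z"
    unfolding islimpt_approachable
  proof (intro allI impI)
    fix e :: real assume "e > 0"
    then have "\<forall>\<^sub>F t in at s. t \<noteq> s \<and> dist t s < min e r"
      using F(1) unfolding eventually_at by (intro exI[of _ "min e r"]) auto
    from frequently_eventually_frequently[OF assms(3) this]
    have "\<exists>\<^sub>F t in at s. f t = g t \<and> t \<noteq> s \<and> dist t s < min e r" .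
    then obtain t where t: "t \<noteq> s" "f t = g t" "dist t s < min e r"
      using frequently_ex by blast
    have "F (of_real t) = 0"
      using F(3)[of t] t(2,3) by (simp add: dist_real_def)
    moreover have "dist (complex_of_real t) (of_real s) = dist t s"
      by (rule dist_of_real)
    ultimately show "\<exists>x'\<in>?Z. x' \<noteq> complex_of_real s \<and> dist x' (complex_of_real s) < e"
      using t(1,3) by (intro bexI[of _ "of_real t"]) 
        (simp_all only: mem_Collect_eq mem_ball dist_commute[of "complex_of_real s"] of_real_eq_iff min_less_iff_conj simp_thms)
  qed
  note lim = this
  have Z: "F z = 0" if "z \<in> ball (of_real s) r" for z
    by (rule analytic_continuation[OF F(2) open_ball connected_ball, of ?Z "of_real s" z])
      (use that F(1) lim in auto)
  have "\<forall>\<^sub>F t in nhds s. \<bar>t - s\<bar> < r"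
    using F(1) unfolding eventually_nhds_metric dist_real_def by blast
  then show ?thesis
  proof eventually_elim
    case (elim t)
    then have "of_real t \<in> ball (complex_of_real s) r"
      by (simp add: dist_of_real dist_real_def abs_minus_commute)
    then have "of_real (f t - g t) = (0::complex)"
      using Z F(3)[OF elim] by simp
    then show "f t = g t" by simp
  qed
qed

text \<open>Convergence at one point besides the centre gives convergence on a complex disc, and
  thus values on both sides of \<open>s\<close>, even if the series is known to represent a given
  function on one side only.\<close>

lemma real_germ_power_series:
  fixes a :: "nat \<Rightarrow> real"
  assumes "summable (\<lambda>n. a n * (t1 - s) ^ n)" "t1 \<noteq> s"
  shows "real_germ (\<lambda>t. \<Sum>n. a n * (t - s) ^ n) s"
proof -
  let ?r = "\<bar>t1 - s\<bar>"
  let ?F = "\<lambda>z. \<Sum>n. complex_of_real (a n) * (z - of_real s) ^ n"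
  have "summable (\<lambda>n. complex_of_real (a n) * of_real (t1 - s) ^ n)"
    using summable_of_real[OF assms(1), where 'a=complex] by simp
  then have S: "summable (\<lambda>n. complex_of_real (a n) * w ^ n)" if "norm w < ?r" for w
    by (rule powser_inside) (use that in \<open>simp only: norm_of_real\<close>)
  have "?F holomorphic_on ball (of_real s) ?r"
    by (rule power_series_holomorphic[of _ _ "\<lambda>n. of_real (a n)"])
      (auto intro!: summable_sums S simp: dist_norm norm_minus_commute)
  moreover have "?F (of_real t) = of_real (\<Sum>n. a n * (t - s) ^ n)" if "\<bar>t - s\<bar> < ?r" for t
  proof -
    have "summable (\<lambda>n. a n * (t - s) ^ n)"
      by (rule powser_inside[OF assms(1)]) (use that in simp)
    from suminf_of_real[OF this, where 'a=complex] show ?thesis by simp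
  qed
  moreover have "\<forall>\<^sub>F t in nhds s. \<bar>t - s\<bar> < ?r"
    using assms(2) unfolding eventually_nhds_metric dist_real_def by (metis zero_less_abs_iff right_minus_eq)
  ultimately show ?thesis
    using assms(2) 
    by (intro real_germI[of ?F] holomorphic_on_imp_analytic_at[of _ "ball (of_real s) ?r"])
      (auto elim!: eventually_mono)
qed

text \<open>The coefficients are the real parts of the complex Taylor coefficients. Absolute
  convergence follows from convergence at a larger argument; it allows the product of two expansions
  to be summed over pairs of indices.\<close>

lemma real_germ_expansion:
  assumes "real_germ f s"
  obtains r a where "r > 0" 
    "\<And>h. \<bar>h\<bar> < r \<Longrightarrow> summable (\<lambda>n. \<bar>a n * h ^ n\<bar>)"
    "\<And>h. \<bar>h\<bar> < r \<Longrightarrow> (\<lambda>n. a n * h ^ n) sums f (s + h)"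
proof -
  obtain F r where F: "r > 0" "F holomorphic_on ball (of_real s) r"
    "\<And>t. \<bar>t - s\<bar> < r \<Longrightarrow> F (complex_of_real t) = of_real (f t)"
    by (rule real_germ_ball[OF assms]) blast
  define a where "a n = Re ((deriv ^^ n) F (of_real s) / fact n)" for n
  have S: "(\<lambda>n. a n * h ^ n) sums f (s + h)" if "\<bar>h\<bar> < r" for h
  proof -
    have "of_real (s + h) \<in> ball (complex_of_real s) r"
      using that by (simp add: dist_norm)
    from holomorphic_power_series[OF F(2) this]
    have "(\<lambda>n. (deriv ^^ n) F (of_real s) / fact n * of_real (h ^ n)) sums of_real (f (s + h))"
      using F(3)[of "s + h"] that by simp
    from sums_Re[OF this] show ?thesis by (simp only: Re_complex_of_real times_complex.simps Im_complex_of_real a_def) simp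
  qed
  show ?thesis
  proof (rule that[OF F(1) _ S])
    fix h :: real assume h: "\<bar>h\<bar> < r"
    then obtain h' where "\<bar>h\<bar> < h'" "h' < r" using dense by blast
    with S[of h'] have "summable (\<lambda>n. a n * h' ^ n)" "norm h < norm h'" by (auto simp: sums_iff)
    from powser_insidea[OF this] show "summable (\<lambda>n. \<bar>a n * h ^ n\<bar>)" by simp
  qed
qed

lemma smooth_on_real_germ:
  assumes "open J" "\<And>s. s \<in> J \<Longrightarrow> real_germ f s"
  shows "smooth_on J f"
proof -
  have "hdiff_on n J f" for n
    using assms(2)
  proof (induction n arbitrary: f)
    case 0
    have "isCont f s" if s: "s \<in> J" for s
      using real_germ_deriv[OF 0[OF s]] DERIV_isCont eventually_nhds_x_imp_x by metis
    then show ?case by (simp add: continuous_at_imp_continuous_on)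
  next
    case (Suc n)
    have der: "\<forall>\<^sub>F t in nhds s. (f has_real_derivative deriv f t) (at t)" if "s \<in> J" for s
    proof (rule real_germ_deriv[OF Suc.prems[OF that]])
      fix f' assume "\<forall>\<^sub>F t in nhds s. (f has_real_derivative f' t) (at t)"
      then show ?thesis by eventually_elim (simp add: DERIV_imp_deriv)
    qed
    show ?case
    proof (rule hdiff_on_SucI[OF assms(1), where f'="\<lambda>x v. v * deriv f x"])
      show "(f has_derivative (\<lambda>v. v * deriv f x)) (at x)" if "x \<in> J" for x
        using eventually_nhds_x_imp_x[OF der[OF that]] unfolding has_field_derivative_def
        by (rule has_derivative_eq_rhs) (simp add: fun_eq_iff)
      show "hdiff_on n J (\<lambda>x. v * deriv f x)" for v
        by (rule hdiff_on_bounded_linear[OF assms(1) bounded_linear_mult_right])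
          (rule Suc.IH, rule real_germ_of_deriv[OF Suc.prems der])
    qed
  qed
  then show ?thesis by (simp add: smooth_on_def)
qed

section \<open>Immersed surfaces transversal to a vector\<close>

unbundle cross3_syntax

lemma bounded_bilinear_cross3: "bounded_bilinear (\<times>)"
  using bilinear_cross bilinear_conv_bounded_bilinear by blast

lemma triple_det_cross: "triple_det a b c = (a \<times> b) \<bullet> c"
  by (simp add: triple_det_def dot_cross_det[symmetric]) (metis cross_triple inner_commute)

text \<open>Cramer's rule for the expansion of \<open>y\<close> in \<open>p\<close>,
  \<open>q\<close>, \<open>r\<close>, multiplied by the determinant. In this form it is a polynomial
  identity and covers dependent vectors as well.\<close>

lemma cross3_cramer:
  "((p \<times> q) \<bullet> r) *\<^sub>R y = ((y \<times> q) \<bullet> r) *\<^sub>R p + ((p \<times> y) \<bullet> r) *\<^sub>R q + ((p \<times> q) \<bullet> y) *\<^sub>R r"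
  unfolding vec_eq_iff forall_3
  by (simp only: vector_add_component vector_scaleR_component cross_components inner_vec_def sum_3 inner_real_def real_scaleR_def)
    (intro conjI; algebra)

lemma linear_pair_expand:
  fixes L :: "real \<times> real \<Rightarrow> 'b::real_vector"
  assumes "linear L" shows "L v = fst v *\<^sub>R L (1, 0) + snd v *\<^sub>R L (0, 1)"
proof -
  have "L v = L (fst v *\<^sub>R (1, 0) + snd v *\<^sub>R (0, 1))" by simp
  then show ?thesis by (simp only: linear_add[OF assms] linear_scale[OF assms])
qed

text \<open>Both sides say that the images of the basis vectors together with \<xi> are linearly
  independent. The right-hand side is the nonvanishing of a single function, which can be
  differentiated and inverted along with the immersion.\<close>

lemma transversal_iff:
  fixes L :: "real \<times> real \<Rightarrow> real^3"
  assumes L: "linear L"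
  shows "inj L \<and> \<xi> \<notin> range L \<longleftrightarrow> (L (1, 0) \<times> L (0, 1)) \<bullet> \<xi> \<noteq> 0" (is "?l \<longleftrightarrow> ?r")
proof
  let ?p = "L (1, 0)" and ?q = "L (0, 1)"
  have ex: "L (x, y) = x *\<^sub>R ?p + y *\<^sub>R ?q" for x y
    using linear_pair_expand[OF L, of "(x, y)"] by simp
  assume l: ?l
  then have inj: "L v = 0 \<Longrightarrow> v = 0" for v
    using linear_injective_0[OF L] by blast
  show ?r
  proof
    assume z: "(?p \<times> ?q) \<bullet> \<xi> = 0"
    define m where "m = ?p \<times> ?q"
    show False
    proof (cases "m = 0")
      case True
      \<comment> \<open>The Lagrange formula turns this into a linear relation between
        \<open>?p\<close> and \<open>?q\<close>, that is, into a kernel vector of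
        \<open>L\<close>.\<close>
      then have "?p \<times> (?p \<times> ?q) = 0" by (simp add: m_def)
      then have "L (?p \<bullet> ?q, - (?p \<bullet> ?p)) = 0"
        using ex[of "?p \<bullet> ?q" "- (?p \<bullet> ?p)"] by (simp add: Lagrange)
      from inj[OF this] have "?p = 0" by (simp add: zero_prod_def)
      from inj[OF this] show False by (simp add: zero_prod_def)
    next
      case False
      \<comment> \<open>For \<xi> orthogonal to the normal \<open>m\<close> the double product gives
        \<xi> back up to the factor \<open>m \<bullet> m\<close>, and expanding it in the other way
        places \<xi> in the span of \<open>?p\<close> and \<open>?q\<close>.\<close>
      have "(m \<bullet> m) *\<^sub>R \<xi> = m \<times> (\<xi> \<times> m)"
        using z[folded m_def] by (simp add: Lagrange)
      also have "\<dots> = (\<xi> \<bullet> ?q) *\<^sub>R (m \<times> ?p) - (\<xi> \<bullet> ?p) *\<^sub>R (m \<times> ?q)"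
        unfolding m_def Lagrange[of \<xi>] by (simp add: Cross3.right_diff_distrib cross_mult_right)
      also have "m \<times> ?p = (?p \<bullet> ?p) *\<^sub>R ?q - (?p \<bullet> ?q) *\<^sub>R ?p"
        unfolding m_def by (subst cross_skew) (simp add: Lagrange)
      also have "m \<times> ?q = (?p \<bullet> ?q) *\<^sub>R ?q - (?q \<bullet> ?q) *\<^sub>R ?p"
        unfolding m_def by (subst cross_skew) (simp add: Lagrange inner_commute)
      finally have "(m \<bullet> m) *\<^sub>R \<xi> \<in> range L"
        by (auto intro!: linear_subspace_image[OF L] subspace_diff subspace_scale subspace_UNIV)
      then obtain v where "(m \<bullet> m) *\<^sub>R \<xi> = L v" by blast
      then have "\<xi> = L ((1 / (m \<bullet> m)) *\<^sub>R v)"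
        using False linear_scale[OF L, of "1 / (m \<bullet> m)" v] by (metis divideR_right inner_eq_zero_iff inverse_eq_divide)
      then show False using l by blast
    qed
  qed
next
  let ?p = "L (1, 0)" and ?q = "L (0, 1)"
  have ex: "L v = fst v *\<^sub>R ?p + snd v *\<^sub>R ?q" for v
    by (rule linear_pair_expand[OF L])
  assume r: ?r
  show ?l
  proof
    show "inj L"
      unfolding linear_injective_0[OF L]
    proof (intro allI impI)
      fix v assume "L v = 0"
      then have v: "fst v *\<^sub>R ?p + snd v *\<^sub>R ?q = 0" using ex[of v] by simp
      have "((fst v *\<^sub>R ?p + snd v *\<^sub>R ?q) \<times> ?q) \<bullet> \<xi> = fst v * ((?p \<times> ?q) \<bullet> \<xi>)"
        "(?p \<times> (fst v *\<^sub>R ?p + snd v *\<^sub>R ?q)) \<bullet> \<xi> = snd v * ((?p \<times> ?q) \<bullet> \<xi>)"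
        by (simp_all add: cross_add_left cross_add_right cross_mult_left cross_mult_right)
      then show "v = 0" using r unfolding v by (simp add: prod_eq_iff)
    qed
    show "\<xi> \<notin> range L"
    proof
      assume "\<xi> \<in> range L"
      then obtain v where "\<xi> = fst v *\<^sub>R ?p + snd v *\<^sub>R ?q" using ex by blast
      then have "(?p \<times> ?q) \<bullet> \<xi> = 0"
        by (simp add: inner_add_right dot_cross_self)
      then show False using r by simp
    qed
  qed
qed

text \<open>Composed with such a projection, an immersion transversal to \<xi> becomes a map between
  planes with invertible differential, so that the inverse function theorem applies. The coordinates
  are inner products with two orthogonal vectors \<open>m\<close> and
  \<open>\<xi> \<times> m\<close> that span the complement of \<xi>.\<close>

lemma projection_along:
  fixes \<xi> :: "real^3"
  assumes "\<xi> \<noteq> 0"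
  obtains \<pi> :: "real^3 \<Rightarrow> real \<times> real" where "bounded_linear \<pi>" "\<And>x. \<pi> x = 0 \<longleftrightarrow> (\<exists>t. x = t *\<^sub>R \<xi>)"
proof -
  obtain m :: "real^3" where m: "m \<noteq> 0" "orthogonal \<xi> m"
    using orthogonal_to_vector_exists[of \<xi>] by auto
  then have m0: "\<xi> \<bullet> m = 0" "m \<bullet> \<xi> = 0" by (simp_all add: orthogonal_def inner_commute)
  let ?n = "\<xi> \<times> m"
  let ?\<pi> = "\<lambda>x. (x \<bullet> m, x \<bullet> ?n)"
  have D: "(m \<times> ?n) \<bullet> \<xi> = (m \<bullet> m) * (\<xi> \<bullet> \<xi>)"
    using m0 by (simp add: Lagrange)
  have "\<exists>t. x = t *\<^sub>R \<xi>" if "?\<pi> x = 0" for x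
  proof -
    have x: "x \<bullet> m = 0" "x \<bullet> ?n = 0" using that by (simp_all add: zero_prod_def)
    have 1: "(x \<times> ?n) \<bullet> \<xi> = 0"
      using x m0 by (simp add: Lagrange inner_commute)
    have 2: "(m \<times> x) \<bullet> \<xi> = 0"
      using x by (metis cross_triple inner_commute)
    have "((m \<bullet> m) * (\<xi> \<bullet> \<xi>)) *\<^sub>R x = ((m \<times> ?n) \<bullet> x) *\<^sub>R \<xi>"
      using cross3_cramer[of m ?n \<xi> x] 1 2 D by simp
    then have "x = (((m \<times> ?n) \<bullet> x) / ((m \<bullet> m) * (\<xi> \<bullet> \<xi>))) *\<^sub>R \<xi>"
      using m(1) assms by (metis (no_types, lifting) divideR_right divide_inverse_commute inner_eq_zero_iff mult_eq_0_iff scaleR_scaleR)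
    then show ?thesis by blast
  qed
  moreover have "?\<pi> (t *\<^sub>R \<xi>) = 0" for t
    using m0 by (simp add: zero_prod_def dot_cross_self)
  moreover have "bounded_linear ?\<pi>"
    by (intro bounded_linear_intros)
  ultimately show ?thesis using that[of ?\<pi>] by blast
qed

text \<open>The inverse function theorem with all derivatives expressed by
  \<open>frechet_derivative\<close>. Only differentiability of the inverse is recorded; higher
  regularity of the maps built from it comes from the bootstrap in
  \<open>smooth_lift\<close>.\<close>

lemma smooth_inverse_function:
  fixes G :: "'a::euclidean_space \<Rightarrow> 'a"
  assumes "open S" "smooth_on S G" "q \<in> S" "inj (fderiv G q)"
  obtains U V H where "open U" "U \<subseteq> S" "q \<in> U" "open V" "homeomorphism U V G H"
    "\<And>y. y \<in> V \<Longrightarrow> (H has_derivative fderiv H y) (at y)"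
    "\<And>y w. y \<in> V \<Longrightarrow> fderiv G (H y) (fderiv H y w) = w"
proof -
  have der: "(G has_derivative fderiv G x) (at x)" if "x \<in> S" for x
    by (rule smooth_on_has_derivative[OF assms(2) that])
  define f' where "f' x = Blinfun (fderiv G x)" for x
  have f': "blinfun_apply (f' x) = fderiv G x" if "x \<in> S" for x
    unfolding f'_def by (rule bounded_linear_Blinfun_apply) (rule has_derivative_bounded_linear[OF der[OF that]])
  have lin: "linear (fderiv G q)"
    using der[OF assms(3)] has_derivative_linear by blast
  obtain g where g: "linear g" "g \<circ> fderiv G q = id"
    using linear_injective_left_inverse[OF lin assms(4)] by blast
  have bg: "bounded_linear g" using g(1) linear_conv_bounded_linear by blast
  have "continuous_on S f'"
  proof (rule continuous_on_blinfun_componentwise)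
    fix i :: 'a
    have "continuous_on S (\<lambda>x. fderiv G x i)"
      by (rule smooth_on_continuous_on[OF smooth_on_fderiv[OF assms(2)]])
    then show "continuous_on S (\<lambda>x. blinfun_apply (f' x) i)"
      by (simp add: f' cong: continuous_on_cong)
  qed
  moreover have "Blinfun g o\<^sub>L f' q = id_blinfun"
    by (rule blinfun_eqI) (use g(2) in \<open>simp add: f'[OF assms(3)] bounded_linear_Blinfun_apply[OF bg] fun_eq_iff\<close>)
  ultimately obtain U V H g' where *: "open U" "U \<subseteq> S" "q \<in> U" "open V" "homeomorphism U V G H"
    "\<And>y. y \<in> V \<Longrightarrow> (H has_derivative (g' y)) (at y)"
    "\<And>y. y \<in> V \<Longrightarrow> g' y = inv (blinfun_apply (f'(H y)))"
    "\<And>y. y \<in> V \<Longrightarrow> bij (blinfun_apply (f'(H y)))"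
    using inverse_function_theorem[of S G f' q "Blinfun g"] assms(1,3) der f' by metis
  have HS: "H y \<in> S" if "y \<in> V" for y
    using that *(2,5) by (auto simp: homeomorphism_def)
  show ?thesis
  proof (rule that[OF *(1-5)])
    fix y assume y: "y \<in> V"
    show "(H has_derivative fderiv H y) (at y)"
      using *(6)[OF y] fderiv_eq by metis
    show "fderiv G (H y) (fderiv H y w) = w" for w
      unfolding fderiv_eq[OF *(6)[OF y]] *(7)[OF y]
      using *(8)[OF y] f'[OF HS[OF y]] by (metis bij_inv_eq_iff)
  qed
qed


text \<open>A vector in the kernel of the composed differential is mapped by
  \<open>fderiv F q\<close> to a multiple of \<xi>. Transversality forces the multiple to be zero,
  and then injectivity forces the vector to be zero.\<close>

lemma transversal_local_inverse:
  fixes F :: "real \<times> real \<Rightarrow> real^3" and \<pi> :: "real^3 \<Rightarrow> real \<times> real"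
  assumes "open S" and F: "smooth_on S F" and q: "q \<in> S"
    and tr: "(fderiv F q (1, 0) \<times> fderiv F q (0, 1)) \<bullet> \<xi> \<noteq> 0"
    and \<pi>: "bounded_linear \<pi>" "\<And>x. \<pi> x = 0 \<longleftrightarrow> (\<exists>t. x = t *\<^sub>R \<xi>)"
  obtains U V H where "open U" "U \<subseteq> S" "q \<in> U" "open V" "homeomorphism U V (\<lambda>x. \<pi> (F x)) H"
    "\<And>y. y \<in> V \<Longrightarrow> (H has_derivative fderiv H y) (at y)"
proof -
  have der: "(F has_derivative fderiv F q) (at q)"
    by (rule smooth_on_has_derivative[OF F q])
  then have lin: "linear (fderiv F q)" by (rule has_derivative_linear)
  have G: "fderiv (\<lambda>x. \<pi> (F x)) q = (\<lambda>v. \<pi> (fderiv F q v))"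
    by (rule fderiv_eq[OF bounded_linear.has_derivative[OF \<pi>(1) der]])
  have "linear (\<lambda>v. \<pi> (fderiv F q v))"
    using linear_compose[OF lin bounded_linear.linear[OF \<pi>(1)]] by (simp add: o_def)
  moreover have "v = 0" if z: "\<pi> (fderiv F q v) = 0" for v
  proof -
    obtain t where t: "fderiv F q v = t *\<^sub>R \<xi>" using \<pi>(2)[of "fderiv F q v"] z by auto
    note inj = transversal_iff[OF lin, THEN iffD2, OF tr]
    have "t = 0"
    proof (rule ccontr)
      assume "t \<noteq> 0"
      then have "fderiv F q ((1/t) *\<^sub>R v) = \<xi>"
        using t by (simp add: linear_scale[OF lin])
      then show False using inj by blast
    qed
    then show ?thesis using t inj linear_injective_0[OF lin] by (metis scale_zero_left)
  qed
  ultimately have "inj (fderiv (\<lambda>x. \<pi> (F x)) q)"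
    unfolding G using linear_injective_0 by blast
  from smooth_inverse_function[OF assms(1) smooth_on_bounded_linear[OF assms(1) \<pi>(1) F] q this]
  show ?thesis using that by metis
qed

text \<open>A continuous lift is differentiable because it is locally a differentiable inverse
  composed with \<open>E\<close>. From there the relation \<open>F (\<Theta> p) = E p\<close>
  bootstraps: the derivative of \<Theta> is a rational expression in the derivatives of
  \<open>E\<close> and in those of \<open>F\<close> at \<open>\<Theta> p\<close>, which are as
  regular as \<Theta> itself.\<close>

lemma smooth_lift:
  fixes F :: "real \<times> real \<Rightarrow> real^3" and \<Theta> :: "real \<times> real \<Rightarrow> real \<times> real"
  assumes "open S" and F: "smooth_on S F"
    and tr: "\<And>q. q \<in> S \<Longrightarrow> (fderiv F q (1, 0) \<times> fderiv F q (0, 1)) \<bullet> \<xi> \<noteq> 0"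
    and W: "open W" "continuous_on W \<Theta>" "\<Theta> ` W \<subseteq> S" and E: "smooth_on W E"
    and eq: "\<And>p. p \<in> W \<Longrightarrow> F (\<Theta> p) = E p"
  shows "smooth_on W \<Theta>" and "\<And>p v. p \<in> W \<Longrightarrow> fderiv F (\<Theta> p) (fderiv \<Theta> p v) = fderiv E p v"
proof -
  have diff: "\<Theta> differentiable (at p)" if p: "p \<in> W" for p
  proof -
    have q: "\<Theta> p \<in> S" using W(3) p by blast
    have "\<xi> \<noteq> 0" using tr[OF q] by auto
    then obtain \<pi> :: "real^3 \<Rightarrow> real \<times> real" where \<pi>: "bounded_linear \<pi>" "\<And>x. \<pi> x = 0 \<longleftrightarrow> (\<exists>t. x = t *\<^sub>R \<xi>)"
      using projection_along by blast
    obtain U V H where U: "open U" "U \<subseteq> S" "\<Theta> p \<in> U" "open V" 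
      and H: "homeomorphism U V (\<lambda>x. \<pi> (F x)) H" "\<And>y. y \<in> V \<Longrightarrow> (H has_derivative fderiv H y) (at y)"
      by (rule transversal_local_inverse[OF assms(1) F q tr[OF q] \<pi>]) blast
    let ?T = "W \<inter> \<Theta> -` U"
    have T: "open ?T" "p \<in> ?T"
      using continuous_open_preimage[OF W(2,1) U(1)] p U(3) by (auto simp: Int_def)
    have eqT: "H (\<pi> (E x)) = \<Theta> x" if "x \<in> ?T" for x
      using that eq[of x] H(1) by (auto simp: homeomorphism_def)
    have "\<pi> (F (\<Theta> p)) \<in> V"
      using U(3) H(1) by (auto simp: homeomorphism_def)
    then have "\<pi> (E p) \<in> V" using eq[OF p] by simp
    from has_derivative_compose[OF bounded_linear.has_derivative[OF \<pi>(1) smooth_on_has_derivative[OF E p]] H(2)[OF this]]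
    have "((\<lambda>x. H (\<pi> (E x))) has_derivative (\<lambda>x. fderiv H (\<pi> (E p)) (\<pi> (fderiv E p x)))) (at p)" .
    then have "(\<Theta> has_derivative (\<lambda>x. fderiv H (\<pi> (E p)) (\<pi> (fderiv E p x)))) (at p)"
      by (rule has_derivative_transform_within_open[OF _ T]) (rule eqT)
    then show ?thesis by (auto simp: differentiable_def)
  qed
  then have der\<Theta>: "(\<Theta> has_derivative fderiv \<Theta> p) (at p)" if "p \<in> W" for p
    using that by (simp add: frechet_derivative_works)
  have derF: "(F has_derivative fderiv F (\<Theta> p)) (at (\<Theta> p))" if "p \<in> W" for p
    using smooth_on_has_derivative[OF F] W(3) that by blast
  show chain: "fderiv F (\<Theta> p) (fderiv \<Theta> p v) = fderiv E p v" if p: "p \<in> W" for p v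
  proof -
    have "((\<lambda>x. F (\<Theta> x)) has_derivative (\<lambda>v. fderiv F (\<Theta> p) (fderiv \<Theta> p v))) (at p)"
      by (rule has_derivative_compose[OF der\<Theta>[OF p] derF[OF p]])
    then have "(E has_derivative (\<lambda>v. fderiv F (\<Theta> p) (fderiv \<Theta> p v))) (at p)"
      by (rule has_derivative_transform_within_open[OF _ W(1) p]) (rule eq)
    then show ?thesis by (simp add: fderiv_eq)
  qed
  define D where "D p = (fderiv F (\<Theta> p) (1, 0) \<times> fderiv F (\<Theta> p) (0, 1)) \<bullet> \<xi>" for p
  have D: "D p \<noteq> 0" if "p \<in> W" for p
    using tr W(3) that unfolding D_def by blast
  \<comment> \<open>Cramer's rule for the two components of \<open>fderiv \<Theta> p v\<close>; the
    denominator \<open>D p\<close> is nonzero by transversality.\<close>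
  let ?f = "\<lambda>p v. inverse (D p) *\<^sub>R (((fderiv E p v \<times> fderiv F (\<Theta> p) (0, 1)) \<bullet> \<xi>) *\<^sub>R (1::real, 0::real)
        + ((fderiv F (\<Theta> p) (1, 0) \<times> fderiv E p v) \<bullet> \<xi>) *\<^sub>R (0::real, 1::real))"
  have f: "fderiv \<Theta> p v = ?f p v" if p: "p \<in> W" for p v
  proof -
    let ?x = "fst (fderiv \<Theta> p v)" and ?y = "snd (fderiv \<Theta> p v)"
    have e: "fderiv E p v = ?x *\<^sub>R fderiv F (\<Theta> p) (1, 0) + ?y *\<^sub>R fderiv F (\<Theta> p) (0, 1)"
      using chain[OF p, of v] linear_pair_expand[OF has_derivative_linear[OF derF[OF p]], of "fderiv \<Theta> p v"] by simp
    have "(fderiv E p v \<times> fderiv F (\<Theta> p) (0, 1)) \<bullet> \<xi> = ?x * D p"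
      "(fderiv F (\<Theta> p) (1, 0) \<times> fderiv E p v) \<bullet> \<xi> = ?y * D p"
      unfolding e D_def by (simp_all add: cross_add_left cross_add_right cross_mult_left cross_mult_right)
    then show ?thesis using D[OF p] by (simp add: prod_eq_iff)
  qed
  have "hdiff_on n W \<Theta>" for n
  proof (induction n)
    case 0
    then show ?case using W(2) by simp
  next
    case (Suc n)
    have Fn: "hdiff_on n W (\<lambda>p. fderiv F (\<Theta> p) v)" for v
      by (rule hdiff_on_compose[OF W(1) assms(1) W(3) _ Suc])
        (use smooth_on_fderiv[OF F] in \<open>simp add: smooth_on_def\<close>)
    have En: "hdiff_on n W (\<lambda>p. fderiv E p v)" for v
      using smooth_on_fderiv[OF E] by (simp add: smooth_on_def)
    note bl = hdiff_on_bounded_linear[OF W(1)]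
    note bil = hdiff_on_bilinear[OF W(1)]
    have Dn: "hdiff_on n W D"
      unfolding D_def by (intro bl[OF bounded_linear_inner_left] bil[OF bounded_bilinear_cross3] Fn)
    show ?case
    proof (rule hdiff_on_SucI[OF W(1), where f'="?f"])
      show "(\<Theta> has_derivative ?f p) (at p)" if "p \<in> W" for p
        by (rule has_derivative_eq_rhs[OF der\<Theta>[OF that]]) (use f[OF that] in \<open>simp add: fun_eq_iff\<close>)
      show "hdiff_on n W (\<lambda>p. ?f p v)" for v
        by (intro bil[OF bounded_bilinear_scaleR] hdiff_on_inverse[OF W(1) D Dn] 
            hdiff_on_add[OF W(1)] bl[OF bounded_linear_inner_left] 
            bil[OF bounded_bilinear_cross3] Fn En hdiff_on_const)
    qed
  qed
  then show "smooth_on W \<Theta>" by (simp add: smooth_on_def)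
qed

section \<open>Maps of rank one near a curve\<close>

lemma increasing_deriv_surj:
  fixes f :: "real \<Rightarrow> real"
  assumes "(f has_real_derivative l) (at s)" "l > 0" "open J" "s \<in> J" "continuous_on J f" "\<epsilon> > 0"
  shows "\<forall>\<^sub>F y in nhds (f s). \<exists>\<sigma>. \<bar>\<sigma> - s\<bar> < \<epsilon> \<and> \<sigma> \<in> J \<and> f \<sigma> = y"
proof -
  obtain d1 where d1: "d1 > 0" "\<And>h. 0 < h \<Longrightarrow> h < d1 \<Longrightarrow> f s < f (s + h)"
    using DERIV_pos_inc_right[OF assms(1,2)] by blast
  obtain d2 where d2: "d2 > 0" "\<And>h. 0 < h \<Longrightarrow> h < d2 \<Longrightarrow> f (s - h) < f s"
    using DERIV_pos_inc_left[OF assms(1,2)] by blast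
  obtain d3 where d3: "d3 > 0" "ball s d3 \<subseteq> J"
    using assms(3,4) open_contains_ball by blast
  define h where "h = min (min d1 d2) (min d3 \<epsilon>) / 2"
  have h: "h > 0" "h < d1" "h < d2" "h < d3" "h < \<epsilon>"
    using d1(1) d2(1) d3(1) assms(6) by (auto simp: h_def)
  have sub: "{s - h..s + h} \<subseteq> J"
    using d3(2) h(4) by (auto simp: subset_iff dist_real_def)
  have "f s \<in> {f (s - h)<..<f (s + h)}"
    using d1(2)[OF h(1,2)] d2(2)[OF h(1,3)] by simp
  then have "\<forall>\<^sub>F y in nhds (f s). y \<in> {f (s - h)<..<f (s + h)}"
    by (intro eventually_nhds_in_open) auto
  then show ?thesis
  proof eventually_elim
    case (elim y)
    then obtain \<sigma> where "s - h \<le> \<sigma>" "\<sigma> \<le> s + h" "f \<sigma> = y"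
      using IVT'[of f "s - h" y "s + h"] h(1) continuous_on_subset[OF assms(5) sub] by auto
    then show ?case using h(5) sub by (intro exI[of _ \<sigma>]) auto
  qed
qed

text \<open>In coordinates the first of which is \<open>A \<bullet> a'\<close>, the map \<open>A\<close> depends on the first one only, and
  along the curve that coordinate takes all nearby values.\<close>

lemma rank_one_image:
  fixes A :: "real \<times> real \<Rightarrow> real^3"
  assumes "open S" and A: "smooth_on S A"
    and rank: "\<And>q v w. q \<in> S \<Longrightarrow> fderiv A q v \<times> fderiv A q w = 0"
    and \<gamma>: "(\<gamma> has_vector_derivative \<gamma>') (at s)" "\<gamma> s \<in> S"
    and eq: "\<forall>\<^sub>F t in nhds s. A (\<gamma> t) = a t"
    and a: "(a has_vector_derivative a') (at s)" "a' \<noteq> 0" "open J" "s \<in> J" "continuous_on J a"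
    and "\<epsilon> > 0"
  shows "\<forall>\<^sub>F q in nhds (\<gamma> s). \<exists>\<sigma>. \<bar>\<sigma> - s\<bar> < \<epsilon> \<and> A q = a \<sigma>"
proof -
  \<comment> \<open>\<open>m\<close> is \<open>\<gamma>'\<close> turned by a right angle, so the
    second coordinate of \<open>G\<close> is stationary exactly in the direction of
    \<open>\<gamma>'\<close>.\<close>
  define m where "m = (- snd \<gamma>', fst \<gamma>')"
  define G where "G q = (A q \<bullet> a') *\<^sub>R (1::real, 0::real) + (q \<bullet> m) *\<^sub>R (0::real, 1::real)" for q
  have G_eq: "G q = (A q \<bullet> a', q \<bullet> m)" for q by (simp add: G_def)
  note derA = smooth_on_has_derivative[OF A]
  have smG: "smooth_on S G"
    unfolding G_def by (intro smooth_on_add smooth_on_bilinear[OF assms(1) bounded_bilinear_scaleR]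
        smooth_on_bounded_linear[OF assms(1) bounded_linear_inner_left A] smooth_on_const 
        smooth_on_linear[OF bounded_linear_inner_left] assms(1))
  have derG: "fderiv G q = (\<lambda>v. (fderiv A q v \<bullet> a', v \<bullet> m))" if "q \<in> S" for q
    unfolding G_eq[abs_def] by (rule fderiv_eq) (auto intro!: derivative_eq_intros derA that)
  have "((\<lambda>t. A (\<gamma> t)) has_vector_derivative fderiv A (\<gamma> s) \<gamma>') (at s)"
    by (rule vector_derivative_diff_chain_within[OF \<gamma>(1), unfolded o_def]) (use derA[OF \<gamma>(2)] has_derivative_at_withinI in blast)
  moreover obtain T where T: "open T" "s \<in> T" "\<And>t. t \<in> T \<Longrightarrow> A (\<gamma> t) = a t"
    using eq unfolding eventually_nhds by blast
  ultimately have "(a has_vector_derivative fderiv A (\<gamma> s) \<gamma>') (at s)"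
    using has_vector_derivative_transform_within_open by blast
  then have a': "fderiv A (\<gamma> s) \<gamma>' = a'"
    using a(1) vector_derivative_unique_at by blast
  have linA: "linear (fderiv A (\<gamma> s))" using derA[OF \<gamma>(2)] has_derivative_linear by blast
  have \<gamma>'0: "\<gamma>' \<noteq> 0" using a' a(2) linear_0[OF linA] by auto
  \<comment> \<open>By the second coordinate a kernel vector is a multiple of
    \<open>\<gamma>'\<close>; in that direction the first coordinate changes at the rate
    \<open>a' \<bullet> a'\<close>, which is nonzero.\<close>
  have "inj (fderiv G (\<gamma> s))"
  proof -
    have "linear (fderiv G (\<gamma> s))"
      using smooth_on_has_derivative[OF smG \<gamma>(2)] has_derivative_linear by blast
    moreover have "v = 0" if "fderiv G (\<gamma> s) v = 0" for v
    proof -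
      have v: "fderiv A (\<gamma> s) v \<bullet> a' = 0" "v \<bullet> m = 0"
        using that unfolding derG[OF \<gamma>(2)] by (simp_all add: zero_prod_def)
      have "(fst \<gamma>' * fst \<gamma>' + snd \<gamma>' * snd \<gamma>') *\<^sub>R v = (v \<bullet> \<gamma>') *\<^sub>R \<gamma>'"
        using v(2) unfolding m_def
        by (cases v; cases \<gamma>') (simp add: inner_prod_def algebra_simps; algebra)
      moreover have "fst \<gamma>' * fst \<gamma>' + snd \<gamma>' * snd \<gamma>' \<noteq> 0"
        using \<gamma>'0 by (simp add: prod_eq_iff sum_squares_eq_zero_iff)
      ultimately obtain k where k: "v = k *\<^sub>R \<gamma>'"
        by (metis (no_types, lifting) divideR_right scaleR_scaleR)
      then have "fderiv A (\<gamma> s) v = k *\<^sub>R a'" using a' linear_scale[OF linA] by simp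
      then show "v = 0" using v(1) a(2) k by simp
    qed
    ultimately show ?thesis using linear_injective_0 by blast
  qed
  then obtain U V H where U: "open U" "U \<subseteq> S" "\<gamma> s \<in> U" "open V" and H: "homeomorphism U V G H"
    "\<And>y. y \<in> V \<Longrightarrow> (H has_derivative fderiv H y) (at y)"
    "\<And>y w. y \<in> V \<Longrightarrow> fderiv G (H y) (fderiv H y w) = w"
    by (rule smooth_inverse_function[OF assms(1) smG \<gamma>(2)]) blast
  have HS: "H y \<in> S" if "y \<in> V" for y
    using that U(2) H(1) by (auto simp: homeomorphism_def)
  \<comment> \<open>In the coordinates \<open>G\<close> the first partial derivative of
    \<open>A\<close> has inner product 1 with \<open>a'\<close> and the second has inner product 0.
    As the two are parallel, the second one vanishes; taking the cross product of \<open>a'\<close>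
    with their vanishing cross product extracts this.\<close>
  have ker: "fderiv A (H y) (fderiv H y (0, 1)) = 0" if y: "y \<in> V" for y
  proof -
    let ?d = "fderiv A (H y)"
    have 1: "?d (fderiv H y (1, 0)) \<bullet> a' = 1" and 0: "?d (fderiv H y (0, 1)) \<bullet> a' = 0"
      using H(3)[OF y, of "(1, 0)"] H(3)[OF y, of "(0, 1)"] unfolding derG[OF HS[OF y]] by auto
    have "0 = a' \<times> (?d (fderiv H y (1, 0)) \<times> ?d (fderiv H y (0, 1)))"
      using rank[OF HS[OF y]] by simp
    also have "\<dots> = - ?d (fderiv H y (0, 1))"
      unfolding Lagrange using 0 1 by (simp add: inner_commute)
    finally show ?thesis by simp
  qed
  have GV: "G (\<gamma> s) \<in> V" using U(3) H(1) by (auto simp: homeomorphism_def)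
  obtain V1 V2 where V12: "open V1" "open V2" "G (\<gamma> s) \<in> Sigma V1 (\<lambda>_. V2)" "Sigma V1 (\<lambda>_. V2) \<subseteq> V"
    using open_prod_elim[OF U(4) GV] by metis
  obtain d where d: "d > 0" "ball (\<gamma> s \<bullet> m) d \<subseteq> V2"
    using V12(2,3) open_contains_ball unfolding G_eq by (metis mem_Sigma_iff)
  \<comment> \<open>Vanishing derivative gives constancy on a connected fibre, so the second
    coordinate is restricted to an interval.\<close>
  let ?B = "ball (\<gamma> s \<bullet> m) d"
  have const: "A (H (x, y)) = A (H (x, y'))" if "x \<in> V1" "y \<in> ?B" "y' \<in> ?B" for x y y'
  proof -
    have "\<exists>c. \<forall>y\<in>?B. A (H (x, y)) = c"
    proof (rule has_derivative_zero_constant)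
      fix y assume y: "y \<in> ?B"
      then have xy: "(x, y) \<in> V" using V12(4) d(2) that(1) by blast
      have "((\<lambda>y. (x, y)) has_derivative (\<lambda>h. (0, h))) (at y)"
        by (auto intro!: derivative_eq_intros)
      from has_derivative_compose[OF has_derivative_compose[OF this H(2)[OF xy]] derA[OF HS[OF xy]]]
      have "((\<lambda>y. A (H (x, y))) has_derivative (\<lambda>h. fderiv A (H (x, y)) (fderiv H (x, y) (0, h)))) (at y)" .
      moreover have "fderiv A (H (x, y)) (fderiv H (x, y) (0, h)) = 0" for h
      proof -
        have "fderiv H (x, y) (0, h) = h *\<^sub>R fderiv H (x, y) (0, 1)"
          using linear_scale[OF has_derivative_linear[OF H(2)[OF xy]], of h "(0, 1)"] by simp
        then show ?thesis
          by (simp add: linear_scale[OF has_derivative_linear[OF derA[OF HS[OF xy]]]] ker[OF xy])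
      qed
      ultimately show "((\<lambda>y. A (H (x, y))) has_derivative (\<lambda>h. 0)) (at y within ?B)"
        by (simp add: has_derivative_at_withinI)
    qed simp
    then show ?thesis using that by metis
  qed
  let ?N = "U \<inter> {q. q \<bullet> m \<in> ?B}"
  have N: "open ?N" "\<gamma> s \<in> ?N"
    using U(1,3) d(1) by (auto intro!: open_Int open_Collect_less continuous_intros simp: dist_real_def)
  have "isCont \<gamma> s" using \<gamma>(1) has_vector_derivative_continuous by blast
  then have "filterlim \<gamma> (nhds (\<gamma> s)) (nhds s)"
    by (simp add: isCont_def tendsto_at_iff_tendsto_nhds)
  from topological_tendstoD[OF this N] have "\<forall>\<^sub>F t in nhds s. \<gamma> t \<in> ?N" .
  from eventually_conj[OF this eq] obtain e where e: "e > 0" 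
    "\<And>t. \<bar>t - s\<bar> < e \<Longrightarrow> \<gamma> t \<in> ?N \<and> A (\<gamma> t) = a t"
    unfolding eventually_nhds_metric dist_real_def by blast
  \<comment> \<open>The derivative \<open>a' \<bullet> a'\<close> is positive. Hence the first
    coordinate of the curve takes every value near \<open>a s \<bullet> a'\<close>, at parameters so
    close to \<open>s\<close> that the curve is still in the coordinate domain.\<close>
  have da: "((\<lambda>t. a t \<bullet> a') has_real_derivative a' \<bullet> a') (at s)"
    using bounded_linear.has_vector_derivative[OF bounded_linear_inner_left a(1)]
    by (simp add: has_real_derivative_iff_has_vector_derivative)
  have "\<forall>\<^sub>F y in nhds (a s \<bullet> a'). \<exists>\<sigma>. \<bar>\<sigma> - s\<bar> < min e \<epsilon> \<and> \<sigma> \<in> J \<and> a \<sigma> \<bullet> a' = y"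
    by (rule increasing_deriv_surj[OF da _ a(3,4)])
      (use a(2,5) e(1) assms(12) in \<open>auto intro: continuous_intros\<close>)
  note surj = this
  have As: "A (\<gamma> s) = a s" using e(1) e(2)[of s] by simp
  have "isCont (\<lambda>q. A q \<bullet> a') (\<gamma> s)"
    using has_derivative_continuous[OF derA[OF \<gamma>(2)]] by (intro continuous_intros)
  then have lim: "filterlim (\<lambda>q. A q \<bullet> a') (nhds (a s \<bullet> a')) (nhds (\<gamma> s))"
    using tendsto_at_iff_tendsto_nhds[of "\<lambda>q. A q \<bullet> a'" "\<gamma> s"] As by (simp add: isCont_def)
  have "a s \<bullet> a' \<in> V1" using V12(3) As unfolding G_eq by simp
  note eventually_compose_filterlim[OF surj lim]
  moreover have "\<forall>\<^sub>F q in nhds (\<gamma> s). q \<in> ?N"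
    by (rule eventually_nhds_in_open[OF N])
  moreover have "\<forall>\<^sub>F q in nhds (\<gamma> s). A q \<bullet> a' \<in> V1"
    by (rule topological_tendstoD[OF lim V12(1) \<open>a s \<bullet> a' \<in> V1\<close>])
  ultimately show ?thesis
  proof eventually_elim
    case (elim q)
    then obtain \<sigma> where \<sigma>: "\<bar>\<sigma> - s\<bar> < min e \<epsilon>" "a \<sigma> \<bullet> a' = A q \<bullet> a'" by blast
    have \<gamma>\<sigma>: "\<gamma> \<sigma> \<in> ?N" "A (\<gamma> \<sigma>) = a \<sigma>" using e(2)[of \<sigma>] \<sigma>(1) by auto
    have HG: "H (G x) = x" if "x \<in> ?N" for x
      using that H(1) by (auto simp: homeomorphism_def)
    \<comment> \<open>\<open>q\<close> and \<open>\<gamma> \<sigma>\<close> share the first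
      coordinate, and \<open>A\<close> depends on no other.\<close>
    have "A q = A (H (G q))" using HG elim(2) by simp
    also have "\<dots> = A (H (G (\<gamma> \<sigma>)))"
      unfolding G_eq \<gamma>\<sigma>(2) \<sigma>(2) by (rule const) (use elim \<gamma>\<sigma>(1) in auto)
    also have "\<dots> = a \<sigma>" using HG[OF \<gamma>\<sigma>(1)] \<gamma>\<sigma>(2) by simp
    finally show ?case using \<sigma>(1) by auto
  qed
qed

section \<open>Double power series\<close>

definition double_series :: "(nat \<Rightarrow> nat \<Rightarrow> real) \<Rightarrow> real \<Rightarrow> real \<Rightarrow> real" where
  "double_series A h k = (\<Sum>\<^sub>\<infinity>(i, j). A i j * h ^ i * k ^ j)"

text \<open>Absolute convergence at the corner of the box, which dominates the series at all real or
  complex arguments of absolute value at most \<rho>.\<close>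

definition double_summable :: "(nat \<Rightarrow> nat \<Rightarrow> real) \<Rightarrow> real \<Rightarrow> bool" where
  "double_summable A \<rho> \<longleftrightarrow> (\<lambda>(i, j). \<bar>A i j\<bar> * \<rho> ^ i * \<rho> ^ j) summable_on UNIV"

lemma double_term_le:
  fixes A :: "nat \<Rightarrow> nat \<Rightarrow> real"
  assumes "\<bar>h\<bar> \<le> \<rho>" "\<bar>k\<bar> \<le> \<rho>"
  shows "\<bar>A i j * h ^ i * k ^ j\<bar> \<le> \<bar>A i j\<bar> * \<rho> ^ i * \<rho> ^ j"
  using assms by (auto simp: abs_mult power_abs intro!: mult_mono power_mono)

lemma double_series_has_sum:
  assumes "double_summable A \<rho>" "\<bar>h\<bar> \<le> \<rho>" "\<bar>k\<bar> \<le> \<rho>"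
  shows "((\<lambda>(i, j). A i j * h ^ i * k ^ j) has_sum double_series A h k) UNIV"
proof -
  have "(\<lambda>(i, j). A i j * h ^ i * k ^ j) summable_on UNIV"
    by (rule abs_summable_summable, rule summable_on_comparison_test[OF assms(1)[unfolded double_summable_def]])
      (use double_term_le[OF assms(2,3)] in auto)
  then show ?thesis unfolding double_series_def by (rule has_sum_infsum)
qed

lemma double_series_transpose: "double_series (\<lambda>i j. A j i) k h = double_series A h k"
proof -
  have "bij_betw prod.swap UNIV (UNIV :: (nat \<times> nat) set)" by (simp add: bij_swap)
  from infsum_reindex_bij_betw[OF this, of "\<lambda>(i, j). A i j * h ^ i * k ^ j"]
  show ?thesis
    unfolding double_series_def by (simp add: case_prod_unfold mult.assoc mult.commute[of "k ^ _"])
qed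

lemma double_summable_transpose: "double_summable A \<rho> \<Longrightarrow> double_summable (\<lambda>i j. A j i) \<rho>"
proof -
  have "bij_betw prod.swap UNIV (UNIV :: (nat \<times> nat) set)" by (simp add: bij_swap)
  from summable_on_reindex_bij_betw[OF this, of "\<lambda>(i, j). \<bar>A i j\<bar> * \<rho> ^ i * \<rho> ^ j"]
  show "double_summable A \<rho> \<Longrightarrow> double_summable (\<lambda>i j. A j i) \<rho>"
    unfolding double_summable_def by (simp add: case_prod_unfold mult.assoc mult.commute[of "\<rho> ^ fst _"])
qed

text \<open>Near \<open>s\<close> the holomorphic extensions of \<open>x\<close> and
  \<open>y\<close> stay below \<rho> in norm. Inserted into the double series they give holomorphic
  terms dominated by the summable corner values, so by the Weierstrass test the sum is
  holomorphic.\<close>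

lemma double_series_real_germ:
  assumes A: "double_summable A \<rho>" and x: "real_germ x s" "\<bar>x s\<bar> < \<rho>" and y: "real_germ y s" "\<bar>y s\<bar> < \<rho>"
  shows "real_germ (\<lambda>t. double_series A (x t) (y t)) s"
proof -
  let ?s = "complex_of_real s"
  obtain X r1 where X: "r1 > 0" "X holomorphic_on ball ?s r1"
    "\<And>t. \<bar>t - s\<bar> < r1 \<Longrightarrow> X (complex_of_real t) = of_real (x t)"
    by (rule real_germ_ball[OF x(1)]) blast
  obtain Y r2 where Y: "r2 > 0" "Y holomorphic_on ball ?s r2"
    "\<And>t. \<bar>t - s\<bar> < r2 \<Longrightarrow> Y (complex_of_real t) = of_real (y t)"
    by (rule real_germ_ball[OF y(1)]) blast
  have "norm (X ?s) < \<rho>" "norm (Y ?s) < \<rho>" using X(1,3) Y(1,3) x(2) y(2) by simp_all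
  moreover have "isCont X ?s" "isCont Y ?s"
    using X(1,2) Y(1,2) continuous_on_interior holomorphic_on_imp_continuous_on 
    by (metis centre_in_ball interior_open open_ball)+
  then have "((\<lambda>z. norm (X z)) \<longlongrightarrow> norm (X ?s)) (nhds ?s)" "((\<lambda>z. norm (Y z)) \<longlongrightarrow> norm (Y ?s)) (nhds ?s)"
    by (auto simp: isCont_def tendsto_at_iff_tendsto_nhds intro: tendsto_norm)
  ultimately have "\<forall>\<^sub>F z in nhds ?s. norm (X z) < \<rho> \<and> norm (Y z) < \<rho>"
    by (intro eventually_conj order_tendstoD)
  then obtain r3 where r3: "r3 > 0" "\<And>z. dist z ?s < r3 \<Longrightarrow> norm (X z) < \<rho> \<and> norm (Y z) < \<rho>"
    unfolding eventually_nhds_metric by blast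
  \<comment> \<open>Halving puts the closed disc used in the Weierstrass test inside all three open
    discs.\<close>
  define r where "r = min (min r1 r2) r3 / 2"
  have r: "r > 0" "r < r1" "r < r2" "r < r3" using X(1) Y(1) r3(1) by (auto simp: r_def)
  define f where "f = (\<lambda>(i, j) z. complex_of_real (A i j) * X z ^ i * Y z ^ j)"
  define g where "g z = (\<Sum>\<^sub>\<infinity>p. f p z)" for z
  have bd: "norm (X z) < \<rho> \<and> norm (Y z) < \<rho>" if "z \<in> cball ?s r" for z
    using r3(2)[of z] that r(4) by (simp add: dist_commute)
  have le: "norm (f p z) \<le> (case p of (i, j) \<Rightarrow> \<bar>A i j\<bar> * \<rho> ^ i * \<rho> ^ j)" if "z \<in> cball ?s r" for p z
    using bd[OF that] order_le_less_trans[OF norm_ge_zero, of "X z" \<rho>] by (cases p)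
      (auto simp: f_def norm_mult norm_power intro!: mult_mono power_mono)
  have hol: "f p holomorphic_on ball ?s (min r1 r2)" for p
    using X(2) Y(2) by (cases p) (auto simp: f_def intro!: holomorphic_intros elim: holomorphic_on_subset)
  have "g holomorphic_on ball ?s r"
  proof (rule holomorphic_uniform_limit)
    show "uniform_limit (cball ?s r) (\<lambda>P z. \<Sum>p\<in>P. f p z) g (finite_subsets_at_top UNIV)"
      unfolding g_def
      by (rule Weierstrass_m_test_general[OF le]) (use A in \<open>auto simp: double_summable_def\<close>)
    have "(\<lambda>z. \<Sum>p\<in>P. f p z) holomorphic_on T" if "T \<subseteq> ball ?s (min r1 r2)" for P T
      by (rule holomorphic_on_subset[OF _ that]) (intro holomorphic_intros hol)
    then show "\<forall>\<^sub>F P in finite_subsets_at_top UNIV. continuous_on (cball ?s r) (\<lambda>z. \<Sum>p\<in>P. f p z) \<and>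
        (\<lambda>z. \<Sum>p\<in>P. f p z) holomorphic_on ball ?s r"
      using r by (intro always_eventually allI conjI holomorphic_on_imp_continuous_on) 
        (auto simp: subset_iff)
  qed auto
  moreover have "g (of_real t) = of_real (double_series A (x t) (y t))" if t: "\<bar>t - s\<bar> < r" for t
  proof -
    have xy: "X (of_real t) = of_real (x t)" "Y (of_real t) = of_real (y t)"
      using X(3)[of t] Y(3)[of t] t r by auto
    have "of_real t \<in> cball ?s r" using t by (simp add: dist_of_real dist_real_def abs_minus_commute)
    from bd[OF this] have "\<bar>x t\<bar> \<le> \<rho>" "\<bar>y t\<bar> \<le> \<rho>" unfolding xy by simp_all
    from has_sum_of_real[OF double_series_has_sum[OF A this], where 'a=complex]
    have "((\<lambda>p. f p (of_real t)) has_sum of_real (double_series A (x t) (y t))) UNIV"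
      by (simp add: f_def xy case_prod_unfold)
    then show ?thesis unfolding g_def by (rule infsumI)
  qed
  moreover have "\<forall>\<^sub>F t in nhds s. \<bar>t - s\<bar> < r"
    using r(1) unfolding eventually_nhds_metric dist_real_def by blast
  ultimately show ?thesis
    using r(1) by (intro real_germI[of g] holomorphic_on_imp_analytic_at[of _ "ball ?s r"])
      (auto elim!: eventually_mono)
qed

text \<open>Summation over the second index first turns the double series into an ordinary power
  series in \<open>h\<close> with coefficients depending on \<open>k\<close>. This is the form to
  which termwise differentiation applies.\<close>

lemma double_series_sums:
  assumes A: "double_summable A \<rho>" and "\<rho> > 0" "\<bar>h\<bar> \<le> \<rho>" "\<bar>k\<bar> \<le> \<rho>"
  shows "(\<lambda>i. (\<Sum>\<^sub>\<infinity>j. A i j * k ^ j) * h ^ i) sums double_series A h k"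
proof -
  have row: "(\<lambda>j. A i j * k ^ j) summable_on UNIV" for i
  proof -
    have "(\<lambda>(i, j). \<bar>A i j\<bar> * \<rho> ^ i * \<rho> ^ j) summable_on (Pair i ` UNIV)"
      by (rule summable_on_subset_banach[OF A[unfolded double_summable_def]]) simp
    then have "(\<lambda>j. \<bar>A i j\<bar> * \<rho> ^ i * \<rho> ^ j) summable_on UNIV"
      by (subst (asm) summable_on_reindex) (auto simp: inj_on_def o_def)
    from summable_on_cmult_right[OF this, of "inverse (\<rho> ^ i)"]
    have 1: "(\<lambda>j. \<bar>A i j\<bar> * \<rho> ^ j) summable_on UNIV" using assms(2) by (simp add: field_simps)
    have "(\<lambda>j. norm (A i j * k ^ j)) summable_on UNIV"
      by (rule summable_on_comparison_test[OF 1])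
        (use assms(4) in \<open>auto simp: abs_mult power_abs intro!: mult_mono power_mono\<close>)
    then show ?thesis by (rule abs_summable_summable)
  qed
  have "((\<lambda>i. (\<Sum>\<^sub>\<infinity>j. A i j * k ^ j) * h ^ i) has_sum double_series A h k) UNIV"
  proof (rule has_sum_SigmaD)
    show "((\<lambda>(i, j). A i j * h ^ i * k ^ j) has_sum double_series A h k) (Sigma UNIV (\<lambda>_. UNIV))"
      using double_series_has_sum[OF A assms(3,4)] by simp
    show "((\<lambda>j. case (i, j) of (i, j) \<Rightarrow> A i j * h ^ i * k ^ j) has_sum (\<Sum>\<^sub>\<infinity>j. A i j * k ^ j) * h ^ i) UNIV" for i
      using has_sum_cmult_left[OF has_sum_infsum[OF row[of i]], of "h ^ i"] by (simp add: mult_ac)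
  qed
  then show ?thesis by (rule has_sum_imp_sums)
qed

definition series_diff :: "(nat \<Rightarrow> nat \<Rightarrow> real) \<Rightarrow> nat \<Rightarrow> nat \<Rightarrow> real" where
  "series_diff A i j = real (Suc i) * A (Suc i) j"

lemma Suc_times_power_bounded:
  fixes q :: real assumes "\<bar>q\<bar> < 1"
  obtains C where "\<And>n. real (Suc n) * q ^ n \<le> C"
proof -
  have "(\<lambda>n. real n * q ^ n + q ^ n) \<longlonglongrightarrow> 0 + 0"
    using assms by (intro tendsto_add powser_times_n_limit_0 LIMSEQ_power_zero) auto
  then have "Bseq (\<lambda>n. real n * q ^ n + q ^ n)" by (rule convergent_imp_Bseq[OF convergentI])
  then obtain C where "\<And>n. \<bar>real n * q ^ n + q ^ n\<bar> \<le> C" unfolding Bseq_def by auto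
  then show ?thesis using that[of C] by (simp add: algebra_simps) (metis abs_le_D1 add.commute)
qed

text \<open>Differentiation introduces the factor \<open>Suc i\<close>. A smaller radius absorbs it,
  because \<open>Suc n\<close> times the \<open>n\<close>-th power of
  \<open>\<rho>' / \<rho>\<close> is bounded.\<close>

lemma double_summable_series_diff:
  assumes A: "double_summable A \<rho>" and "0 \<le> \<rho>'" "\<rho>' < \<rho>"
  shows "double_summable (series_diff A) \<rho>'"
proof -
  have \<rho>: "\<rho> > 0" using assms by linarith
  have "\<bar>\<rho>' / \<rho>\<bar> < 1" using assms \<rho> by (simp add: field_simps)
  then obtain C where C: "\<And>n. real (Suc n) * (\<rho>' / \<rho>) ^ n \<le> C" by (rule Suc_times_power_bounded) blast
  have C': "real (Suc n) * \<rho>' ^ n \<le> C * \<rho> ^ n" for n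
    using C[of n] \<rho> by (simp add: power_divide field_simps)
  let ?g = "\<lambda>(i, j). \<bar>A i j\<bar> * \<rho> ^ i * \<rho> ^ j"
  have "?g summable_on (map_prod Suc id ` UNIV)"
    by (rule summable_on_subset_banach[OF A[unfolded double_summable_def]]) simp
  then have "(\<lambda>(i, j). \<bar>A (Suc i) j\<bar> * \<rho> ^ Suc i * \<rho> ^ j) summable_on UNIV"
    by (subst (asm) summable_on_reindex) (auto simp: inj_on_def o_def case_prod_unfold)
  from summable_on_cmult_right[OF this, of "C / \<rho>"]
  have 1: "(\<lambda>(i, j). C * \<rho> ^ i * \<bar>A (Suc i) j\<bar> * \<rho> ^ j) summable_on UNIV"
    using \<rho> by (simp add: case_prod_unfold mult_ac)
  show ?thesis
    unfolding double_summable_def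
  proof (rule summable_on_comparison_test[OF 1], clarify)
    fix i j
    have "\<bar>series_diff A i j\<bar> * \<rho>' ^ i * \<rho>' ^ j = (real (Suc i) * \<rho>' ^ i) * \<bar>A (Suc i) j\<bar> * \<rho>' ^ j"
      by (simp add: series_diff_def abs_mult mult_ac)
    also have "\<dots> \<le> (C * \<rho> ^ i) * \<bar>A (Suc i) j\<bar> * \<rho> ^ j"
    proof (rule mult_mono)
      show "real (Suc i) * \<rho>' ^ i * \<bar>A (Suc i) j\<bar> \<le> C * \<rho> ^ i * \<bar>A (Suc i) j\<bar>"
        by (rule mult_right_mono[OF C']) simp
      have "0 \<le> C * \<rho> ^ i" by (rule order_trans[OF _ C']) (use assms in simp)
      then show "0 \<le> C * \<rho> ^ i * \<bar>A (Suc i) j\<bar>" by simp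
    qed (use assms in \<open>auto intro: power_mono\<close>)
    finally show "\<bar>series_diff A i j\<bar> * \<rho>' ^ i * \<rho>' ^ j \<le> C * \<rho> ^ i * \<bar>A (Suc i) j\<bar> * \<rho> ^ j" .
  qed (use assms in auto)
qed

text \<open>For fixed \<open>k\<close> the series is a power series in \<open>h\<close> that
  converges at \<rho>, so it may be differentiated term by term; the coefficients
  \<open>diffs c\<close> are the row sums of \<open>series_diff A\<close>.\<close>

lemma double_series_deriv:
  assumes A: "double_summable A \<rho>" and h: "\<bar>h\<bar> < \<rho>" and k: "\<bar>k\<bar> < \<rho>"
  shows "((\<lambda>h. double_series A h k) has_real_derivative double_series (series_diff A) h k) (at h)"
proof -
  define c where "c i = (\<Sum>\<^sub>\<infinity>j. A i j * k ^ j)" for i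
  have \<rho>: "\<rho> > 0" using h by linarith
  have S: "(\<lambda>i. c i * h ^ i) sums double_series A h k" if "\<bar>h\<bar> \<le> \<rho>" for h
    unfolding c_def by (rule double_series_sums[OF A \<rho> that]) (use k in simp)
  have "summable (\<lambda>i. c i * \<rho> ^ i)" using S[of \<rho>] \<rho> by (simp add: sums_iff)
  from termdiffs_strong[OF this, of h]
  have d: "((\<lambda>h. \<Sum>i. c i * h ^ i) has_real_derivative (\<Sum>i. diffs c i * h ^ i)) (at h)"
    using h \<rho> by simp
  obtain \<rho>' where \<rho>': "max \<bar>h\<bar> \<bar>k\<bar> < \<rho>'" "\<rho>' < \<rho>" using dense[of "max \<bar>h\<bar> \<bar>k\<bar>" \<rho>] h k by auto
  have \<rho>'0: "\<rho>' > 0" using \<rho>'(1) by linarith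
  have "(\<lambda>i. (\<Sum>\<^sub>\<infinity>j. series_diff A i j * k ^ j) * h ^ i) sums double_series (series_diff A) h k"
    by (rule double_series_sums[OF double_summable_series_diff[OF A _ \<rho>'(2)] \<rho>'0]) (use \<rho>' \<rho>'0 in auto)
  moreover have "(\<Sum>\<^sub>\<infinity>j. series_diff A i j * k ^ j) = diffs c i" for i
    unfolding series_diff_def diffs_def c_def mult.assoc by (subst infsum_cmult_right') simp
  ultimately have "(\<Sum>i. diffs c i * h ^ i) = double_series (series_diff A) h k"
    by (simp add: sums_iff)
  with d have "((\<lambda>h. \<Sum>i. c i * h ^ i) has_real_derivative double_series (series_diff A) h k) (at h)" by simp
  then show ?thesis
    by (rule has_field_derivative_transform_within_open[of _ _ _ "{-\<rho><..<\<rho>}"]) 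
      (use S h in \<open>auto simp: sums_iff\<close>)
qed

section \<open>Analytic maps of two variables and their restriction to analytic curves\<close>

lemma real_analytic2_onE:
  assumes "real_analytic2_on S f" "p \<in> S"
  obtains r a where "r > 0" "\<And>q. q \<in> S \<Longrightarrow> \<bar>fst q - fst p\<bar> < r \<Longrightarrow> \<bar>snd q - snd p\<bar> < r \<Longrightarrow>
        ((\<lambda>(i, j). ((fst q - fst p) ^ i * (snd q - snd p) ^ j) *\<^sub>R a i j) has_sum f q) UNIV"
  using bspec[OF assms(1)[unfolded real_analytic2_on_def] assms(2)] by blast

lemma real_analytic2_on_local:
  fixes F :: "real \<times> real \<Rightarrow> real^3"
  assumes "open S" "real_analytic2_on S F" "p \<in> S"
  obtains \<rho> A where "\<rho> > 0" "double_summable A \<rho>" 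
    "\<And>h k. \<bar>h\<bar> < \<rho> \<Longrightarrow> \<bar>k\<bar> < \<rho> \<Longrightarrow> (fst p + h, snd p + k) \<in> S \<and> F (fst p + h, snd p + k) $ m = double_series A h k"
proof -
  obtain r a where r: "r > 0" and a: "\<And>q. q \<in> S \<Longrightarrow> \<bar>fst q - fst p\<bar> < r \<Longrightarrow> \<bar>snd q - snd p\<bar> < r \<Longrightarrow>
        ((\<lambda>(i, j). ((fst q - fst p) ^ i * (snd q - snd p) ^ j) *\<^sub>R a i j) has_sum F q) UNIV"
    by (rule real_analytic2_onE[OF assms(2,3)]) blast
  obtain V1 V2 where V: "open V1" "open V2" "p \<in> Sigma V1 (\<lambda>_. V2)" "Sigma V1 (\<lambda>_. V2) \<subseteq> S"
    using open_prod_elim[OF assms(1,3)] by metis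
  obtain d1 where d1: "d1 > 0" "ball (fst p) d1 \<subseteq> V1" using V(1,3) open_contains_ball by (metis SigmaE fst_conv)
  obtain d2 where d2: "d2 > 0" "ball (snd p) d2 \<subseteq> V2" using V(2,3) open_contains_ball by (metis SigmaE snd_conv)
  \<comment> \<open>Half of the minimum keeps the corner with both increments equal to \<rho> inside
    the domain and the radius of expansion; summability at this corner is what
    \<open>double_summable\<close> records.\<close>
  define \<rho> where "\<rho> = min r (min d1 d2) / 2"
  have \<rho>: "\<rho> > 0" "\<rho> < r" "\<rho> < d1" "\<rho> < d2" using r d1(1) d2(1) by (auto simp: \<rho>_def)
  have inS: "(fst p + h, snd p + k) \<in> S" if "\<bar>h\<bar> \<le> \<rho>" "\<bar>k\<bar> \<le> \<rho>" for h k
  proof -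
    have "fst p + h \<in> ball (fst p) d1" "snd p + k \<in> ball (snd p) d2" using that \<rho> by (auto simp: dist_real_def)
    then show ?thesis using V(4) d1(2) d2(2) by blast
  qed
  have hs: "((\<lambda>(i, j). a i j $ m * h ^ i * k ^ j) has_sum F (fst p + h, snd p + k) $ m) UNIV"
    if "\<bar>h\<bar> \<le> \<rho>" "\<bar>k\<bar> \<le> \<rho>" for h k
    using has_sum_bounded_linear[OF bounded_linear_vec_nth[of m] a[OF inS[OF that]]] that \<rho>
    by (simp add: case_prod_unfold mult_ac)
  show ?thesis
  proof (rule that[OF \<rho>(1)])
    have "(\<lambda>p. norm (case p of (i, j) \<Rightarrow> a i j $ m * \<rho> ^ i * \<rho> ^ j)) summable_on UNIV"
      using has_sum_imp_summable[OF hs[of \<rho> \<rho>]] \<rho>(1) summable_on_iff_abs_summable_on_real by auto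
    then show "double_summable (\<lambda>i j. a i j $ m) \<rho>"
      unfolding double_summable_def using \<rho>(1) by (simp add: case_prod_unfold abs_mult power_abs)
    show "(fst p + h, snd p + k) \<in> S \<and> F (fst p + h, snd p + k) $ m = double_series (\<lambda>i j. a i j $ m) h k"
      if "\<bar>h\<bar> < \<rho>" "\<bar>k\<bar> < \<rho>" for h k
      using inS[of h k] infsumI[OF hs[of h k]] that unfolding double_series_def by simp
  qed
qed

lemma real_germ_isCont: "real_germ f s \<Longrightarrow> isCont f s"
  using real_germ_deriv DERIV_isCont eventually_nhds_x_imp_x by metis

text \<open>Near a point each component of \<open>F\<close> is a double series, its partial
  derivatives are the termwise differentiated series, and a double series evaluated along two germs
  is a germ. The derivatives enter because the conormal is built from them.\<close>

lemma real_analytic2_on_germ: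
  fixes F :: "real \<times> real \<Rightarrow> real^3"
  assumes S: "open S" "real_analytic2_on S F" "smooth_on S F"
    and x: "real_germ x s" and y: "real_germ y s" and "(x s, y s) \<in> S"
  shows "real_germ (\<lambda>t. F (x t, y t) $ m) s"
    and "real_germ (\<lambda>t. fderiv F (x t, y t) (1, 0) $ m) s"
    and "real_germ (\<lambda>t. fderiv F (x t, y t) (0, 1) $ m) s"
proof -
  obtain \<rho> A where \<rho>: "\<rho> > 0" "double_summable A \<rho>" 
    and F: "\<And>h k. \<bar>h\<bar> < \<rho> \<Longrightarrow> \<bar>k\<bar> < \<rho> \<Longrightarrow> (x s + h, y s + k) \<in> S \<and> F (x s + h, y s + k) $ m = double_series A h k"
    by (rule real_analytic2_on_local[OF S(1,2) assms(6), of m]) auto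
  let ?x = "\<lambda>t. x t - x s" and ?y = "\<lambda>t. y t - y s"
  have g: "real_germ ?x s" "real_germ ?y s" by (intro real_germ_diff x y real_germ_const)+
  have g0: "\<bar>?x s\<bar> < \<rho>" "\<bar>?y s\<bar> < \<rho>" "\<bar>?x s\<bar> < \<rho>/2" "\<bar>?y s\<bar> < \<rho>/2" using \<rho>(1) by simp_all
  have "(?x \<longlongrightarrow> ?x s) (nhds s)" "(?y \<longlongrightarrow> ?y s) (nhds s)"
    using real_germ_isCont[OF g(1)] real_germ_isCont[OF g(2)] 
      tendsto_at_iff_tendsto_nhds[of ?x s] tendsto_at_iff_tendsto_nhds[of ?y s] by (simp_all add: isCont_def)
  then have "\<forall>\<^sub>F t in nhds s. \<bar>?x t\<bar> < \<rho>" "\<forall>\<^sub>F t in nhds s. \<bar>?y t\<bar> < \<rho>"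
    by (auto intro!: order_tendstoD(2)[OF tendsto_rabs] simp: \<rho>(1))
  then have ev: "\<forall>\<^sub>F t in nhds s. \<bar>?x t\<bar> < \<rho> \<and> \<bar>?y t\<bar> < \<rho>" by (rule eventually_conj)
  show "real_germ (\<lambda>t. F (x t, y t) $ m) s"
  proof (rule real_germ_cong[OF double_series_real_germ[OF \<rho>(2) g(1) g0(1) g(2) g0(2)]])
    show "\<forall>\<^sub>F t in nhds s. double_series A (?x t) (?y t) = F (x t, y t) $ m"
      using ev by eventually_elim (use F in fastforce)
  qed
  have der: "((\<lambda>q. F q $ m) has_derivative (\<lambda>v. fderiv F q v $ m)) (at q)" if "q \<in> S" for q
    by (rule bounded_linear.has_derivative[OF bounded_linear_vec_nth smooth_on_has_derivative[OF S(3) that]])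
  have partial: "real_germ (\<lambda>t. fderiv F (x t, y t) v $ m) s"
    if B: "double_summable B \<rho>" and f: "real_germ f s" "\<bar>f s\<bar> < \<rho> / 2" and g: "real_germ g s" "\<bar>g s\<bar> < \<rho> / 2"
      and eq: "\<forall>\<^sub>F t in nhds s. (x t, y t) \<in> S \<and> \<bar>f t\<bar> < \<rho> \<and> \<bar>g t\<bar> < \<rho> \<and>
        (\<forall>h. \<bar>h\<bar> < \<rho> \<longrightarrow> F ((x t, y t) + (h - f t) *\<^sub>R v) $ m = double_series B h (g t))" for B f g v
  proof (rule real_germ_cong[OF double_series_real_germ[OF double_summable_series_diff[OF B, of "\<rho> / 2"] f g]])
    show "\<forall>\<^sub>F t in nhds s. double_series (series_diff B) (f t) (g t) = fderiv F (x t, y t) v $ m"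
      using eq
    proof eventually_elim
      case (elim t)
      then have q: "(x t, y t) \<in> S" by blast
      have "((\<lambda>h. (x t, y t) + (h - f t) *\<^sub>R v) has_derivative (\<lambda>h. h *\<^sub>R v)) (at (f t))"
        by (auto intro!: derivative_eq_intros)
      from has_derivative_compose[OF this, of "\<lambda>q. F q $ m" "\<lambda>w. fderiv F (x t, y t) w $ m"] der[OF q]
      have "((\<lambda>h. F ((x t, y t) + (h - f t) *\<^sub>R v) $ m) has_derivative (\<lambda>h. fderiv F (x t, y t) (h *\<^sub>R v) $ m)) (at (f t))"
        by simp
      then have 1: "((\<lambda>h. F ((x t, y t) + (h - f t) *\<^sub>R v) $ m) has_real_derivative fderiv F (x t, y t) v $ m) (at (f t))"
        unfolding has_field_derivative_def
        by (rule has_derivative_eq_rhs)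
          (simp add: linear_scale[OF has_derivative_linear[OF smooth_on_has_derivative[OF S(3) q]]] fun_eq_iff)
      have "((\<lambda>h. double_series B h (g t)) has_real_derivative double_series (series_diff B) (f t) (g t)) (at (f t))"
        by (rule double_series_deriv[OF B]) (use elim in auto)
      then have "((\<lambda>h. F ((x t, y t) + (h - f t) *\<^sub>R v) $ m) has_real_derivative double_series (series_diff B) (f t) (g t)) (at (f t))"
        by (rule has_field_derivative_transform_within_open[of _ _ _ "ball 0 \<rho>"]) (use elim in auto)
      then show ?case using 1 by (rule DERIV_unique)
    qed
  qed (use \<rho>(1) in auto)
  show "real_germ (\<lambda>t. fderiv F (x t, y t) (1, 0) $ m) s"
  proof (rule partial[OF \<rho>(2) g(1) g0(3) g(2) g0(4)])
    show "\<forall>\<^sub>F t in nhds s. (x t, y t) \<in> S \<and> \<bar>?x t\<bar> < \<rho> \<and> \<bar>?y t\<bar> < \<rho> \<and>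
        (\<forall>h. \<bar>h\<bar> < \<rho> \<longrightarrow> F ((x t, y t) + (h - ?x t) *\<^sub>R (1, 0)) $ m = double_series A h (?y t))"
      using ev by eventually_elim (use F[of "_" "y _ - y s"] F[of "x _ - x s" "y _ - y s"] in \<open>simp add: algebra_simps\<close>)
  qed
  show "real_germ (\<lambda>t. fderiv F (x t, y t) (0, 1) $ m) s"
  proof (rule partial[OF double_summable_transpose[OF \<rho>(2)] g(2) g0(4) g(1) g0(3)])
    show "\<forall>\<^sub>F t in nhds s. (x t, y t) \<in> S \<and> \<bar>?y t\<bar> < \<rho> \<and> \<bar>?x t\<bar> < \<rho> \<and>
        (\<forall>h. \<bar>h\<bar> < \<rho> \<longrightarrow> F ((x t, y t) + (h - ?y t) *\<^sub>R (0, 1)) $ m = double_series (\<lambda>i j. A j i) h (?x t))"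
      using ev by eventually_elim 
        (use F[of "x _ - x s"] F[of "x _ - x s" "y _ - y s"] in \<open>simp add: algebra_simps double_series_transpose[of A]\<close>)
  qed
qed

section \<open>Sums and products of analytic maps of two variables\<close>

lemma real_analytic2_on_add:
  assumes "real_analytic2_on S f" "real_analytic2_on S g"
  shows "real_analytic2_on S (\<lambda>q. f q + g q)"
  unfolding real_analytic2_on_def
proof
  fix p assume p: "p \<in> S"
  obtain r1 a where r1: "r1 > 0"
    and a: "\<And>q. q \<in> S \<Longrightarrow> \<bar>fst q - fst p\<bar> < r1 \<Longrightarrow> \<bar>snd q - snd p\<bar> < r1 \<Longrightarrow>
        ((\<lambda>(i, j). ((fst q - fst p) ^ i * (snd q - snd p) ^ j) *\<^sub>R a i j) has_sum f q) UNIV"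
    by (rule real_analytic2_onE[OF assms(1) p]) blast
  obtain r2 b where r2: "r2 > 0"
    and b: "\<And>q. q \<in> S \<Longrightarrow> \<bar>fst q - fst p\<bar> < r2 \<Longrightarrow> \<bar>snd q - snd p\<bar> < r2 \<Longrightarrow>
        ((\<lambda>(i, j). ((fst q - fst p) ^ i * (snd q - snd p) ^ j) *\<^sub>R b i j) has_sum g q) UNIV"
    by (rule real_analytic2_onE[OF assms(2) p]) blast
  show "\<exists>r>0. \<exists>c. \<forall>q\<in>S. \<bar>fst q - fst p\<bar> < r \<and> \<bar>snd q - snd p\<bar> < r \<longrightarrow>
        ((\<lambda>(i, j). ((fst q - fst p) ^ i * (snd q - snd p) ^ j) *\<^sub>R c i j) has_sum f q + g q) UNIV"
  proof (intro exI[of _ "min r1 r2"] exI[of _ "\<lambda>i j. a i j + b i j"] conjI ballI impI)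
    fix q assume q: "q \<in> S" "\<bar>fst q - fst p\<bar> < min r1 r2 \<and> \<bar>snd q - snd p\<bar> < min r1 r2"
    show "((\<lambda>(i, j). ((fst q - fst p) ^ i * (snd q - snd p) ^ j) *\<^sub>R (a i j + b i j)) has_sum f q + g q) UNIV"
      using has_sum_add[OF a[OF q(1)] b[OF q(1)]] q(2) by (simp add: case_prod_unfold scaleR_add_right)
  qed (use r1 r2 in auto)
qed

lemma real_analytic2_on_cong:
  "real_analytic2_on S f \<Longrightarrow> (\<And>q. q \<in> S \<Longrightarrow> f q = g q) \<Longrightarrow> real_analytic2_on S g"
  unfolding real_analytic2_on_def by (simp cong: ball_cong_simp)

text \<open>The product of two absolutely convergent expansions is summable over pairs of indices.
  The explicit surface and the identity chart are finite sums of maps of this form.\<close>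

lemma real_analytic2_on_product:
  assumes "\<And>q. q \<in> S \<Longrightarrow> real_germ f (fst q)" "\<And>q. q \<in> S \<Longrightarrow> real_germ g (snd q)"
  shows "real_analytic2_on S (\<lambda>q. (f (fst q) * g (snd q)) *\<^sub>R e)"
  unfolding real_analytic2_on_def
proof
  fix p assume p: "p \<in> S"
  obtain r1 a where r1: "r1 > 0" and a: "\<And>h. \<bar>h\<bar> < r1 \<Longrightarrow> summable (\<lambda>n. \<bar>a n * h ^ n\<bar>)"
    "\<And>h. \<bar>h\<bar> < r1 \<Longrightarrow> (\<lambda>n. a n * h ^ n) sums f (fst p + h)"
    by (rule real_germ_expansion[OF assms(1)[OF p]]) blast
  obtain r2 b where r2: "r2 > 0" and b: "\<And>h. \<bar>h\<bar> < r2 \<Longrightarrow> summable (\<lambda>n. \<bar>b n * h ^ n\<bar>)"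
    "\<And>h. \<bar>h\<bar> < r2 \<Longrightarrow> (\<lambda>n. b n * h ^ n) sums g (snd p + h)"
    by (rule real_germ_expansion[OF assms(2)[OF p]]) blast
  show "\<exists>r>0. \<exists>c. \<forall>q\<in>S. \<bar>fst q - fst p\<bar> < r \<and> \<bar>snd q - snd p\<bar> < r \<longrightarrow>
        ((\<lambda>(i, j). ((fst q - fst p) ^ i * (snd q - snd p) ^ j) *\<^sub>R c i j) has_sum (f (fst q) * g (snd q)) *\<^sub>R e) UNIV"
  proof (intro exI[of _ "min r1 r2"] exI[of _ "\<lambda>i j. (a i * b j) *\<^sub>R e"] conjI ballI impI)
    fix q assume q: "q \<in> S" "\<bar>fst q - fst p\<bar> < min r1 r2 \<and> \<bar>snd q - snd p\<bar> < min r1 r2"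
    let ?h = "fst q - fst p" and ?k = "snd q - snd p"
    have A: "((\<lambda>n. a n * ?h ^ n) has_sum f (fst q)) UNIV" "((\<lambda>n. \<bar>a n * ?h ^ n\<bar>) has_sum (\<Sum>n. \<bar>a n * ?h ^ n\<bar>)) UNIV"
      using norm_summable_imp_has_sum[OF _ a(2)[of ?h]] a(1)[of ?h] q(2) 
        norm_summable_imp_has_sum[of "\<lambda>n. \<bar>a n * ?h ^ n\<bar>"] by (auto simp: summable_sums)
    have B: "((\<lambda>n. b n * ?k ^ n) has_sum g (snd q)) UNIV" "((\<lambda>n. \<bar>b n * ?k ^ n\<bar>) has_sum (\<Sum>n. \<bar>b n * ?k ^ n\<bar>)) UNIV"
      using norm_summable_imp_has_sum[OF _ b(2)[of ?k]] b(1)[of ?k] q(2) 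
        norm_summable_imp_has_sum[of "\<lambda>n. \<bar>b n * ?k ^ n\<bar>"] by (auto simp: summable_sums)
    let ?f = "\<lambda>(i, j). (a i * ?h ^ i) * (b j * ?k ^ j)"
    have "(\<lambda>(i, j). \<bar>a i * ?h ^ i\<bar> * \<bar>b j * ?k ^ j\<bar>) summable_on (Sigma UNIV (\<lambda>_. UNIV))"
      by (rule summable_on_SigmaI[where g="\<lambda>i. \<bar>a i * ?h ^ i\<bar> * (\<Sum>n. \<bar>b n * ?k ^ n\<bar>)"])
        (auto intro!: has_sum_cmult_right B(2) summable_on_cmult_left has_sum_imp_summable[OF A(2)])
    then have "?f summable_on (Sigma UNIV (\<lambda>_. UNIV))"
      by (subst summable_on_iff_abs_summable_on_real) (simp add: case_prod_unfold abs_mult mult_ac)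
    then have "(?f has_sum (f (fst q) * g (snd q))) (Sigma UNIV (\<lambda>_. UNIV))"
      by (rule has_sum_SigmaI[rotated 2, where g="\<lambda>i. (a i * ?h ^ i) * g (snd q)"])
        (auto intro!: has_sum_cmult_right has_sum_cmult_left A(1) B(1) simp del: mult_cancel_left)
    then have "((\<lambda>p. ?f p *\<^sub>R e) has_sum ((f (fst q) * g (snd q)) *\<^sub>R e)) UNIV"
      using has_sum_bounded_linear[OF bounded_linear_scaleR_left] by fastforce
    then show "((\<lambda>(i, j). (?h ^ i * ?k ^ j) *\<^sub>R (a i * b j) *\<^sub>R e) has_sum (f (fst q) * g (snd q)) *\<^sub>R e) UNIV"
      by (simp add: case_prod_unfold mult_ac)
  qed (use r1 r2 in auto)
qed

section \<open>Analytic curves in space\<close>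

definition vec_germ :: "(real \<Rightarrow> real^3) \<Rightarrow> real \<Rightarrow> bool" where
  "vec_germ f s \<longleftrightarrow> (\<forall>i. real_germ (\<lambda>t. f t $ i) s)"

lemma vec_germ_cong: "vec_germ f s \<Longrightarrow> \<forall>\<^sub>F t in nhds s. f t = g t \<Longrightarrow> vec_germ g s"
  unfolding vec_germ_def by (auto elim!: real_germ_cong eventually_mono)

lemma vec_germ_eventually: "vec_germ f s \<Longrightarrow> \<forall>\<^sub>F t in nhds s. vec_germ f t"
  unfolding vec_germ_def by (intro eventually_all_finite) (auto intro: real_germ_eventually)

lemma vec_germ_const: "vec_germ (\<lambda>t. c) s"
  by (simp add: vec_germ_def real_germ_const)

lemma vec_germ_add: "vec_germ f s \<Longrightarrow> vec_germ g s \<Longrightarrow> vec_germ (\<lambda>t. f t + g t) s"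
  by (simp add: vec_germ_def real_germ_add)

lemma vec_germ_diff: "vec_germ f s \<Longrightarrow> vec_germ g s \<Longrightarrow> vec_germ (\<lambda>t. f t - g t) s"
  by (simp add: vec_germ_def real_germ_diff)

lemma vec_germ_scaleR: "real_germ c s \<Longrightarrow> vec_germ f s \<Longrightarrow> vec_germ (\<lambda>t. c t *\<^sub>R f t) s"
  by (simp add: vec_germ_def real_germ_mult)

lemma vec_germ_inner: "vec_germ f s \<Longrightarrow> vec_germ g s \<Longrightarrow> real_germ (\<lambda>t. f t \<bullet> g t) s"
  by (auto simp: vec_germ_def inner_vec_def intro!: real_germ_sum real_germ_mult)

lemma vec_germ_cross: "vec_germ f s \<Longrightarrow> vec_germ g s \<Longrightarrow> vec_germ (\<lambda>t. f t \<times> g t) s"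
  by (auto simp: vec_germ_def forall_3 cross_components intro!: real_germ_diff real_germ_mult)

lemma vec_germ_identity:
  assumes "vec_germ f s" "vec_germ g s" "\<exists>\<^sub>F t in at s. f t = g t"
  shows "\<forall>\<^sub>F t in nhds s. f t = g t"
proof -
  have "\<forall>\<^sub>F t in nhds s. f t $ i = g t $ i" for i
    by (rule real_germ_identity) (use assms in \<open>auto simp: vec_germ_def elim!: frequently_elim1\<close>)
  then have "\<forall>\<^sub>F t in nhds s. \<forall>i. f t $ i = g t $ i" by (intro eventually_all_finite) auto
  then show ?thesis by (simp add: vec_eq_iff)
qed

lemma has_vector_derivative_vec3:
  fixes f :: "real \<Rightarrow> real^3"
  shows "(f has_vector_derivative d) (at t) \<longleftrightarrow> (\<forall>i. ((\<lambda>t. f t $ i) has_real_derivative d $ i) (at t))"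
proof -
  have "(f has_vector_derivative d) (at t) \<longleftrightarrow> (\<forall>b\<in>Basis. ((\<lambda>t. f t \<bullet> b) has_derivative (\<lambda>h. (h *\<^sub>R d) \<bullet> b)) (at t))"
    unfolding has_vector_derivative_def has_derivative_componentwise_within[of f] ..
  also have "\<dots> \<longleftrightarrow> (\<forall>i. ((\<lambda>t. f t $ i) has_derivative (\<lambda>h. h * d $ i)) (at t))"
    by (auto simp: Basis_vec_def inner_axis)
  also have "\<dots> \<longleftrightarrow> (\<forall>i. ((\<lambda>t. f t $ i) has_real_derivative d $ i) (at t))"
    by (simp add: has_real_derivative_iff_has_vector_derivative has_vector_derivative_def)
  finally show ?thesis .
qed

lemma vec_germ_deriv:
  assumes "vec_germ f s"
  obtains f' where "vec_germ f' s" "\<forall>\<^sub>F t in nhds s. (f has_vector_derivative f' t) (at t)"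
proof -
  have "\<exists>f'. real_germ f' s \<and> (\<forall>\<^sub>F t in nhds s. ((\<lambda>t. f t $ i) has_real_derivative f' t) (at t))" for i
    using real_germ_deriv assms unfolding vec_germ_def by metis
  then obtain f' where f': "\<And>i. real_germ (f' i) s" 
    "\<And>i. \<forall>\<^sub>F t in nhds s. ((\<lambda>t. f t $ i) has_real_derivative f' i t) (at t)" by metis
  have "\<forall>\<^sub>F t in nhds s. \<forall>i. ((\<lambda>t. f t $ i) has_real_derivative f' i t) (at t)"
    by (intro eventually_all_finite f')
  then have "\<forall>\<^sub>F t in nhds s. (f has_vector_derivative (\<chi> i. f' i t)) (at t)"
    by (simp add: has_vector_derivative_vec3)
  moreover have "vec_germ (\<lambda>t. \<chi> i. f' i t) s" using f'(1) by (simp add: vec_germ_def)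
  ultimately show ?thesis using that by blast
qed

lemma vec_germ_vector_derivative:
  assumes "vec_germ f s"
  shows "(f has_vector_derivative vector_derivative f (at s)) (at s)"
    and "vec_germ (\<lambda>t. vector_derivative f (at t)) s"
proof -
  obtain f' where f': "vec_germ f' s" "\<forall>\<^sub>F t in nhds s. (f has_vector_derivative f' t) (at t)"
    by (rule vec_germ_deriv[OF assms])
  have "\<forall>\<^sub>F t in nhds s. f' t = vector_derivative f (at t)"
    using f'(2) by eventually_elim (simp add: vector_derivative_at)
  then show "vec_germ (\<lambda>t. vector_derivative f (at t)) s" by (rule vec_germ_cong[OF f'(1)])
  show "(f has_vector_derivative vector_derivative f (at s)) (at s)"
    using eventually_nhds_x_imp_x[OF f'(2)] vector_derivative_at by fastforce
qed

lemma vec_germ_isCont: "vec_germ f s \<Longrightarrow> isCont f s"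
  using vec_germ_vector_derivative(1) has_vector_derivative_continuous by blast

lemma vec_germ_primitive:
  assumes "vec_germ f s" "\<forall>\<^sub>F t in nhds s. (g has_vector_derivative f t) (at t)"
  shows "vec_germ g s"
  unfolding vec_germ_def
proof
  fix i
  have "\<forall>\<^sub>F t in nhds s. ((\<lambda>t. g t $ i) has_real_derivative f t $ i) (at t)"
    using assms(2) by eventually_elim (simp add: has_vector_derivative_vec3)
  then show "real_germ (\<lambda>t. g t $ i) s"
    by (rule real_germ_primitive[rotated]) (use assms(1) in \<open>simp add: vec_germ_def\<close>)
qed

lemma smooth_on_vec_germ:
  assumes "open J" "\<And>t. t \<in> J \<Longrightarrow> vec_germ f t"
  shows "smooth_on J f"
proof -
  have "f = (\<lambda>t. \<Sum>i\<in>UNIV. f t $ i *\<^sub>R axis i 1)"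
    by (rule ext) (simp add: vec_eq_iff axis_def if_distrib sum.If_cases cong del: if_weak_cong)
  moreover have "smooth_on J (\<lambda>t. \<Sum>i\<in>UNIV. f t $ i *\<^sub>R axis i (1::real))"
    unfolding sum_3 using assms 
    by (intro smooth_on_add smooth_on_bilinear[OF assms(1) bounded_bilinear_scaleR] smooth_on_real_germ smooth_on_const)
      (auto simp: vec_germ_def)
  ultimately show ?thesis by simp
qed

text \<open>Since \<open>s\<close> is a limit point, the expansion at \<open>s\<close> converges at
  some other point of \<open>S\<close>, and its sum is then defined on both sides of
  \<open>s\<close> even if \<open>S\<close> lies on one side. The functional \<open>L\<close>
  selects a real coordinate, because germs are real-valued.\<close>

lemma real_analytic_on_extends:
  fixes L :: "'b::real_normed_vector \<Rightarrow> real"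
  assumes "real_analytic_on S f" "s \<in> S" "s islimpt S" "bounded_linear L"
  obtains g where "real_germ g s" "\<forall>\<^sub>F t in nhds s. t \<in> S \<longrightarrow> g t = L (f t)"
proof -
  obtain r a where r: "r > 0" and a: "\<forall>t\<in>S. \<bar>t - s\<bar> < r \<longrightarrow> (\<lambda>n. (t - s) ^ n *\<^sub>R a n) sums f t"
    using bspec[OF assms(1)[unfolded real_analytic_on_def] assms(2)] by blast
  have sm: "(\<lambda>n. L (a n) * (t - s) ^ n) sums L (f t)" if "t \<in> S" "\<bar>t - s\<bar> < r" for t
    using bounded_linear.sums[OF assms(4) a[rule_format, OF that]]
    by (simp add: linear_scale[OF bounded_linear.linear[OF assms(4)]] mult.commute)
  obtain t1 where t1: "t1 \<in> S" "t1 \<noteq> s" "dist t1 s < r" using assms(3) r unfolding islimpt_approachable by blast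
  show ?thesis
  proof (rule that)
    show "real_germ (\<lambda>t. \<Sum>n. L (a n) * (t - s) ^ n) s"
      by (rule real_germ_power_series[OF _ t1(2)]) (use sm[OF t1(1)] t1(3) in \<open>simp add: sums_iff dist_real_def\<close>)
    have "\<forall>\<^sub>F t in nhds s. \<bar>t - s\<bar> < r"
      using r unfolding eventually_nhds_metric dist_real_def by blast
    then show "\<forall>\<^sub>F t in nhds s. t \<in> S \<longrightarrow> (\<Sum>n. L (a n) * (t - s) ^ n) = L (f t)"
      by eventually_elim (use sm in \<open>auto simp: sums_iff\<close>)
  qed
qed

lemma interval_islimpt:
  fixes I :: "real set"
  assumes "is_interval I" "interior I \<noteq> {}" "s \<in> I"
  shows "s islimpt I"
proof -
  have "connected I" using assms(1) is_interval_connected by blast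
  moreover have "I \<noteq> {s}" using assms(2) by (metis interior_singleton)
  ultimately show ?thesis using connected_imp_perfect assms(3) by blast
qed

lemma vec_extends:
  assumes "is_interval I" "interior I \<noteq> {}" "real_analytic_on I f" "s \<in> I"
  obtains g where "vec_germ g s" "\<forall>\<^sub>F t in nhds s. t \<in> I \<longrightarrow> g t = f t"
proof -
  have "\<exists>g. real_germ g s \<and> (\<forall>\<^sub>F t in nhds s. t \<in> I \<longrightarrow> g t = f t $ i)" for i
    by (rule real_analytic_on_extends[OF assms(3,4) interval_islimpt[OF assms(1,2,4)] bounded_linear_vec_nth[of i]]) blast
  then obtain g where g: "\<And>i. real_germ (g i) s" "\<And>i. \<forall>\<^sub>F t in nhds s. t \<in> I \<longrightarrow> g i t = f t $ i" by metis
  have "\<forall>\<^sub>F t in nhds s. \<forall>i. t \<in> I \<longrightarrow> g i t = f t $ i" by (intro eventually_all_finite g)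
  then have "\<forall>\<^sub>F t in nhds s. t \<in> I \<longrightarrow> (\<chi> i. g i t) = f t" 
    by eventually_elim (auto simp: vec_eq_iff)
  moreover have "vec_germ (\<lambda>t. \<chi> i. g i t) s" using g(1) by (simp add: vec_germ_def)
  ultimately show ?thesis using that by blast
qed

text \<open>Only the points of \<open>I\<close> outside its interior need a continuation, and on
  each side of an interior point \<open>m\<close> there is at most one of them. Continuations of
  radius at most the distance to \<open>m\<close> stay on their own side and cannot
  conflict.\<close>

lemma vec_extension:
  fixes I :: "real set" and f :: "real \<Rightarrow> real^3"
  assumes I: "is_interval I" "interior I \<noteq> {}" and f: "real_analytic_on I f"
  obtains J g where "open J" "is_interval J" "I \<subseteq> J" "\<And>t. t \<in> J \<Longrightarrow> vec_germ g t" "\<And>t. t \<in> I \<Longrightarrow> g t = f t"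
proof -
  obtain m where m: "m \<in> interior I" using I(2) by blast
  have mI: "m \<in> I" using m interior_subset by blast
  define E where "E = I - interior I"
  have btw: "x \<in> interior I" if "x \<in> I" "y \<in> I" "z \<in> I" "y < x" "x < z" for x y z
  proof (rule interiorI[of "{y<..<z}"])
    show "{y<..<z} \<subseteq> I"
    proof
      fix u assume "u \<in> {y<..<z}"
      then show "u \<in> I"
        using I(1)[unfolded is_interval_1, rule_format, OF that(2,3), of u] by simp
    qed
  qed (use that in auto)
  obtain d0 where d0: "d0 > 0" "ball m d0 \<subseteq> I" using m mem_interior by blast
  have m': "m - d0/2 \<in> I" "m + d0/2 \<in> I" using d0 by (auto simp: subset_iff dist_real_def)
  have Em: "s \<noteq> m" if "s \<in> E" for s using that m unfolding E_def by blast
  have E_left: "s \<le> t" if "s \<in> E" "s < m" "t \<in> I" for s t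
    using btw[of s t m] that mI unfolding E_def by force
  have E_right: "t \<le> s" if "s \<in> E" "m < s" "t \<in> I" for s t
    using btw[of s m t] that mI unfolding E_def by force
  have uniq: "s = s'" if "s \<in> E" "s' \<in> E" "s < m \<longleftrightarrow> s' < m" for s s'
    using that E_left[of s s'] E_left[of s' s] E_right[of s s'] E_right[of s' s] Em unfolding E_def
    by (metis DiffD1 linorder_less_linear order_antisym)
  have "\<exists>g d. 0 < d \<and> d \<le> \<bar>s - m\<bar> \<and> (\<forall>t. \<bar>t - s\<bar> < d \<longrightarrow> vec_germ g t) \<and> (\<forall>t\<in>I. \<bar>t - s\<bar> < d \<longrightarrow> g t = f t)"
    if s: "s \<in> E" for s
  proof -
    have "s \<in> I" using s unfolding E_def by simp
    then obtain g where g: "vec_germ g s" "\<forall>\<^sub>F t in nhds s. t \<in> I \<longrightarrow> g t = f t"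
      using vec_extends[OF I f] by blast
    from eventually_conj[OF vec_germ_eventually[OF g(1)] g(2)]
    obtain d where d: "d > 0" "\<And>t. \<bar>t - s\<bar> < d \<Longrightarrow> vec_germ g t \<and> (t \<in> I \<longrightarrow> g t = f t)"
      unfolding eventually_nhds_metric dist_real_def by blast
    show ?thesis
      using d Em[OF s] by (intro exI[of _ g] exI[of _ "min d \<bar>s - m\<bar>"]) auto
  qed
  then obtain g d where gd: "\<And>s. s \<in> E \<Longrightarrow> 0 < d s" "\<And>s. s \<in> E \<Longrightarrow> d s \<le> \<bar>s - m\<bar>"
    "\<And>s t. s \<in> E \<Longrightarrow> \<bar>t - s\<bar> < d s \<Longrightarrow> vec_germ (g s) t"
    "\<And>s t. s \<in> E \<Longrightarrow> t \<in> I \<Longrightarrow> \<bar>t - s\<bar> < d s \<Longrightarrow> g s t = f t" by metis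
  have side: "t < m \<longleftrightarrow> s < m" if "s \<in> E" "\<bar>t - s\<bar> < d s" for s t
    using gd(2)[OF that(1)] that(2) by linarith
  \<comment> \<open>By \<open>uniq\<close> and \<open>side\<close> at most one of the balls contains
    \<open>t\<close>, so the choice is forced wherever it matters.\<close>
  define e where "e t = (SOME s. s \<in> E \<and> \<bar>t - s\<bar> < d s)" for t
  have e: "e t = s" if "s \<in> E" "\<bar>t - s\<bar> < d s" for s t
  proof -
    have "e t \<in> E \<and> \<bar>t - e t\<bar> < d (e t)" unfolding e_def by (rule someI[of _ s]) (use that in blast)
    then show ?thesis using uniq[of "e t" s] side[of "e t" t] side[of s t] that by blast
  qed
  define h where "h t = (if t \<in> I then f t else g (e t) t)" for t
  define J where "J = I \<union> (\<Union>s\<in>E. ball s (d s))"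
  have hE: "h t = g s t" if "s \<in> E" "\<bar>t - s\<bar> < d s" for s t
    using e[OF that] gd(4)[OF that(1) _ that(2)] by (simp add: h_def)
  \<comment> \<open>This form shows that \<open>J\<close> is open: a point of \<open>I\<close>
    outside the interior is the centre of one of the balls.\<close>
  have J_eq: "J = interior I \<union> (\<Union>s\<in>E. ball s (d s))"
    using gd(1) interior_subset unfolding J_def E_def by (auto intro!: centre_in_ball[THEN iffD2])
  show ?thesis
  proof
    show "open J" unfolding J_eq by (intro open_Un open_interior open_UN ballI open_ball)
    have cI: "connected I" using I(1) is_interval_connected by blast
    have "J = \<Union>(insert I ((\<lambda>s. I \<union> ball s (d s)) ` E))" unfolding J_def by auto
    also have "connected \<dots>"
    proof (rule connected_Union)
      show "connected s" if s: "s \<in> insert I ((\<lambda>s. I \<union> ball s (d s)) ` E)" for s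
      proof -
        have "connected (I \<union> ball s (d s))" if "s \<in> E" for s
          by (rule connected_Un[OF cI connected_ball]) (use that gd(1) E_def in auto)
        then show ?thesis using s cI by auto
      qed
      show "\<Inter>(insert I ((\<lambda>s. I \<union> ball s (d s)) ` E)) \<noteq> {}" using mI by auto
    qed
    finally show "is_interval J" by (simp add: is_interval_connected_1)
    show "I \<subseteq> J" by (simp add: J_def)
    show "h t = f t" if "t \<in> I" for t using that by (simp add: h_def)
    show "vec_germ h t" if t: "t \<in> J" for t
    proof (cases "t \<in> interior I")
      case True
      then obtain g0 where g0: "vec_germ g0 t" "\<forall>\<^sub>F u in nhds t. u \<in> I \<longrightarrow> g0 u = f u"
        using vec_extends[OF I f] interior_subset by blast
      have "\<forall>\<^sub>F u in nhds t. u \<in> interior I" by (rule eventually_nhds_in_open[OF open_interior True])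
      with g0(2) have "\<forall>\<^sub>F u in nhds t. g0 u = h u"
        by eventually_elim (use interior_subset h_def in auto)
      then show ?thesis by (rule vec_germ_cong[OF g0(1)])
    next
      case False
      then obtain s where s: "s \<in> E" "t \<in> ball s (d s)" using t unfolding J_eq by blast
      then have "vec_germ (g s) t" using gd(3)[OF s(1)] by (simp add: dist_real_def abs_minus_commute)
      moreover have "\<forall>\<^sub>F u in nhds t. u \<in> ball s (d s)" by (rule eventually_nhds_in_open) (use s in auto)
      then have "\<forall>\<^sub>F u in nhds t. g s u = h u"
        by eventually_elim (use hE[OF s(1)] in \<open>simp add: dist_real_def abs_minus_commute\<close>)
      ultimately show ?thesis by (rule vec_germ_cong)
    qed
  qed
qed

lemma open_interval_primitive:
  fixes f :: "real \<Rightarrow> 'b::euclidean_space"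
  assumes J: "open J" "is_interval J" and "s \<in> J" and f: "continuous_on J f"
  obtains P where "\<And>t. t \<in> J \<Longrightarrow> (P has_vector_derivative f t) (at t)"
proof
  fix t assume t: "t \<in> J"
  \<comment> \<open>Closed intervals around \<open>s\<close> and around \<open>t\<close> are merged
    into one that has \<open>t\<close> in its interior. There the derivative within the interval,
    which the fundamental theorem provides, is the full derivative.\<close>
  have "\<exists>a b. a < x \<and> x < b \<and> {a..b} \<subseteq> J" if x: "x \<in> J" for x
  proof -
    obtain e where e: "e > 0" "cball x e \<subseteq> J" using x J(1) unfolding open_contains_cball by blast
    then show ?thesis by (intro exI[of _ "x - e"] exI[of _ "x + e"]) (auto simp: cball_eq_atLeastAtMost)
  qed
  then obtain a1 b1 a2 b2 where ab: "a1 < s" "s < b1" "{a1..b1} \<subseteq> J" "a2 < t" "t < b2" "{a2..b2} \<subseteq> J"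
    using t assms(3) by metis
  define a b where "a = min a1 a2" and "b = max b1 b2"
  have mem: "a1 \<in> J" "a2 \<in> J" "b1 \<in> J" "b2 \<in> J" using ab by (auto simp: subset_iff)
  then have "a \<in> J" "b \<in> J" by (auto simp: a_def b_def min_def max_def)
  then have sub: "{a..b} \<subseteq> J"
    using J(2)[unfolded is_interval_1, rule_format, of a b] by (simp add: subset_iff)
  have *: "a \<le> s" "s \<le> b" "t \<in> {a<..<b}" using ab by (auto simp: a_def b_def)
  have "((\<lambda>u. LBINT y=s..u. f y) has_vector_derivative f t) (at t within {a..b})"
    by (rule interval_integral_FTC2[OF *(1,2) continuous_on_subset[OF f sub]]) (use *(3) in auto)
  then show "((\<lambda>u. LBINT y=s..u. f y) has_vector_derivative f t) (at t)"
    using *(3) at_within_interior[of t "{a..b}"] by (simp add: interior_atLeastAtMost_real)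
qed

section \<open>The surface with given null data\<close>

text \<open>Expansion in the dual basis of \<open>p\<close>, \<open>q\<close>, \<open>r\<close>,
  multiplied by the determinant. It shows that a conormal is determined by its inner products with
  two tangent vectors and \<xi>.\<close>

lemma cross3_cramer_dual:
  "((p \<times> q) \<bullet> r) *\<^sub>R n = (n \<bullet> p) *\<^sub>R (q \<times> r) + (n \<bullet> q) *\<^sub>R (r \<times> p) + (n \<bullet> r) *\<^sub>R (p \<times> q)"
  unfolding vec_eq_iff forall_3
  by (simp only: vector_add_component vector_scaleR_component cross_components inner_vec_def sum_3 inner_real_def real_scaleR_def)
    (intro conjI; algebra)

definition jac :: "real^3 \<Rightarrow> (real \<times> real \<Rightarrow> real^3) \<Rightarrow> real \<times> real \<Rightarrow> real" where
  "jac \<xi> F p = (fderiv F p (1, 0) \<times> fderiv F p (0, 1)) \<bullet> \<xi>"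

lemma triple_det_fderiv:
  assumes "linear (fderiv F p)"
  shows "triple_det (fderiv F p v) (fderiv F p w) \<xi> = (fst v * snd w - snd v * fst w) * jac \<xi> F p"
  unfolding triple_det_cross jac_def linear_pair_expand[OF assms, of v] linear_pair_expand[OF assms, of w]
  using cross_skew[of "fderiv F p (0, 1)" "fderiv F p (1, 0)"]
  by (simp add: cross_add_left cross_add_right cross_mult_left cross_mult_right inner_add_left algebra_simps)

lemma conormal_unique:
  assumes "jac \<xi> F p \<noteq> 0" "linear (fderiv F p)"
    and "n \<bullet> \<xi> = 1" "\<And>v. n \<bullet> fderiv F p v = 0" "m \<bullet> \<xi> = 1" "m \<bullet> fderiv F p (1, 0) = 0" "m \<bullet> fderiv F p (0, 1) = 0"
  shows "m = n"
proof -
  have "jac \<xi> F p *\<^sub>R m = jac \<xi> F p *\<^sub>R n"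
    using assms cross3_cramer_dual[of "fderiv F p (1, 0)" "fderiv F p (0, 1)" \<xi> m]
      cross3_cramer_dual[of "fderiv F p (1, 0)" "fderiv F p (0, 1)" \<xi> n] by (simp add: jac_def)
  then show ?thesis using assms(1) by simp
qed

text \<open>Differentiating the relation \<open>n q \<bullet> fderiv F q w = 0\<close> moves the
  derivative from the immersion to the conormal, and the conormal reads off the coefficient of \<xi>
  because it annihilates tangent vectors and has inner product 1 with \<xi>.\<close>

lemma affine_metric_eq:
  assumes S: "open S" "smooth_on S F" "p \<in> S" and jac: "jac \<xi> F p \<noteq> 0"
    and n: "\<And>q v. q \<in> S \<Longrightarrow> n q \<bullet> fderiv F q v = 0" "n p \<bullet> \<xi> = 1"
    and dn: "(n has_derivative n') (at p)"
  shows "affine_metric \<xi> F p v w = - (n' v \<bullet> fderiv F p w)"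
proof -
  have dw: "((\<lambda>q. fderiv F q w) has_derivative fderiv (\<lambda>q. fderiv F q w) p) (at p)"
    by (rule smooth_on_has_derivative[OF smooth_on_fderiv[OF S(2)] S(3)])
  let ?y = "fderiv (\<lambda>q. fderiv F q w) p v"
  have lin: "linear (fderiv F p)" by (rule has_derivative_linear[OF smooth_on_has_derivative[OF S(2,3)]])
  have "((\<lambda>q. n q \<bullet> fderiv F q w) has_derivative (\<lambda>v. n p \<bullet> fderiv (\<lambda>q. fderiv F q w) p v + n' v \<bullet> fderiv F p w)) (at p)"
    by (rule has_derivative_inner[OF dn dw])
  moreover have "((\<lambda>q. n q \<bullet> fderiv F q w) has_derivative (\<lambda>v. 0)) (at p)"
    by (rule has_derivative_transform_within_open[OF _ S(1,3), of "\<lambda>q. 0"]) (use n(1) in auto)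
  ultimately have "(\<lambda>v. n p \<bullet> fderiv (\<lambda>q. fderiv F q w) p v + n' v \<bullet> fderiv F p w) = (\<lambda>v. 0)"
    by (rule has_derivative_unique)
  from fun_cong[OF this, of v] have eq: "n p \<bullet> ?y = - (n' v \<bullet> fderiv F p w)" by linarith
  show ?thesis
    unfolding affine_metric_def
  proof (rule the_equality)
    let ?p = "fderiv F p (1, 0)" and ?q = "fderiv F p (0, 1)"
    \<comment> \<open>The coefficients of the second derivative in the frame of the two tangent
      vectors and \<xi>, by Cramer's rule; \<open>x\<close> represents the connection term.\<close>
    define x where "x = (((?y \<times> ?q) \<bullet> \<xi>) / jac \<xi> F p, ((?p \<times> ?y) \<bullet> \<xi>) / jac \<xi> F p)"
    define t where "t = ((?p \<times> ?q) \<bullet> ?y) / jac \<xi> F p"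
    have "jac \<xi> F p *\<^sub>R ?y = jac \<xi> F p *\<^sub>R (fderiv F p x + t *\<^sub>R \<xi>)"
      unfolding linear_pair_expand[OF lin, of x] using cross3_cramer[of ?p ?q \<xi> ?y] jac
      by (simp add: x_def t_def scaleR_add_right jac_def[symmetric])
    then have y: "?y = fderiv F p x + t *\<^sub>R \<xi>" using jac by simp
    then have "n p \<bullet> ?y = t" using n(1)[OF S(3)] n(2) by (simp add: inner_add_right)
    then show "\<exists>z. ?y = fderiv F p z + (- (n' v \<bullet> fderiv F p w)) *\<^sub>R \<xi>" using y eq by metis
    show "h = - (n' v \<bullet> fderiv F p w)" if ex: "\<exists>z. ?y = fderiv F p z + h *\<^sub>R \<xi>" for h
    proof -
      obtain z where "?y = fderiv F p z + h *\<^sub>R \<xi>" using ex by blast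
      then have "n p \<bullet> ?y = h" using n(1)[OF S(3)] n(2) by (simp add: inner_add_right)
      then show ?thesis using eq by simp
    qed
  qed
qed

lemma fderiv_transform:
  assumes "open S" "x \<in> S" "\<And>y. y \<in> S \<Longrightarrow> f y = g y"
  shows "fderiv f x = fderiv g x"
proof -
  have "(f has_derivative D) (at x) \<longleftrightarrow> (g has_derivative D) (at x)" for D
    using has_derivative_transform_within_open[OF _ assms(1,2)] assms(3) by metis
  then show ?thesis by (simp add: frechet_derivative_def)
qed

lemma vec3_expand: "(\<Sum>i\<in>UNIV. x $ i *\<^sub>R axis i 1) = (x :: real^3)"
  by (simp add: vec_eq_iff axis_def if_distrib sum.If_cases cong del: if_weak_cong)

text \<open>The cross product as a sum of products of scalar components with constant vectors, which
  is the shape that \<open>real_analytic2_on_product\<close> accepts.\<close>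

lemma cross3_expand: "(\<Sum>i\<in>UNIV. \<Sum>j\<in>UNIV. (y $ i * x $ j) *\<^sub>R (axis j 1 \<times> axis i 1)) = x \<times> y"
proof -
  interpret bounded_bilinear "(\<times>)" by (rule bounded_bilinear_cross3)
  have "x \<times> y = (\<Sum>j\<in>UNIV. x $ j *\<^sub>R axis j 1) \<times> (\<Sum>i\<in>UNIV. y $ i *\<^sub>R axis i 1)"
    by (simp only: vec3_expand)
  also have "\<dots> = (\<Sum>i\<in>UNIV. \<Sum>j\<in>UNIV. (y $ i * x $ j) *\<^sub>R (axis j 1 \<times> axis i 1))"
    by (simp add: sum_left sum_right cross_mult_left cross_mult_right scaleR_sum_right mult.commute)
  finally show ?thesis by simp
qed

lemma real_analytic2_on_sum:
  assumes "finite B" "\<And>i. i \<in> B \<Longrightarrow> real_analytic2_on S (f i)"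
  shows "real_analytic2_on S (\<lambda>q. \<Sum>i\<in>B. f i q)"
  using assms
proof (induction B rule: finite_induct)
  case empty
  have "real_analytic2_on S (\<lambda>q. (0 * 0) *\<^sub>R 0)"
    by (rule real_analytic2_on_product[of S "\<lambda>_. 0" "\<lambda>_. 0"]) (rule real_germ_const)+
  then show ?case by simp
qed (auto intro: real_analytic2_on_add)

lemma second_countable_euclidean: "second_countable (euclidean :: 'a::second_countable_topology topology)"
proof -
  obtain B :: "'a set set" where B: "countable B" "topological_basis B"
    using ex_countable_basis by blast
  have "\<exists>V\<in>B. x \<in> V \<and> V \<subseteq> W" if "open W" "x \<in> W" for W x
    by (rule topological_basisE[OF B(2) that]) blast
  moreover have "open V" if "V \<in> B" for V using topological_basis_open[OF B(2) that] .
  ultimately show ?thesis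
    unfolding second_countable_def open_openin[symmetric] using B(1) by blast
qed

lemma in_chart_id: "q \<in> S \<Longrightarrow> in_chart (S, id) f q = f q"
  using inv_into_f_f[of id S q] by (simp add: in_chart_def)

text \<open>The two curves of the null representation with their derivatives and primitives. The
  values 1/2 in \<open>half\<close> divide the normalisation of the conormal equally between
  \<open>a\<close> and \<open>b\<close>. The set \<open>J\<close> may be larger than the interval
  that carries the Cauchy data.\<close>

locale null_data =
  fixes \<xi> :: "real^3" and J :: "real set" and a b a' b' P Q :: "real \<Rightarrow> real^3"
  assumes J: "open J"
    and germ: "\<And>t. t \<in> J \<Longrightarrow> vec_germ a t" "\<And>t. t \<in> J \<Longrightarrow> vec_germ b t"
      "\<And>t. t \<in> J \<Longrightarrow> vec_germ a' t" "\<And>t. t \<in> J \<Longrightarrow> vec_germ b' t"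
      "\<And>t. t \<in> J \<Longrightarrow> vec_germ P t" "\<And>t. t \<in> J \<Longrightarrow> vec_germ Q t"
    and der: "\<And>t. t \<in> J \<Longrightarrow> (a has_vector_derivative a' t) (at t)"
      "\<And>t. t \<in> J \<Longrightarrow> (b has_vector_derivative b' t) (at t)"
      "\<And>t. t \<in> J \<Longrightarrow> (P has_vector_derivative (a t \<times> a' t)) (at t)"
      "\<And>t. t \<in> J \<Longrightarrow> (Q has_vector_derivative - (b t \<times> b' t)) (at t)"
    and half: "\<And>t. t \<in> J \<Longrightarrow> a t \<bullet> \<xi> = 1/2" "\<And>t. t \<in> J \<Longrightarrow> b t \<bullet> \<xi> = 1/2"
begin

definition conormal :: "real \<times> real \<Rightarrow> real^3" where
  "conormal p = a (fst p) + b (snd p)"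

definition surf :: "real \<times> real \<Rightarrow> real^3" where
  "surf p = P (fst p) + Q (snd p) + b (snd p) \<times> a (fst p)"

text \<open>The affine metric turns out to be \<open>- null_det\<close> times the symmetric form du
  dv + dv du, and \<open>- null_det\<close> is also the determinant of the tangent frame with \<xi>.
  Its zeros are the singular points of \<open>surf\<close>.\<close>

definition null_det :: "real \<times> real \<Rightarrow> real" where
  "null_det p = (a' (fst p) \<times> b' (snd p)) \<bullet> conormal p"

definition null_dom :: "(real \<times> real) set" where
  "null_dom = {p. fst p \<in> J \<and> snd p \<in> J}"

definition reg_dom :: "(real \<times> real) set" where
  "reg_dom = {p \<in> null_dom. null_det p \<noteq> 0}"

lemma open_null_dom: "open null_dom"
proof -
  have "null_dom = Sigma J (\<lambda>_. J)" by (auto simp: null_dom_def)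
  then show ?thesis using open_Times[OF J J] by simp
qed

lemma der_fst: "fst p \<in> J \<Longrightarrow> (f has_vector_derivative f') (at (fst p)) \<Longrightarrow>
    ((\<lambda>p. f (fst p)) has_derivative (\<lambda>v. fst v *\<^sub>R f')) (at p)"
  using has_derivative_compose[OF has_derivative_fst[OF has_derivative_ident], of f _ p UNIV]
  by (simp add: has_vector_derivative_def)

lemma der_snd: "snd p \<in> J \<Longrightarrow> (f has_vector_derivative f') (at (snd p)) \<Longrightarrow>
    ((\<lambda>p. f (snd p)) has_derivative (\<lambda>v. snd v *\<^sub>R f')) (at p)"
  using has_derivative_compose[OF has_derivative_snd[OF has_derivative_ident], of f _ p UNIV]
  by (simp add: has_vector_derivative_def)

lemma smooth_fst:
  fixes f :: "real \<Rightarrow> real^3"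
  assumes "\<And>t. t \<in> J \<Longrightarrow> vec_germ f t" shows "smooth_on null_dom (\<lambda>p. f (fst p))"
  by (rule smooth_on_compose[OF open_null_dom J _ smooth_on_vec_germ[OF J assms] smooth_on_linear[OF bounded_linear_fst]])
    (auto simp: null_dom_def)

lemma smooth_snd:
  fixes f :: "real \<Rightarrow> real^3"
  assumes "\<And>t. t \<in> J \<Longrightarrow> vec_germ f t" shows "smooth_on null_dom (\<lambda>p. f (snd p))"
  by (rule smooth_on_compose[OF open_null_dom J _ smooth_on_vec_germ[OF J assms] smooth_on_linear[OF bounded_linear_snd]])
    (auto simp: null_dom_def)

lemma smooth_surf: "smooth_on null_dom surf"
  unfolding surf_def[abs_def]
  by (intro smooth_on_add open_null_dom smooth_on_bilinear[OF open_null_dom bounded_bilinear_cross3] smooth_fst smooth_snd germ)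

lemma smooth_conormal: "smooth_on null_dom conormal"
  unfolding conormal_def[abs_def] by (intro smooth_on_add open_null_dom smooth_fst smooth_snd germ)

lemma smooth_null_det: "smooth_on null_dom null_det"
proof -
  have "smooth_on null_dom (\<lambda>p. (a' (fst p) \<times> b' (snd p)) \<bullet> conormal p)"
    by (intro smooth_on_bilinear[OF open_null_dom bounded_bilinear_inner] smooth_on_bilinear[OF open_null_dom bounded_bilinear_cross3]
      smooth_fst smooth_snd smooth_conormal germ)
  then show ?thesis unfolding null_det_def[abs_def] .
qed

lemma open_reg_dom: "open reg_dom"
proof -
  have "open (null_dom \<inter> null_det -` (- {0}))"
    by (rule continuous_open_preimage[OF smooth_on_continuous_on[OF smooth_null_det] open_null_dom]) auto
  moreover have "null_dom \<inter> null_det -` (- {0}) = reg_dom" by (auto simp: reg_dom_def)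
  ultimately show ?thesis by simp
qed

lemma reg_dom_subset: "reg_dom \<subseteq> null_dom"
  by (auto simp: reg_dom_def)

lemma der_conormal:
  "p \<in> null_dom \<Longrightarrow> (conormal has_derivative (\<lambda>v. fst v *\<^sub>R a' (fst p) + snd v *\<^sub>R b' (snd p))) (at p)"
  unfolding conormal_def[abs_def] null_dom_def by (intro has_derivative_add der_fst der_snd der) auto

lemma conormal_xi: "p \<in> null_dom \<Longrightarrow> conormal p \<bullet> \<xi> = 1"
  by (simp add: conormal_def null_dom_def inner_add_left half)

text \<open>The product rule applied to the mixed term \<open>b \<times> a\<close> supplies exactly
  what the primitives lack: \<open>a \<times> a'\<close> is completed by
  \<open>b \<times> a'\<close>, and \<open>- b \<times> b'\<close> by \<open>b' \<times> a\<close>,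
  each to a product with the whole conormal.\<close>

lemma fderiv_surf:
  assumes "p \<in> null_dom"
  shows "fderiv surf p v = fst v *\<^sub>R (conormal p \<times> a' (fst p)) - snd v *\<^sub>R (conormal p \<times> b' (snd p))"
proof -
  have J: "fst p \<in> J" "snd p \<in> J" using assms by (auto simp: null_dom_def)
  have "(surf has_derivative (\<lambda>v. (fst v *\<^sub>R (a (fst p) \<times> a' (fst p)) + snd v *\<^sub>R (- (b (snd p) \<times> b' (snd p))))
      + (b (snd p) \<times> (fst v *\<^sub>R a' (fst p)) + (snd v *\<^sub>R b' (snd p)) \<times> a (fst p)))) (at p)"
    unfolding surf_def[abs_def]
    by (intro has_derivative_add der_fst der_snd der bounded_bilinear.FDERIV[OF bounded_bilinear_cross3] J)
  note d = this
  have "b' (snd p) \<times> a (fst p) = - (a (fst p) \<times> b' (snd p))" by (rule cross_skew)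
  then show ?thesis
    unfolding fderiv_eq[OF d] conormal_def cross_add_left cross_mult_left cross_mult_right scaleR_add_right
    by simp
qed

lemma conormal_fderiv: "p \<in> null_dom \<Longrightarrow> conormal p \<bullet> fderiv surf p v = 0"
  by (simp add: fderiv_surf inner_diff_right dot_cross_self)

text \<open>The cross product of two vectors orthogonal to the conormal is a multiple of it:
  \<open>(n \<times> x) \<times> (n \<times> y)\<close> equals the determinant of \<open>n\<close>,
  \<open>x\<close>, \<open>y\<close> times \<open>n\<close>. The sign comes from the minus in the
  second tangent vector.\<close>

lemma jac_surf: "p \<in> null_dom \<Longrightarrow> jac \<xi> surf p = - null_det p"
proof -
  assume p: "p \<in> null_dom"
  have "(conormal p \<times> a' (fst p)) \<times> (conormal p \<times> b' (snd p)) = null_det p *\<^sub>R conormal p"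
    unfolding cross_cross_det dot_cross_det[symmetric] null_det_def 
    by (simp add: dot_cross_self inner_commute)
  then show ?thesis
    using conormal_xi[OF p] by (simp add: jac_def fderiv_surf[OF p])
qed

lemma a'_xi: "t \<in> J \<Longrightarrow> a' t \<bullet> \<xi> = 0" and b'_xi: "t \<in> J \<Longrightarrow> b' t \<bullet> \<xi> = 0"
proof -
  have *: "f' \<bullet> \<xi> = 0" if "t \<in> J" "(f has_vector_derivative f') (at t)" "\<And>t. t \<in> J \<Longrightarrow> f t \<bullet> \<xi> = 1/2" for f f' and t :: real
  proof -
    have "((\<lambda>t. f t \<bullet> \<xi>) has_vector_derivative f' \<bullet> \<xi>) (at t)"
      by (rule bounded_linear.has_vector_derivative[OF bounded_linear_inner_left that(2)])
    moreover have "((\<lambda>t. f t \<bullet> \<xi>) has_vector_derivative 0) (at t)"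
      by (rule has_vector_derivative_transform_within_open[OF has_vector_derivative_const[of "1/2"] J that(1)])
        (use that(3) in auto)
    ultimately show ?thesis by (rule vector_derivative_unique_at)
  qed
  show "t \<in> J \<Longrightarrow> a' t \<bullet> \<xi> = 0" "t \<in> J \<Longrightarrow> b' t \<bullet> \<xi> = 0"
    using * der half by blast+
qed

text \<open>Both sides have the same differential, because
  \<open>(n \<times> x) \<times> \<xi> = x\<close> whenever \<open>x\<close> is orthogonal to \<xi>
  and \<open>n \<bullet> \<xi> = 1\<close>. The square over an interval is convex, so a single
  diagonal point fixes the constant.\<close>

lemma surf_cross_xi: "s \<in> J \<Longrightarrow> surf (s, s) \<times> \<xi> = a s - b s \<Longrightarrow> is_interval J \<Longrightarrow> p \<in> null_dom \<Longrightarrow>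
    surf p \<times> \<xi> = a (fst p) - b (snd p)"
proof -
  assume s: "s \<in> J" and eq: "surf (s, s) \<times> \<xi> = a s - b s" and int: "is_interval J" and p: "p \<in> null_dom"
  let ?f = "\<lambda>p. surf p \<times> \<xi> - (a (fst p) - b (snd p))"
  have "\<exists>c. \<forall>p\<in>null_dom. ?f p = c"
  proof (rule has_derivative_zero_constant)
    have "null_dom = Sigma J (\<lambda>_. J)" by (auto simp: null_dom_def)
    then show "convex null_dom" using int by (simp add: convex_Times is_interval_convex_1)
    fix q assume q: "q \<in> null_dom"
    then have Jq: "fst q \<in> J" "snd q \<in> J" by (auto simp: null_dom_def)
    have "(?f has_derivative (\<lambda>v. fderiv surf q v \<times> \<xi> - (fst v *\<^sub>R a' (fst q) - snd v *\<^sub>R b' (snd q)))) (at q)"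
      by (intro has_derivative_diff der_fst der_snd der Jq 
          bounded_linear.has_derivative[OF bounded_bilinear.bounded_linear_left[OF bounded_bilinear_cross3]]
          smooth_on_has_derivative[OF smooth_surf q])
    moreover have "fderiv surf q v \<times> \<xi> - (fst v *\<^sub>R a' (fst q) - snd v *\<^sub>R b' (snd q)) = 0" for v
    proof -
      have "(conormal q \<times> x) \<times> \<xi> = x" if "x \<bullet> \<xi> = 0" for x
        using conormal_xi[OF q] that by (subst cross_skew) (simp add: Lagrange inner_commute)
      then show ?thesis using a'_xi[OF Jq(1)] b'_xi[OF Jq(2)]
        by (simp add: fderiv_surf[OF q] Cross3.left_diff_distrib cross_mult_left)
    qed
    ultimately show "(?f has_derivative (\<lambda>v. 0)) (at q within null_dom)" by (simp add: has_derivative_at_withinI)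
  qed
  moreover have "(s, s) \<in> null_dom" using s by (simp add: null_dom_def)
  ultimately have "?f p = ?f (s, s)" using p by metis
  then show ?thesis using eq by simp
qed

text \<open>Formulated for a map \<open>F\<close> that agrees with \<open>surf\<close> on an open
  set only, since \<open>in_chart\<close> has arbitrary values outside the chart. The value is minus
  the inner product of the differentials of conormal and surface, in which the terms in
  \<open>a'\<close> alone and in \<open>b'\<close> alone vanish.\<close>

lemma affine_metric_surf:
  assumes "p \<in> reg_dom" "S \<subseteq> null_dom" "open S" "p \<in> S" "\<And>q. q \<in> S \<Longrightarrow> F q = surf q"
  shows "affine_metric \<xi> F p v w = - null_det p * (fst v * snd w + snd v * fst w)"
proof -
  have p: "p \<in> null_dom" "null_det p \<noteq> 0" using assms(1) by (auto simp: reg_dom_def)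
  have fd: "fderiv F q = fderiv surf q" if "q \<in> S" for q
    by (rule fderiv_transform[OF assms(3) that assms(5)])
  have "smooth_on S F"
    by (rule smooth_on_cong[OF assms(3) smooth_on_subset[OF smooth_surf assms(2)]]) (use assms(5) in auto)
  moreover have "jac \<xi> F p \<noteq> 0"
    using jac_surf[OF p(1)] p(2) fd[OF assms(4)] by (simp add: jac_def)
  ultimately have "affine_metric \<xi> F p v w = - ((fst v *\<^sub>R a' (fst p) + snd v *\<^sub>R b' (snd p)) \<bullet> fderiv F p w)"
    using assms(2-4) by (intro affine_metric_eq[where S=S and n=conormal] der_conormal p(1) conormal_xi)
      (auto simp: fd conormal_fderiv)
  also have "fderiv F p w = fderiv surf p w" using fd assms(4) by simp
  also have "(fst v *\<^sub>R a' (fst p) + snd v *\<^sub>R b' (snd p)) \<bullet> fderiv surf p w = null_det p * (fst v * snd w + snd v * fst w)"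
  proof -
    let ?a = "a' (fst p)" and ?b = "b' (snd p)" and ?n = "conormal p"
    have "?b \<bullet> (?n \<times> ?a) = null_det p" "?a \<bullet> (?n \<times> ?b) = - null_det p"
      unfolding null_det_def by (metis cross_triple inner_commute, metis cross_triple inner_commute cross_skew inner_minus_left)
    then show ?thesis
      by (simp add: fderiv_surf[OF p(1)] inner_add_left inner_diff_right dot_cross_self algebra_simps)
  qed
  finally show ?thesis by simp
qed


lemma analytic_surf: "real_analytic2_on reg_dom surf"
proof -
  have gJ: "fst q \<in> J" "snd q \<in> J" if "q \<in> reg_dom" for q using that by (auto simp: reg_dom_def null_dom_def)
  have "real_analytic2_on reg_dom (\<lambda>q. P (fst q) + Q (snd q) + b (snd q) \<times> a (fst q))"
  proof (intro real_analytic2_on_add)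
    have "real_analytic2_on reg_dom (\<lambda>q. \<Sum>i\<in>UNIV. (P (fst q) $ i * 1) *\<^sub>R axis i (1::real))"
      by (intro real_analytic2_on_sum real_analytic2_on_product real_germ_const)
        (use germ(5)[OF gJ(1)] in \<open>auto simp: vec_germ_def\<close>)
    then show "real_analytic2_on reg_dom (\<lambda>q. P (fst q))" by (simp add: vec3_expand)
    have "real_analytic2_on reg_dom (\<lambda>q. \<Sum>i\<in>UNIV. (1 * Q (snd q) $ i) *\<^sub>R axis i (1::real))"
      by (intro real_analytic2_on_sum real_analytic2_on_product[where f="\<lambda>_. 1"] real_germ_const)
        (use germ(6)[OF gJ(2)] in \<open>auto simp: vec_germ_def\<close>)
    then show "real_analytic2_on reg_dom (\<lambda>q. Q (snd q))" by (simp add: vec3_expand)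
    have "real_analytic2_on reg_dom (\<lambda>q. \<Sum>i\<in>UNIV. \<Sum>j\<in>UNIV. (a (fst q) $ i * b (snd q) $ j) *\<^sub>R (axis j 1 \<times> axis i 1))"
      by (intro real_analytic2_on_sum real_analytic2_on_product)
        (use germ(1)[OF gJ(1)] germ(2)[OF gJ(2)] in \<open>auto simp: vec_germ_def\<close>)
    then show "real_analytic2_on reg_dom (\<lambda>q. b (snd q) \<times> a (fst q))" by (simp add: cross3_expand)
  qed
  then show ?thesis by (simp add: surf_def[abs_def])
qed

lemma sphere_surf:
  assumes "\<xi> \<noteq> 0"
  shows "indefinite_improper_affine_sphere \<xi> (top_of_set reg_dom) {(reg_dom, id)} surf"
proof -
  have chart: "chart_range (reg_dom, id) = reg_dom" by (simp add: chart_range_def)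
  have "smooth_on reg_dom (in_chart (reg_dom, id) surf)"
    by (rule smooth_on_cong[OF open_reg_dom smooth_on_subset[OF smooth_surf reg_dom_subset]]) (simp add: in_chart_id)
  then have smooth: "smooth_map {(reg_dom, id)} surf" by (simp add: smooth_map_def chart)
  \<comment> \<open>The only transition map is the identity, written here as a sum of products of
    functions of one variable.\<close>
  have "real_analytic2_on reg_dom (\<lambda>q. (fst q * 1) *\<^sub>R (1::real, 0::real) + (1 * snd q) *\<^sub>R (0::real, 1::real))"
    by (intro real_analytic2_on_add real_analytic2_on_product[where g="\<lambda>_. 1"] real_analytic2_on_product[where f="\<lambda>_. 1"]
        real_germ_const real_germ_ident)
  then have "real_analytic2_on reg_dom (in_chart (reg_dom, id) id)"
    by (rule real_analytic2_on_cong) (simp add: in_chart_id)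
  moreover have "is_chart (top_of_set reg_dom) (reg_dom, id)"
    unfolding is_chart_def chart by (simp add: open_reg_dom subtopology_subtopology)
  ultimately have surface: "analytic_surface (top_of_set reg_dom) {(reg_dom, id)}"
    unfolding analytic_surface_def
    by (simp add: Hausdorff_space_subtopology second_countable_subtopology second_countable_euclidean)
  have main: "let d\<psi> = fderiv (in_chart c surf) p; h = affine_metric \<xi> (in_chart c surf) p
        in inj d\<psi> \<and> \<xi> \<notin> range d\<psi> \<and> lorentzian h \<and>
           (\<forall>v w. sqrt ((h v w)\<^sup>2 - h v v * h w w) = \<bar>triple_det (d\<psi> v) (d\<psi> w) \<xi>\<bar>)"
    if "c \<in> {(reg_dom, id)}" "p \<in> chart_range c" for c p
  proof -
    have c: "c = (reg_dom, id)" and p: "p \<in> reg_dom" using that chart by auto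
    have pd: "p \<in> null_dom" "null_det p \<noteq> 0" using p by (auto simp: reg_dom_def)
    have fd: "fderiv (in_chart c surf) p = fderiv surf p"
      by (rule fderiv_transform[OF open_reg_dom p]) (simp add: c in_chart_id)
    have lin: "linear (fderiv surf p)"
      by (rule has_derivative_linear[OF smooth_on_has_derivative[OF smooth_surf pd(1)]])
    have h: "affine_metric \<xi> (in_chart c surf) p v w = - null_det p * (fst v * snd w + snd v * fst w)" for v w
      by (rule affine_metric_surf[OF p _ open_reg_dom p]) (auto simp: reg_dom_def c in_chart_id)
    have tr: "inj (fderiv surf p)" "\<xi> \<notin> range (fderiv surf p)"
      using transversal_iff[OF lin, of \<xi>] jac_surf[OF pd(1)] pd(2) by (auto simp: jac_def)
    have lor: "lorentzian (\<lambda>v w. - null_det p * (fst v * snd w + snd v * fst w))" (is "lorentzian ?h")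
      unfolding lorentzian_def
    proof (intro conjI allI impI)
      show "bilinear ?h" unfolding bilinear_def by (auto intro!: linearI simp: algebra_simps)
      show "?h v w = ?h w v" for v w by (simp add: algebra_simps)
      show "\<exists>w. ?h v w \<noteq> 0" if "v \<noteq> 0" for v
      proof (cases "fst v = 0")
        case True
        then have "snd v \<noteq> 0" using that by (simp add: prod_eq_iff)
        then show ?thesis using pd(2) by (intro exI[of _ "(1, 0)"]) simp
      next
        case False
        then show ?thesis using pd(2) by (intro exI[of _ "(0, 1)"]) simp
      qed
      \<comment> \<open>Using \<open>null_det p\<close> itself as the second component makes the
        sign of the metric independent of the sign of \<open>null_det p\<close>.\<close>
      have "0 < null_det p * null_det p" using pd(2) not_real_square_gt_zero by blast
      then show "\<exists>v. ?h v v > 0" "\<exists>v. ?h v v < 0"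
        by (intro exI[of _ "(1, - null_det p)"], simp, intro exI[of _ "(1, null_det p)"], simp)
    qed
    have vol: "sqrt ((?h v w)\<^sup>2 - ?h v v * ?h w w) = \<bar>triple_det (fderiv surf p v) (fderiv surf p w) \<xi>\<bar>"
      for v w :: "real \<times> real"
    proof -
      \<comment> \<open>The metric has no diagonal terms, so its Gram determinant is up to sign a
        perfect square, namely that of the area of \<open>v\<close> and \<open>w\<close> times the
        density.\<close>
      have "(?h v w)\<^sup>2 - ?h v v * ?h w w = ((fst v * snd w - snd v * fst w) * - null_det p)\<^sup>2"
        by (simp add: power2_eq_square algebra_simps)
      then show ?thesis
        by (simp only: real_sqrt_abs triple_det_fderiv[OF lin] jac_surf[OF pd(1)])
    qed
    have h': "affine_metric \<xi> (in_chart c surf) p = ?h" by (intro ext h)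
    show ?thesis unfolding Let_def fd h' using tr lor vol by blast
  qed
  show ?thesis
    unfolding indefinite_improper_affine_sphere_def using assms surface smooth main by blast
qed

lemma conormal_surf:
  assumes "p \<in> reg_dom"
  shows "affine_conormal \<xi> {(reg_dom, id)} surf p = conormal p"
proof -
  have pd: "p \<in> null_dom" "null_det p \<noteq> 0" using assms by (auto simp: reg_dom_def)
  have fd: "fderiv (in_chart (reg_dom, id) surf) p = fderiv surf p"
    using inv_into_f_f[of id reg_dom] 
    by (intro fderiv_transform[OF open_reg_dom assms]) (auto simp: in_chart_def)
  have lin: "linear (fderiv surf p)"
    by (rule has_derivative_linear[OF smooth_on_has_derivative[OF smooth_surf pd(1)]])
  show ?thesis
    unfolding affine_conormal_def
  proof (rule the_equality)
    show "conormal p \<bullet> \<xi> = 1 \<and> (\<forall>c\<in>{(reg_dom, id)}. p \<in> fst c \<longrightarrow> (\<forall>v. conormal p \<bullet> fderiv (in_chart c surf) (snd c p) v = 0))"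
      using fd conormal_xi[OF pd(1)] conormal_fderiv[OF pd(1)] by simp
    show "n = conormal p" 
      if "n \<bullet> \<xi> = 1 \<and> (\<forall>c\<in>{(reg_dom, id)}. p \<in> fst c \<longrightarrow> (\<forall>v. n \<bullet> fderiv (in_chart c surf) (snd c p) v = 0))" for n
      by (rule conormal_unique[where F=surf and p=p and \<xi>=\<xi>])
        (use that fd conormal_xi[OF pd(1)] conormal_fderiv[OF pd(1)] lin jac_surf[OF pd(1)] pd(2) assms in auto)
  qed
qed

lemma cauchy_solution_surf:
  assumes I: "is_interval I" "interior I \<noteq> {}" "I \<subseteq> J" and "\<xi> \<noteq> 0"
    and data: "\<And>s. s \<in> I \<Longrightarrow> surf (s, s) = \<alpha> s" "\<And>s. s \<in> I \<Longrightarrow> conormal (s, s) = U s" 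
      "\<And>s. s \<in> I \<Longrightarrow> null_det (s, s) \<noteq> 0"
  shows "cauchy_solution \<xi> I \<alpha> U (top_of_set reg_dom) {(reg_dom, id)} surf (\<lambda>s. (s, s))"
    and "analytic_map {(reg_dom, id)} surf"
proof -
  have null_coords: "(s, s) \<in> reg_dom" if "s \<in> I" for s using I(3) data(3) that by (auto simp: reg_dom_def null_dom_def)
  have ana: "real_analytic_on S (\<lambda>s. (s, s))" for S :: "real set"
    unfolding real_analytic_on_def
  proof (intro ballI exI[of _ 1] exI[of _ "\<lambda>n. if n = 0 then (s, s) else if n = 1 then (1, 1) else 0" for s] conjI impI)
    fix s t :: real
    show "(\<lambda>n. (t - s) ^ n *\<^sub>R (if n = 0 then (s, s) else if n = 1 then (1, 1) else 0)) sums (t, t)"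
      using sums_finite[of "{0, 1}" "\<lambda>n. (t - s) ^ n *\<^sub>R (if n = 0 then (s, s) else if n = 1 then (1, 1) else 0)"] by simp
  qed simp
  have vd: "vector_derivative (\<lambda>s. (s, s)) (at s within I) \<noteq> 0" if "s \<in> I" for s
  proof -
    have "((\<lambda>s. (s, s)) has_vector_derivative (1, 1)) (at s within I)"
      unfolding has_vector_derivative_def by (auto intro!: derivative_eq_intros)
    moreover have "at s within I \<noteq> bot"
      using interval_islimpt[OF I(1,2) that] trivial_limit_within by blast
    ultimately have "vector_derivative (\<lambda>s. (s, s)) (at s within I) = (1, 1)" 
      by (intro vector_derivative_within)
    then show ?thesis by (simp add: zero_prod_def)
  qed
  have "regular_analytic_curve I (top_of_set reg_dom) {(reg_dom, id)} (\<lambda>s. (s, s))"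
    unfolding regular_analytic_curve_def using null_coords ana vd
    by (auto simp: continuous_map_in_subtopology intro!: continuous_intros)
  then show "cauchy_solution \<xi> I \<alpha> U (top_of_set reg_dom) {(reg_dom, id)} surf (\<lambda>s. (s, s))"
    unfolding cauchy_solution_def using sphere_surf[OF assms(4)] data conormal_surf null_coords by simp
  have "real_analytic2_on reg_dom (in_chart (reg_dom, id) surf)"
    by (rule real_analytic2_on_cong[OF analytic_surf]) (use inv_into_f_f[of id reg_dom] in \<open>auto simp: in_chart_def\<close>)
  then show "analytic_map {(reg_dom, id)} surf" by (simp add: analytic_map_def chart_range_def)
qed

end

section \<open>Local normal form\<close>

lemma cross_zero_parallel:
  fixes \<xi> :: "real^3"
  assumes "x \<times> \<xi> = 0" "\<xi> \<noteq> 0"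
  shows "\<exists>t. x = t *\<^sub>R \<xi>"
proof -
  have "(\<xi> \<bullet> \<xi>) *\<^sub>R x = (\<xi> \<bullet> x) *\<^sub>R \<xi>"
    using Lagrange[of \<xi> x \<xi>] assms(1) by simp
  then have "inverse (\<xi> \<bullet> \<xi>) *\<^sub>R (\<xi> \<bullet> \<xi>) *\<^sub>R x = inverse (\<xi> \<bullet> \<xi>) *\<^sub>R (\<xi> \<bullet> x) *\<^sub>R \<xi>" by simp
  then have "x = (inverse (\<xi> \<bullet> \<xi>) * (\<xi> \<bullet> x)) *\<^sub>R \<xi>" using assms(2) by simp
  then show ?thesis by blast
qed

text \<open>A junk value where the immersion is not transversal to \<open>\<xi>\<close>, since \<open>inverse 0 = 0\<close>.\<close>

definition conormal_of :: "real^3 \<Rightarrow> (real \<times> real \<Rightarrow> real^3) \<Rightarrow> real \<times> real \<Rightarrow> real^3" where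
  "conormal_of \<xi> F p = inverse (jac \<xi> F p) *\<^sub>R (fderiv F p (1, 0) \<times> fderiv F p (0, 1))"

lemma conormal_of_xi: "jac \<xi> F p \<noteq> 0 \<Longrightarrow> conormal_of \<xi> F p \<bullet> \<xi> = 1"
  by (simp add: conormal_of_def jac_def)

lemma conormal_of_fderiv: "linear (fderiv F p) \<Longrightarrow> conormal_of \<xi> F p \<bullet> fderiv F p v = 0"
  unfolding linear_pair_expand[of "fderiv F p" v] 
  by (simp add: conormal_of_def inner_add_right dot_cross_self)

lemma smooth_conormal_of:
  assumes "open S" "smooth_on S F" "\<And>q. q \<in> S \<Longrightarrow> jac \<xi> F q \<noteq> 0"
  shows "smooth_on S (conormal_of \<xi> F)"
proof -
  have c: "smooth_on S (\<lambda>q. fderiv F q (1, 0) \<times> fderiv F q (0, 1))"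
    by (intro smooth_on_bilinear[OF assms(1) bounded_bilinear_cross3] smooth_on_fderiv assms(2))
  have "smooth_on S (jac \<xi> F)"
    unfolding jac_def[abs_def] by (rule smooth_on_bounded_linear[OF assms(1) bounded_linear_inner_left c])
  then show ?thesis
    unfolding conormal_of_def[abs_def]
    by (intro smooth_on_bilinear[OF assms(1) bounded_bilinear_scaleR] smooth_on_inverse assms(1,3) c)
qed

text \<open>What a single chart sees of a sphere, with transversality expressed by
  \<open>jac\<close>. As a statement about a map on the plane it lets the local argument run without
  mention of the surface.\<close>

definition sphere_patch :: "real^3 \<Rightarrow> (real \<times> real) set \<Rightarrow> (real \<times> real \<Rightarrow> real^3) \<Rightarrow> bool" where
  "sphere_patch \<xi> S F \<longleftrightarrow> open S \<and> smooth_on S F \<and>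
     (\<forall>q\<in>S. jac \<xi> F q \<noteq> 0 \<and>
        (let h = affine_metric \<xi> F q
         in \<forall>v w. h v w = h w v \<and>
              sqrt ((h v w)\<^sup>2 - h v v * h w w) = \<bar>triple_det (fderiv F q v) (fderiv F q w) \<xi>\<bar>))"

lemma sphere_patchD:
  assumes "sphere_patch \<xi> S F"
  shows "open S" and "smooth_on S F" and "\<And>q. q \<in> S \<Longrightarrow> jac \<xi> F q \<noteq> 0"
    and "\<And>q v w. q \<in> S \<Longrightarrow> affine_metric \<xi> F q v w = affine_metric \<xi> F q w v"
    and "\<And>q v w. q \<in> S \<Longrightarrow>
      sqrt ((affine_metric \<xi> F q v w)\<^sup>2 - affine_metric \<xi> F q v v * affine_metric \<xi> F q w w)
        = \<bar>triple_det (fderiv F q v) (fderiv F q w) \<xi>\<bar>"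
    and "\<And>q. q \<in> S \<Longrightarrow> linear (fderiv F q)"
  using assms has_derivative_linear[OF smooth_on_has_derivative[of S F]]
  unfolding sphere_patch_def Let_def by blast+

text \<open>The volume condition and the symmetry of the affine metric say exactly that the two maps
  \<open>(N \<plusminus> \<psi> \<times> \<xi>) / 2\<close> have rank at most one.\<close>

lemma characteristic_maps_rank:
  assumes patch: "sphere_patch \<xi> S F" and q: "q \<in> S" and \<sigma>: "\<sigma> * \<sigma> = 1"
    and A: "A = (\<lambda>q. (1/2) *\<^sub>R (conormal_of \<xi> F q + \<sigma> *\<^sub>R (F q \<times> \<xi>)))"
  shows "fderiv A q v \<times> fderiv A q w = 0"
proof -
  note S = sphere_patchD(1,2)[OF patch] and jac = sphere_patchD(3)[OF patch] and lin = sphere_patchD(6)[OF patch]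
    and sym = sphere_patchD(4)[OF patch q] and vol = sphere_patchD(5)[OF patch q]
  have dn: "(conormal_of \<xi> F has_derivative fderiv (conormal_of \<xi> F) q) (at q)"
    by (rule smooth_on_has_derivative[OF smooth_conormal_of[OF S jac] q])
  have dF: "(F has_derivative fderiv F q) (at q)"
    by (rule smooth_on_has_derivative[OF S(2) q])
  let ?n = "conormal_of \<xi> F q" and ?dn = "fderiv (conormal_of \<xi> F) q" and ?df = "fderiv F q"
  have dA: "(A has_derivative (\<lambda>v. (1/2) *\<^sub>R (?dn v + \<sigma> *\<^sub>R (?df v \<times> \<xi>)))) (at q)"
    unfolding A by (intro has_derivative_scaleR_right has_derivative_add dn
        bounded_linear.has_derivative[OF bounded_bilinear.bounded_linear_left[OF bounded_bilinear_cross3]] dF)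
  have h: "affine_metric \<xi> F q v w = - (?dn v \<bullet> ?df w)" for v w
    by (rule affine_metric_eq[OF S q jac[OF q] _ conormal_of_xi[OF jac[OF q]] dn]) (rule conormal_of_fderiv[OF lin])
  have dn_xi: "?dn v \<bullet> \<xi> = 0" for v
  proof -
    have "((\<lambda>p. conormal_of \<xi> F p \<bullet> \<xi>) has_derivative (\<lambda>v. ?dn v \<bullet> \<xi>)) (at q)"
      by (rule bounded_linear.has_derivative[OF bounded_linear_inner_left dn])
    moreover have "((\<lambda>p. conormal_of \<xi> F p \<bullet> \<xi>) has_derivative (\<lambda>v. 0)) (at q)"
      by (rule has_derivative_transform_within_open[OF _ S(1) q, of "\<lambda>q. 1"]) (use conormal_of_xi[OF jac] in auto)
    ultimately have "(\<lambda>v. ?dn v \<bullet> \<xi>) = (\<lambda>v. 0)" by (rule has_derivative_unique)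
    then show ?thesis by (rule fun_cong)
  qed
  let ?e = "(1, 0) :: real \<times> real" and ?f = "(0, 1) :: real \<times> real"
  let ?p = "?dn ?e" and ?q = "?dn ?f" and ?x = "?df ?e" and ?y = "?df ?f"
  define T where "T = jac \<xi> F q"
  have T: "T \<noteq> 0" "(?x \<times> ?y) \<bullet> \<xi> = T" using jac[OF q] by (simp_all add: T_def jac_def)
  have sym': "?p \<bullet> ?y = ?q \<bullet> ?x" using sym[of ?e ?f] unfolding h by simp
  have xy: "?x \<times> ?y = T *\<^sub>R ?n" using T(1) unfolding conormal_of_def T_def by simp
  have "(?p \<bullet> ?y)\<^sup>2 - (?p \<bullet> ?x) * (?q \<bullet> ?y) = T\<^sup>2"
  proof -
    have "sqrt ((?p \<bullet> ?y)\<^sup>2 - (?p \<bullet> ?x) * (?q \<bullet> ?y)) = \<bar>T\<bar>"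
      using vol[of ?e ?f] unfolding h triple_det_fderiv[OF lin[OF q]] by (simp add: T_def)
    \<comment> \<open>The HOL function \<open>sqrt\<close> takes negative values at negative
      arguments. Nonnegativity of the root therefore shows that the radicand is nonnegative and is
      recovered by squaring.\<close>
    then have "(sqrt ((?p \<bullet> ?y)\<^sup>2 - (?p \<bullet> ?x) * (?q \<bullet> ?y)))\<^sup>2 = T\<^sup>2" 
      and "sqrt ((?p \<bullet> ?y)\<^sup>2 - (?p \<bullet> ?x) * (?q \<bullet> ?y)) \<ge> 0" by simp_all
    then show ?thesis by simp
  qed
  \<comment> \<open>The Binet-Cauchy identity. Since \<open>?x \<times> ?y\<close> is
    \<open>T\<close> times the conormal, it turns the volume condition into the value
    \<open>- T\<close> for the conormal component of \<open>?p \<times> ?q\<close>.\<close>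
  moreover have "(?p \<times> ?q) \<bullet> (?x \<times> ?y) = (?p \<bullet> ?x) * (?q \<bullet> ?y) - (?p \<bullet> ?y) * (?q \<bullet> ?x)"
    by (simp add: cross3_simps)
  ultimately have "((?p \<times> ?q) \<bullet> ?n) * T = (- T) * T"
    unfolding xy sym' by (simp add: power2_eq_square algebra_simps)
  then have pqn: "(?p \<times> ?q) \<bullet> ?n = - T" using T(1) by (simp only: mult_cancel_right) simp
  have "\<xi> \<noteq> 0" using T by auto
  \<comment> \<open>Derivatives of the conormal are orthogonal to \<xi>, so their cross product is a
    multiple of \<xi>; the conormal reads off the factor.\<close>
  moreover have "(?p \<times> ?q) \<times> \<xi> = 0"
    using dn_xi by (subst cross_skew) (simp add: Lagrange inner_commute)
  ultimately obtain k where k: "?p \<times> ?q = k *\<^sub>R \<xi>" using cross_zero_parallel by blast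
  then have "k = - T" using pqn conormal_of_xi[OF jac[OF q]] by (simp add: inner_commute)
  then have pq: "?p \<times> ?q = - T *\<^sub>R \<xi>" using k by simp
  have 1: "?p \<times> (?y \<times> \<xi>) = - (?p \<bullet> ?y) *\<^sub>R \<xi>" using dn_xi by (simp add: Lagrange)
  have 2: "(?x \<times> \<xi>) \<times> ?q = (?q \<bullet> ?x) *\<^sub>R \<xi>" using dn_xi by (subst cross_skew) (simp add: Lagrange)
  have 3: "(?x \<times> \<xi>) \<times> (?y \<times> \<xi>) = T *\<^sub>R \<xi>"
  proof -
    have "(?x \<times> \<xi>) \<times> (?y \<times> \<xi>) = - (?x \<bullet> (\<xi> \<times> ?y)) *\<^sub>R \<xi>"
      unfolding cross_cross_det dot_cross_det[symmetric] by simp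
    also have "?x \<bullet> (\<xi> \<times> ?y) = - T"
      unfolding T(2)[symmetric] cross_triple[of ?x ?y \<xi>] cross_skew[of \<xi> ?y] by (simp add: inner_commute)
    finally show ?thesis by simp
  qed
  \<comment> \<open>All four terms of the expansion are multiples of \<xi>. The first and the last
    cancel because \<open>\<sigma> * \<sigma> = 1\<close>, the two mixed ones by the symmetry of the
    metric.\<close>
  have base: "(?p + \<sigma> *\<^sub>R (?x \<times> \<xi>)) \<times> (?q + \<sigma> *\<^sub>R (?y \<times> \<xi>)) = 0"
  proof -
    have "(?p + \<sigma> *\<^sub>R (?x \<times> \<xi>)) \<times> (?q + \<sigma> *\<^sub>R (?y \<times> \<xi>))
      = ?p \<times> ?q + \<sigma> *\<^sub>R (?p \<times> (?y \<times> \<xi>)) + \<sigma> *\<^sub>R ((?x \<times> \<xi>) \<times> ?q) + (\<sigma> * \<sigma>) *\<^sub>R ((?x \<times> \<xi>) \<times> (?y \<times> \<xi>))"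
      by (simp add: cross_add_left cross_add_right cross_mult_left cross_mult_right scaleR_add_right)
    then show ?thesis unfolding 1 2 3 pq sym' \<sigma> by simp
  qed
  let ?d = "\<lambda>v. (1/2) *\<^sub>R (?dn v + \<sigma> *\<^sub>R (?df v \<times> \<xi>))"
  have L: "linear ?d" by (rule has_derivative_linear[OF dA])
  have b: "?d ?e \<times> ?d ?f = 0" "?d ?f \<times> ?d ?e = 0"
    using base cross_skew[of "?q + \<sigma> *\<^sub>R (?y \<times> \<xi>)"] by (simp_all add: cross_mult_left cross_mult_right)
  have "?d v \<times> ?d w = (fst v *\<^sub>R ?d ?e + snd v *\<^sub>R ?d ?f) \<times> (fst w *\<^sub>R ?d ?e + snd w *\<^sub>R ?d ?f)"
    using linear_pair_expand[OF L, of v] linear_pair_expand[OF L, of w] by simp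
  also have "\<dots> = 0"
    unfolding cross_add_left cross_add_right cross_mult_left[of "fst _"] cross_mult_left[of "snd _"]
      cross_mult_right[of _ "fst _"] cross_mult_right[of _ "snd _"] b cross_refl by simp
  finally show ?thesis unfolding fderiv_eq[OF dA] .
qed

context null_data
begin

text \<open>Near \<open>\<gamma> s0\<close> the two characteristic maps have values
  \<open>a \<sigma>\<close> and \<open>b \<tau>\<close>, so \<open>F \<times> \<xi>\<close> there
  coincides with \<open>surf (\<sigma>, \<tau>) \<times> \<xi>\<close>. Local injectivity of the
  projected surface identifies \<open>(\<sigma>, \<tau>)\<close> with the point being lifted. This
  gives equality of the conormals, and from it equality of the surfaces. The relations in
  \<open>ev\<close> are assumed on both sides of \<open>s0\<close>, and the point \<open>s1\<close>
  only fixes the constant in \<open>surf_cross_xi\<close>.\<close>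

lemma local_normal_form:
  assumes int: "is_interval J" and s0: "s0 \<in> J" and base: "s1 \<in> J" "surf (s1, s1) \<times> \<xi> = a s1 - b s1"
    and reg: "null_det (s0, s0) \<noteq> 0"
    and patch: "sphere_patch \<xi> S F"
    and \<gamma>: "(\<gamma> has_vector_derivative \<gamma>') (at s0)" "\<gamma> s0 \<in> S"
    and ev: "\<forall>\<^sub>F t in nhds s0. conormal_of \<xi> F (\<gamma> t) = a t + b t \<and> F (\<gamma> t) \<times> \<xi> = a t - b t"
    and init: "F (\<gamma> s0) = surf (s0, s0)"
  obtains W \<Theta> where "open W" "(s0, s0) \<in> W" "W \<subseteq> null_dom" "continuous_on W \<Theta>" "\<Theta> ` W \<subseteq> S"
    "\<And>p. p \<in> W \<Longrightarrow> F (\<Theta> p) = surf p" "\<forall>\<^sub>F t in nhds s0. \<Theta> (t, t) = \<gamma> t"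
proof -
  note S = sphere_patchD(1,2)[OF patch] and jac = sphere_patchD(3)[OF patch]
  let ?p = "(s0, s0)"
  have p: "?p \<in> null_dom" using s0 by (simp add: null_dom_def)
  have \<xi>: "\<xi> \<noteq> 0" using half(1)[OF s0] by auto
  obtain \<pi> :: "real^3 \<Rightarrow> real \<times> real" where \<pi>: "bounded_linear \<pi>" "\<And>x. \<pi> x = 0 \<longleftrightarrow> (\<exists>t. x = t *\<^sub>R \<xi>)"
    using projection_along[OF \<xi>] by blast
  have \<pi>_eq: "\<pi> x = \<pi> y" if "x \<times> \<xi> = y \<times> \<xi>" for x y
  proof -
    have "(x - y) \<times> \<xi> = 0" using that by (simp add: Cross3.left_diff_distrib)
    then have "\<pi> (x - y) = 0" using \<pi>(2) cross_zero_parallel[OF _ \<xi>] by blast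
    then show ?thesis by (simp add: linear_diff[OF bounded_linear.linear[OF \<pi>(1)]])
  qed
  obtain U V H where U: "open U" "U \<subseteq> S" "\<gamma> s0 \<in> U" "open V" 
    and H: "homeomorphism U V (\<lambda>x. \<pi> (F x)) H" "\<And>y. y \<in> V \<Longrightarrow> (H has_derivative fderiv H y) (at y)"
    by (rule transversal_local_inverse[OF S \<gamma>(2) jac[OF \<gamma>(2), unfolded jac_def] \<pi>]) blast
  have "jac \<xi> surf ?p \<noteq> 0" using jac_surf[OF p] reg by simp
  then obtain U2 V2 H2 where U2: "open U2" "U2 \<subseteq> null_dom" "?p \<in> U2"
    and H2: "homeomorphism U2 V2 (\<lambda>x. \<pi> (surf x)) H2"
    using transversal_local_inverse[OF open_null_dom smooth_surf p _ \<pi>] unfolding jac_def by metis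
  have inj2: "x = y" if "x \<in> U2" "y \<in> U2" "\<pi> (surf x) = \<pi> (surf y)" for x y
    using that H2 by (metis homeomorphism_apply1)
  \<comment> \<open>A square of parameters inside the set on which the projected surface is
    injective. The same \<epsilon> is passed to \<open>rank_one_image\<close>, so that the
    parameters it returns fall into this set.\<close>
  obtain \<epsilon> where \<epsilon>: "\<epsilon> > 0" "\<And>\<sigma> \<tau>. \<bar>\<sigma> - s0\<bar> < \<epsilon> \<Longrightarrow> \<bar>\<tau> - s0\<bar> < \<epsilon> \<Longrightarrow> (\<sigma>, \<tau>) \<in> U2"
  proof -
    obtain K1 K2 where K: "open K1" "open K2" "?p \<in> Sigma K1 (\<lambda>_. K2)" "Sigma K1 (\<lambda>_. K2) \<subseteq> U2"
      using open_prod_elim[OF U2(1,3)] by metis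
    then obtain e1 e2 where "e1 > 0" "ball s0 e1 \<subseteq> K1" "e2 > 0" "ball s0 e2 \<subseteq> K2"
      by (metis SigmaD1 SigmaD2 open_contains_ball)
    then show ?thesis using K(4)
      by (intro that[of "min e1 e2"]) (auto simp: subset_iff dist_real_def abs_minus_commute)
  qed
  define A where "A \<sigma> = (\<lambda>q. (1/2) *\<^sub>R (conormal_of \<xi> F q + \<sigma> *\<^sub>R (F q \<times> \<xi>)))" for \<sigma>
  have smA: "smooth_on S (A \<sigma>)" for \<sigma>
    unfolding A_def
    by (intro smooth_on_bounded_linear[OF S(1) bounded_linear_scaleR_right] smooth_on_add S(1) smooth_conormal_of S(2) jac
        smooth_on_bounded_linear[OF S(1) bounded_bilinear.bounded_linear_left[OF bounded_bilinear_cross3]])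
  have rankA: "fderiv (A \<sigma>) q v \<times> fderiv (A \<sigma>) q w = 0" if "\<sigma> * \<sigma> = 1" "q \<in> S" for \<sigma> q v w
    by (rule characteristic_maps_rank[OF patch that(2,1)]) (simp add: A_def)
  have d0: "a' s0 \<noteq> 0" "b' s0 \<noteq> 0" using reg by (auto simp: null_det_def)
  have cont: "continuous_on J a" "continuous_on J b"
    using vec_germ_isCont[OF germ(1)] vec_germ_isCont[OF germ(2)] by (simp_all add: continuous_at_imp_continuous_on)
  have evA: "\<forall>\<^sub>F t in nhds s0. A 1 (\<gamma> t) = a t" 
    using ev by eventually_elim (simp add: A_def flip: scaleR_2)
  have evB: "\<forall>\<^sub>F t in nhds s0. A (-1) (\<gamma> t) = b t" 
    using ev by eventually_elim (simp add: A_def flip: scaleR_2)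
  have "\<forall>\<^sub>F q in nhds (\<gamma> s0). \<exists>\<sigma>. \<bar>\<sigma> - s0\<bar> < \<epsilon> \<and> A 1 q = a \<sigma>"
    by (rule rank_one_image[OF S(1) smA rankA \<gamma> evA der(1)[OF s0] d0(1) J s0 cont(1) \<epsilon>(1)]) auto
  moreover have "\<forall>\<^sub>F q in nhds (\<gamma> s0). \<exists>\<tau>. \<bar>\<tau> - s0\<bar> < \<epsilon> \<and> A (-1) q = b \<tau>"
    by (rule rank_one_image[OF S(1) smA rankA \<gamma> evB der(2)[OF s0] d0(2) J s0 cont(2) \<epsilon>(1)]) auto
  ultimately have "\<forall>\<^sub>F q in nhds (\<gamma> s0). (\<exists>\<sigma>. \<bar>\<sigma> - s0\<bar> < \<epsilon> \<and> A 1 q = a \<sigma>) \<and> (\<exists>\<tau>. \<bar>\<tau> - s0\<bar> < \<epsilon> \<and> A (-1) q = b \<tau>)"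
    by (rule eventually_conj)
  then obtain N where N: "open N" "\<gamma> s0 \<in> N" 
    "\<And>q. q \<in> N \<Longrightarrow> \<exists>\<sigma> \<tau>. \<bar>\<sigma> - s0\<bar> < \<epsilon> \<and> \<bar>\<tau> - s0\<bar> < \<epsilon> \<and> A 1 q = a \<sigma> \<and> A (-1) q = b \<tau>"
    unfolding eventually_nhds by metis
  define \<Theta> where "\<Theta> p = H (\<pi> (surf p))" for p
  have \<pi>V: "\<pi> (surf ?p) \<in> V" 
    using U(3) H(1) unfolding init[symmetric] by (auto simp: homeomorphism_def)
  have \<Theta>0: "\<Theta> ?p = \<gamma> s0" 
    using U(3) H(1) init unfolding \<Theta>_def by (metis homeomorphism_apply1)
  \<comment> \<open>The lift is kept in \<open>N\<close>, where both characteristic maps are known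
    to take values of \<open>a\<close> and \<open>b\<close>.\<close>
  define V' where "V' = V \<inter> H -` N"
  have V': "open V'"
    unfolding V'_def by (rule continuous_open_preimage[OF homeomorphism_cont2[OF H(1)] U(4) N(1)])
  have cps: "continuous_on null_dom (\<lambda>p. \<pi> (surf p))"
    by (rule bounded_linear.continuous_on[OF \<pi>(1) smooth_on_continuous_on[OF smooth_surf]])
  define W0 where "W0 = U2 \<inter> (null_dom \<inter> (\<lambda>p. \<pi> (surf p)) -` V')"
  have "open W0"
    unfolding W0_def by (intro open_Int U2(1) continuous_open_preimage[OF cps open_null_dom V'])
  moreover have "?p \<in> W0" unfolding W0_def V'_def using U2(3) p \<pi>V \<Theta>0 N(2) by (simp add: \<Theta>_def)
  ultimately obtain r where r: "r > 0" "ball ?p r \<subseteq> W0" using open_contains_ball by blast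
  let ?W = "ball ?p r"
  have W: "q \<in> U2" "q \<in> null_dom" "\<pi> (surf q) \<in> V" "\<Theta> q \<in> N" if "q \<in> ?W" for q
    using that r(2) unfolding W0_def V'_def \<Theta>_def by auto
  have \<Theta>S: "\<Theta> q \<in> S" "\<Theta> q \<in> U" "\<pi> (F (\<Theta> q)) = \<pi> (surf q)" if "q \<in> ?W" for q
  proof -
    show "\<Theta> q \<in> U" "\<pi> (F (\<Theta> q)) = \<pi> (surf q)"
      using W(3)[OF that] H(1) unfolding \<Theta>_def homeomorphism_def by auto
    then show "\<Theta> q \<in> S" using U(2) by blast
  qed
  have par: "F (\<Theta> q) \<times> \<xi> = surf q \<times> \<xi>" if "q \<in> ?W" for q
  proof -
    have "\<pi> (F (\<Theta> q) - surf q) = 0" 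
      using \<Theta>S(3)[OF that] by (simp add: linear_diff[OF bounded_linear.linear[OF \<pi>(1)]])
    then obtain t where "F (\<Theta> q) - surf q = t *\<^sub>R \<xi>" using \<pi>(2)[of "F (\<Theta> q) - surf q"] by auto
    then have "F (\<Theta> q) = surf q + t *\<^sub>R \<xi>" by (simp add: algebra_simps)
    then show ?thesis by (simp add: cross_add_left cross_mult_left)
  qed
  \<comment> \<open>The difference of the characteristic maps determines the parameters by
    injectivity; their sum is then the conormal at these parameters.\<close>
  have nrm_eq: "conormal_of \<xi> F (\<Theta> q) = conormal q" if q: "q \<in> ?W" for q
  proof -
    obtain \<sigma> \<tau> where st: "\<bar>\<sigma> - s0\<bar> < \<epsilon>" "\<bar>\<tau> - s0\<bar> < \<epsilon>" "A 1 (\<Theta> q) = a \<sigma>" "A (-1) (\<Theta> q) = b \<tau>"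
      using N(3)[OF W(4)[OF q]] by blast
    have U2': "(\<sigma>, \<tau>) \<in> U2" by (rule \<epsilon>(2)[OF st(1,2)])
    have "A 1 (\<Theta> q) - A (-1) (\<Theta> q) = F (\<Theta> q) \<times> \<xi>"
      unfolding A_def scaleR_diff_right[symmetric] by (simp flip: scaleR_2)
    then have "surf q \<times> \<xi> = surf (\<sigma>, \<tau>) \<times> \<xi>"
      using par[OF q] surf_cross_xi[OF base int, OF subsetD[OF U2(2) U2']] st(3,4) by simp
    from \<pi>_eq[OF this] have "q = (\<sigma>, \<tau>)" by (rule inj2[OF W(1)[OF q] U2'])
    moreover have "A 1 (\<Theta> q) + A (-1) (\<Theta> q) = conormal_of \<xi> F (\<Theta> q)"
      unfolding A_def scaleR_add_right[symmetric] by (simp flip: scaleR_2)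
    ultimately show ?thesis using st(3,4) by (simp add: conormal_def)
  qed
  \<comment> \<open>The difference of the two surfaces is a multiple of \<xi>, hence so is its
    derivative. The common conormal annihilates that derivative but not \<xi>, so the difference is
    constant, and it is zero at the centre.\<close>
  have eq: "F (\<Theta> q) = surf q" if q: "q \<in> ?W" for q
  proof -
    let ?f = "\<lambda>q. F (\<Theta> q) - surf q"
    have "\<exists>c. \<forall>q\<in>?W. ?f q = c"
    proof (rule has_derivative_zero_constant)
      fix q assume q: "q \<in> ?W"
      note dS = smooth_on_has_derivative[OF smooth_surf W(2)[OF q]]
      note dF = smooth_on_has_derivative[OF S(2) \<Theta>S(1)[OF q]]
      define dT where "dT v = fderiv H (\<pi> (surf q)) (\<pi> (fderiv surf q v))" for v
      have dT: "(\<Theta> has_derivative dT) (at q)"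
        unfolding \<Theta>_def[abs_def] dT_def[abs_def]
        by (rule has_derivative_compose[OF bounded_linear.has_derivative[OF \<pi>(1) dS] H(2)[OF W(3)[OF q]]])
      define D where "D v = fderiv F (\<Theta> q) (dT v) - fderiv surf q v" for v
      have D: "(?f has_derivative D) (at q)"
        unfolding D_def[abs_def] by (intro has_derivative_diff has_derivative_compose[OF dT dF] dS)
      have "((\<lambda>q. ?f q \<times> \<xi>) has_derivative (\<lambda>v. D v \<times> \<xi>)) (at q)"
        by (rule bounded_linear.has_derivative[OF bounded_bilinear.bounded_linear_left[OF bounded_bilinear_cross3] D])
      moreover have "((\<lambda>q. ?f q \<times> \<xi>) has_derivative (\<lambda>v. 0)) (at q)"
        by (rule has_derivative_transform_within_open[OF _ open_ball q, of "\<lambda>q. 0"]) 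
          (use par in \<open>auto simp: Cross3.left_diff_distrib\<close>)
      ultimately have "(\<lambda>v. D v \<times> \<xi>) = (\<lambda>v. 0)" by (rule has_derivative_unique)
      then have Dx: "D v \<times> \<xi> = 0" for v by (rule fun_cong)
      have "D v = 0" for v
      proof -
        obtain k where k: "D v = k *\<^sub>R \<xi>" using cross_zero_parallel[OF Dx \<xi>] by blast
        have "conormal q \<bullet> D v = 0"
          unfolding D_def using conormal_of_fderiv[OF has_derivative_linear[OF dF], of \<xi> "dT v"] nrm_eq[OF q] 
            conormal_fderiv[OF W(2)[OF q]] by (simp add: inner_diff_right)
        then show ?thesis using k conormal_xi[OF W(2)[OF q]] by simp
      qed
      then have "D = (\<lambda>v. 0)" by auto
      then show "(?f has_derivative (\<lambda>h. 0)) (at q within ?W)" using D by (simp add: has_derivative_at_withinI)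
    qed simp
    then have "?f q = ?f ?p" using q r(1) by (metis centre_in_ball)
    then show ?thesis using \<Theta>0 init by simp
  qed
  show ?thesis
  proof (rule that[of ?W \<Theta>])
    show "open ?W" "?p \<in> ?W" "?W \<subseteq> null_dom" "\<Theta> ` ?W \<subseteq> S" using r(1) W(2) \<Theta>S(1) by auto
    show "continuous_on ?W \<Theta>"
      unfolding \<Theta>_def[abs_def]
    proof (rule continuous_on_compose2[OF homeomorphism_cont2[OF H(1)] continuous_on_subset[OF cps]])
      show "?W \<subseteq> null_dom" using W(2) by blast
      show "(\<lambda>p. \<pi> (surf p)) ` ?W \<subseteq> V" using W(3) by blast
    qed
    show "F (\<Theta> q) = surf q" if "q \<in> ?W" for q by (rule eq[OF that])
    have "isCont \<gamma> s0" using \<gamma>(1) has_vector_derivative_continuous by blast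
    then have "filterlim \<gamma> (nhds (\<gamma> s0)) (nhds s0)"
      using tendsto_at_iff_tendsto_nhds[of \<gamma> s0] by (simp add: isCont_def)
    from topological_tendstoD[OF this U(1,3)] have "\<forall>\<^sub>F t in nhds s0. \<gamma> t \<in> U" .
    moreover have "\<forall>\<^sub>F t in nhds s0. t \<in> J" by (rule eventually_nhds_in_open[OF J s0])
    ultimately show "\<forall>\<^sub>F t in nhds s0. \<Theta> (t, t) = \<gamma> t" using ev
    proof eventually_elim
      case (elim t)
      then have "\<pi> (F (\<gamma> t)) = \<pi> (surf (t, t))"
        using surf_cross_xi[OF base int, of "(t, t)"] elim by (intro \<pi>_eq) (simp add: null_dom_def)
      then show ?case using homeomorphism_apply1[OF H(1) elim(1)] unfolding \<Theta>_def by simp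
    qed
  qed
qed

end

section \<open>Lifting null coordinates to a solution\<close>

lemma is_chart_properties:
  assumes "is_chart X c"
  shows chart_inj: "inj_on (snd c) (fst c)"
    and chart_continuous: "continuous_map (subtopology X (fst c)) (top_of_set (chart_range c)) (snd c)"
    and chart_inv_continuous: "continuous_map (top_of_set (chart_range c)) X (inv_into (fst c) (snd c))"
    and chart_domain: "openin X (fst c)" "fst c \<subseteq> topspace X" "open (chart_range c)"
proof -
  have c: "openin X (fst c)" "open (chart_range c)"
    "homeomorphic_map (subtopology X (fst c)) (top_of_set (chart_range c)) (snd c)"
    using assms by (auto simp: is_chart_def)
  show "openin X (fst c)" "open (chart_range c)" by fact+
  show sub: "fst c \<subseteq> topspace X" using c(1) by (rule openin_subset)
  then have top: "topspace (subtopology X (fst c)) = fst c" by (rule topspace_subtopology_subset)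
  show inj: "inj_on (snd c) (fst c)" using homeomorphic_imp_injective_map[OF c(3)] top by simp
  show "continuous_map (subtopology X (fst c)) (top_of_set (chart_range c)) (snd c)"
    by (rule homeomorphic_imp_continuous_map[OF c(3)])
  obtain g where g: "homeomorphic_maps (subtopology X (fst c)) (top_of_set (chart_range c)) (snd c) g"
    using c(3) homeomorphic_map_maps by blast
  have "continuous_map (top_of_set (chart_range c)) X g"
    using g unfolding homeomorphic_maps_def continuous_map_in_subtopology by blast
  \<comment> \<open>The homeomorphism comes with an unspecified inverse \<open>g\<close>; it is
    identified with \<open>inv_into\<close>, the inverse used by \<open>in_chart\<close>.\<close>
  moreover have "g y = inv_into (fst c) (snd c) y" if "y \<in> chart_range c" for y
  proof -
    obtain x where x: "x \<in> fst c" "y = snd c x" using \<open>y \<in> chart_range c\<close> by (auto simp: chart_range_def)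
    then have "g y = x" using g top by (auto simp: homeomorphic_maps_def)
    then show ?thesis using x inv_into_f_f[OF inj] by simp
  qed
  ultimately show "continuous_map (top_of_set (chart_range c)) X (inv_into (fst c) (snd c))"
    by (rule continuous_map_eq) auto
qed

lemma in_chart_apply:
  assumes "is_chart X c" "x \<in> fst c" shows "in_chart c f (snd c x) = f x"
  using inv_into_f_f[OF chart_inj[OF assms(1)] assms(2)] by (simp add: in_chart_def)

lemma continuous_into_chart:
  assumes "is_chart X c" "open W" "continuous_map (top_of_set W) X \<Phi>"
  shows "open {p \<in> W. \<Phi> p \<in> fst c}" "continuous_on {p \<in> W. \<Phi> p \<in> fst c} (snd c \<circ> \<Phi>)"
proof -
  let ?V = "{p \<in> W. \<Phi> p \<in> fst c}"
  have "openin (top_of_set W) ?V"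
    using openin_continuous_map_preimage[OF assms(3) chart_domain(1)[OF assms(1)]] by simp
  then show "open ?V" using assms(2) openin_open_trans by blast
  have "continuous_map (top_of_set ?V) (subtopology X (fst c)) \<Phi>"
    unfolding continuous_map_in_subtopology
    using continuous_map_from_subtopology[OF assms(3), of ?V] by (auto simp: subtopology_subtopology Int_absorb1)
  from continuous_map_compose[OF this chart_continuous[OF assms(1)]]
  show "continuous_on ?V (snd c \<circ> \<Phi>)" by (simp add: continuous_map_in_subtopology)
qed

lemma sphere_chart:
  assumes "indefinite_improper_affine_sphere \<xi> X A \<psi>" "c \<in> A"
  shows "is_chart X c" and "sphere_patch \<xi> (chart_range c) (in_chart c \<psi>)"
proof -
  have surface: "analytic_surface X A" "smooth_map A \<psi>"
    and sph: "\<And>q. q \<in> chart_range c \<Longrightarrow> inj (fderiv (in_chart c \<psi>) q) \<and> \<xi> \<notin> range (fderiv (in_chart c \<psi>) q) \<and>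
      lorentzian (affine_metric \<xi> (in_chart c \<psi>) q) \<and> (\<forall>v w. 
        sqrt ((affine_metric \<xi> (in_chart c \<psi>) q v w)\<^sup>2 - affine_metric \<xi> (in_chart c \<psi>) q v v * affine_metric \<xi> (in_chart c \<psi>) q w w)
        = \<bar>triple_det (fderiv (in_chart c \<psi>) q v) (fderiv (in_chart c \<psi>) q w) \<xi>\<bar>)"
    using assms unfolding indefinite_improper_affine_sphere_def Let_def by blast+
  show ch: "is_chart X c" using surface(1) assms(2) by (auto simp: analytic_surface_def)
  have sm: "smooth_on (chart_range c) (in_chart c \<psi>)" using surface(2) assms(2) by (simp add: smooth_map_def)
  have "jac \<xi> (in_chart c \<psi>) q \<noteq> 0" if "q \<in> chart_range c" for q
    using transversal_iff[OF has_derivative_linear[OF smooth_on_has_derivative[OF sm that]], of \<xi>] sph[OF that]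
    by (simp add: jac_def)
  then show "sphere_patch \<xi> (chart_range c) (in_chart c \<psi>)"
    unfolding sphere_patch_def Let_def using chart_domain(3)[OF ch] sm sph lorentzian_def by blast
qed

text \<open>A continuous lift through a transversal immersion is as smooth as the lifted map. Applied to the
  inverse of another chart it replaces the differentiability of transition maps, which need not be
  derived from their analyticity.\<close>

lemma sphere_lift_smooth:
  fixes \<Phi> :: "real \<times> real \<Rightarrow> 'a"
  assumes sph: "indefinite_improper_affine_sphere \<xi> X A \<psi>" "c \<in> A"
    and W: "open W" "continuous_map (top_of_set W) X \<Phi>" and E: "smooth_on W E" "\<And>p. p \<in> W \<Longrightarrow> \<psi> (\<Phi> p) = E p"
  shows "smooth_on {p \<in> W. \<Phi> p \<in> fst c} (snd c \<circ> \<Phi>)"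
    and "\<And>p v. p \<in> W \<Longrightarrow> \<Phi> p \<in> fst c \<Longrightarrow>
      fderiv (in_chart c \<psi>) (snd c (\<Phi> p)) (fderiv (snd c \<circ> \<Phi>) p v) = fderiv E p v"
proof -
  note ch = sphere_chart(1)[OF sph] sphere_patchD[OF sphere_chart(2)[OF sph]]
  let ?V = "{p \<in> W. \<Phi> p \<in> fst c}"
  have *: "(snd c \<circ> \<Phi>) ` ?V \<subseteq> chart_range c" by (auto simp: chart_range_def)
  have **: "in_chart c \<psi> ((snd c \<circ> \<Phi>) p) = E p" if "p \<in> ?V" for p
    using that by (simp add: in_chart_apply[OF ch(1)] E(2))
  have ***: "smooth_on ?V E" by (rule smooth_on_subset[OF E(1)]) blast
  note lift = smooth_lift[OF ch(2,3) ch(4)[unfolded jac_def] continuous_into_chart[OF ch(1) W] * *** **]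
  show "smooth_on ?V (snd c \<circ> \<Phi>)" by (rule lift(1))
  show "fderiv (in_chart c \<psi>) (snd c (\<Phi> p)) (fderiv (snd c \<circ> \<Phi>) p v) = fderiv E p v" 
    if "p \<in> W" "\<Phi> p \<in> fst c" for p v
    using lift(2)[of p v] that unfolding o_def by simp
qed

text \<open>The definition refers to all charts around \<open>x\<close>. The inverse of a second
  chart is a lift into the first one, so every tangent vector seen in the second chart is one seen
  in the first, and the formula from one chart satisfies the conditions for all.\<close>

lemma sphere_conormal:
  assumes sph: "indefinite_improper_affine_sphere \<xi> X A \<psi>" and c: "c \<in> A" "x \<in> fst c"
  shows "affine_conormal \<xi> A \<psi> x = conormal_of \<xi> (in_chart c \<psi>) (snd c x)"
proof -
  note ch = sphere_chart(1)[OF sph c(1)] sphere_patchD[OF sphere_chart(2)[OF sph c(1)]]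
  let ?n = "conormal_of \<xi> (in_chart c \<psi>) (snd c x)"
  have q: "snd c x \<in> chart_range c" using c(2) by (auto simp: chart_range_def)
  have n: "?n \<bullet> \<xi> = 1" "\<And>v. ?n \<bullet> fderiv (in_chart c \<psi>) (snd c x) v = 0"
    by (rule conormal_of_xi[OF ch(4)[OF q]], rule conormal_of_fderiv[OF ch(7)[OF q]])
  show ?thesis
    unfolding affine_conormal_def
  proof (rule the_equality)
    show "?n \<bullet> \<xi> = 1 \<and> (\<forall>d\<in>A. x \<in> fst d \<longrightarrow> (\<forall>v. ?n \<bullet> fderiv (in_chart d \<psi>) (snd d x) v = 0))"
    proof (intro conjI ballI impI allI n(1))
      fix d v assume d: "d \<in> A" "x \<in> fst d"
      note dh = sphere_chart(1)[OF sph d(1)] sphere_patchD[OF sphere_chart(2)[OF sph d(1)]]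
      have dx: "snd d x \<in> chart_range d" using d(2) by (auto simp: chart_range_def)
      have inv: "inv_into (fst d) (snd d) (snd d x) = x" by (rule inv_into_f_f[OF chart_inj[OF dh(1)] d(2)])
      have "fderiv (in_chart c \<psi>) (snd c (inv_into (fst d) (snd d) (snd d x))) 
          (fderiv (snd c \<circ> inv_into (fst d) (snd d)) (snd d x) v) = fderiv (in_chart d \<psi>) (snd d x) v"
        by (rule sphere_lift_smooth(2)[OF sph c(1) dh(2) chart_inv_continuous[OF dh(1)] dh(3) _ dx])
          (use inv c(2) in \<open>auto simp: in_chart_def\<close>)
      then show "?n \<bullet> fderiv (in_chart d \<psi>) (snd d x) v = 0" using n(2) unfolding inv by metis
    qed
    show "m = ?n" if "m \<bullet> \<xi> = 1 \<and> (\<forall>d\<in>A. x \<in> fst d \<longrightarrow> (\<forall>v. m \<bullet> fderiv (in_chart d \<psi>) (snd d x) v = 0))" for m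
      by (rule conormal_unique[OF ch(4)[OF q] ch(7)[OF q] n]) (use that c in auto)
  qed
qed

text \<open>Near each point already the composition of the immersion with the projection along \<xi>
  is invertible in a chart.\<close>

lemma sphere_locally_injective:
  assumes sph: "indefinite_improper_affine_sphere \<xi> X A \<psi>" and x: "x \<in> topspace X"
  obtains V where "openin X V" "x \<in> V" "inj_on \<psi> V"
proof -
  have "topspace X = (\<Union>c\<in>A. fst c)" "\<xi> \<noteq> 0"
    using sph by (auto simp: indefinite_improper_affine_sphere_def analytic_surface_def)
  then obtain c where c: "c \<in> A" "x \<in> fst c" using x by blast
  note ch = sphere_chart(1)[OF sph c(1)] sphere_patchD[OF sphere_chart(2)[OF sph c(1)]]
  have q: "snd c x \<in> chart_range c" using c(2) by (auto simp: chart_range_def)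
  obtain \<pi> :: "real^3 \<Rightarrow> real \<times> real" where \<pi>: "bounded_linear \<pi>" "\<And>x. \<pi> x = 0 \<longleftrightarrow> (\<exists>t. x = t *\<^sub>R \<xi>)"
    using projection_along[OF \<open>\<xi> \<noteq> 0\<close>] by blast
  obtain U V H where U: "open U" "U \<subseteq> chart_range c" "snd c x \<in> U" 
    and H: "homeomorphism U V (\<lambda>x. \<pi> (in_chart c \<psi> x)) H"
    by (rule transversal_local_inverse[OF ch(2,3) q ch(4)[OF q, unfolded jac_def] \<pi>]) blast
  let ?V = "{y \<in> fst c. snd c y \<in> U}"
  have "openin (top_of_set (chart_range c)) U" using U(1,2) by (simp add: open_subset)
  from openin_continuous_map_preimage[OF chart_continuous[OF ch(1)] this]
  have "openin (subtopology X (fst c)) ?V"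
    unfolding topspace_subtopology_subset[OF chart_domain(2)[OF ch(1)]] .
  then have "openin X ?V" using chart_domain(1)[OF ch(1)] openin_trans_full by blast
  moreover have "inj_on \<psi> ?V"
  proof (rule inj_onI)
    fix y z assume yz: "y \<in> ?V" "z \<in> ?V" "\<psi> y = \<psi> z"
    then have "in_chart c \<psi> (snd c y) = in_chart c \<psi> (snd c z)" by (simp add: in_chart_apply[OF ch(1)])
    moreover have "H (\<pi> (in_chart c \<psi> (snd c y))) = snd c y" "H (\<pi> (in_chart c \<psi> (snd c z))) = snd c z"
      using yz(1,2) homeomorphism_apply1[OF H, of "snd c y"] homeomorphism_apply1[OF H, of "snd c z"] by blast+
    ultimately have "snd c y = snd c z" by metis
    then show "y = z" using inj_onD[OF chart_inj[OF ch(1)]] yz by simp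
  qed
  ultimately show ?thesis using that c(2) U(3) by blast
qed

text \<open>The set where the two lifts coincide is closed because the surface is Hausdorff and open
  because the immersion is locally injective.\<close>

lemma sphere_lift_unique:
  assumes sph: "indefinite_improper_affine_sphere \<xi> X A \<psi>"
    and B: "open B" "connected B" and lifts: "continuous_map (top_of_set B) X f" "continuous_map (top_of_set B) X g"
    and eq: "\<And>p. p \<in> B \<Longrightarrow> \<psi> (f p) = \<psi> (g p)" and p0: "p0 \<in> B" "f p0 = g p0" and p: "p \<in> B"
  shows "f p = g p"
proof -
  let ?E = "{p \<in> B. f p = g p}"
  have "Hausdorff_space X" using sph by (simp add: indefinite_improper_affine_sphere_def analytic_surface_def)
  from closedin_continuous_maps_eq[OF this lifts] have cl: "closedin (top_of_set B) ?E" by simp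
  have "openin (top_of_set B) ?E"
  proof (subst openin_subopen, intro ballI)
    fix q assume q: "q \<in> ?E"
    have "f ` B \<subseteq> topspace X" using continuous_map_image_subset_topspace[OF lifts(1)] by simp
    then have "f q \<in> topspace X" using q by blast
    then obtain V where V: "openin X V" "f q \<in> V" "inj_on \<psi> V" using sphere_locally_injective[OF sph] by blast
    let ?T = "{p \<in> B. f p \<in> V} \<inter> {p \<in> B. g p \<in> V}"
    have "openin (top_of_set B) ?T"
      using openin_continuous_map_preimage[OF lifts(1) V(1)] openin_continuous_map_preimage[OF lifts(2) V(1)]
      by (intro openin_Int) simp_all
    moreover have "q \<in> ?T" using q V(2) by auto
    moreover have "?T \<subseteq> ?E" using inj_onD[OF V(3) eq] by auto
    ultimately show "\<exists>T. openin (top_of_set B) T \<and> q \<in> T \<and> T \<subseteq> ?E" by blast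
  qed
  with cl B(2) have "?E = {} \<or> ?E = B" unfolding connected_clopen by blast
  then show ?thesis using p0 p by blast
qed

context null_data
begin

text \<open>The linear change u = x + y, v = x - y, which takes the axis of the strip in
  \<open>agree_near_curve\<close> to the diagonal that carries the Cauchy data.\<close>

definition null_coords :: "real \<times> real \<Rightarrow> real \<times> real" where
  "null_coords p = (fst p + snd p, fst p - snd p)"

lemma bounded_linear_null_coords: "bounded_linear null_coords"
  unfolding null_coords_def[abs_def] by (intro bounded_linear_intros)

text \<open>In a chart around \<open>\<beta> s0\<close> the solution meets the hypotheses of
  \<open>local_normal_form\<close>, and the lift found there is carried to the surface by the
  inverse chart. The alternative \<open>open I \<or> analytic_map A \<psi>\<close> provides the
  relations of conormal and position with \<open>a\<close> and \<open>b\<close> on both sides of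
  \<open>s0\<close>.\<close>

lemma local_lift:
  fixes \<beta> :: "real \<Rightarrow> 'b"
  assumes I: "is_interval I" "interior I \<noteq> {}" "I \<subseteq> J" "is_interval J"
    and data: "\<And>s. s \<in> I \<Longrightarrow> surf (s, s) = \<alpha> s" "\<And>s. s \<in> I \<Longrightarrow> conormal (s, s) = U s" 
      "\<And>s. s \<in> I \<Longrightarrow> null_det (s, s) \<noteq> 0"
    and base: "s1 \<in> J" "surf (s1, s1) \<times> \<xi> = a s1 - b s1"
    and sol: "cauchy_solution \<xi> I \<alpha> U X A \<psi> \<beta>" and an: "open I \<or> analytic_map A \<psi>"
    and s0: "s0 \<in> I"
  obtains r \<Theta> where "r > 0" "ball (s0, 0) r \<subseteq> null_coords -` reg_dom" "continuous_map (top_of_set (ball (s0, 0) r)) X \<Theta>"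
    "\<And>p. p \<in> ball (s0, 0) r \<Longrightarrow> \<psi> (\<Theta> p) = surf (null_coords p)"
    "\<And>s. s \<in> I \<Longrightarrow> \<bar>s - s0\<bar> < r \<Longrightarrow> \<Theta> (s, 0) = \<beta> s"
proof -
  have sph: "indefinite_improper_affine_sphere \<xi> X A \<psi>" and reg: "regular_analytic_curve I X A \<beta>"
    and sol': "\<And>s. s \<in> I \<Longrightarrow> \<psi> (\<beta> s) = \<alpha> s" "\<And>s. s \<in> I \<Longrightarrow> affine_conormal \<xi> A \<psi> (\<beta> s) = U s"
    using sol by (auto simp: cauchy_solution_def)
  have top: "topspace X = (\<Union>c\<in>A. fst c)"
    using sph by (auto simp: indefinite_improper_affine_sphere_def analytic_surface_def)
  have cont\<beta>: "continuous_map (top_of_set I) X \<beta>" using reg by (simp add: regular_analytic_curve_def)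
  then have "\<beta> s0 \<in> topspace X" using s0 by (auto simp: continuous_map_def)
  then obtain c where c: "c \<in> A" "\<beta> s0 \<in> fst c" using top by blast
  note ch = sphere_chart(1)[OF sph c(1)] sphere_patchD[OF sphere_chart(2)[OF sph c(1)]]
  let ?S = "chart_range c" and ?F = "in_chart c \<psi>"
  define T where "T = {s \<in> I. \<beta> s \<in> fst c}"
  have "openin (top_of_set I) T"
    using openin_continuous_map_preimage[OF cont\<beta> chart_domain(1)[OF ch(1)]] by (simp add: T_def)
  then obtain K where K: "open K" "T = I \<inter> K" unfolding openin_open by blast
  have s0T: "s0 \<in> T" "s0 \<in> K" using s0 c(2) K(2) by (auto simp: T_def)
  have evK: "\<forall>\<^sub>F t in nhds s0. t \<in> K" by (rule eventually_nhds_in_open[OF K(1) s0T(2)])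
  have lim: "\<exists>\<^sub>F t in at s0. t \<in> I" using interval_islimpt[OF I(1,2) s0] by (simp add: islimpt_conv_frequently_at)
  have at: "\<forall>\<^sub>F t in at s0. P t" if "\<forall>\<^sub>F t in nhds s0. P t" for P
    using that by (auto simp: eventually_at_filter elim: eventually_mono)
  \<comment> \<open>As \<open>I\<close> accumulates at \<open>s0\<close>, whatever holds on
    \<open>I\<close> near \<open>s0\<close> holds frequently, which is the form required by the
    identity theorem.\<close>
  have freq: "\<exists>\<^sub>F t in at s0. P t" if "\<forall>\<^sub>F t in nhds s0. t \<in> I \<longrightarrow> P t" for P
    using frequently_eventually_frequently[OF lim at[OF that]] by (rule frequently_elim1) blast
  have limT: "s0 islimpt T"
    unfolding islimpt_conv_frequently_at by (rule freq) (use evK in \<open>auto simp: K(2) elim: eventually_mono\<close>)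
  have anT: "real_analytic_on T (snd c \<circ> \<beta>)"
    using reg c(1) unfolding regular_analytic_curve_def T_def by blast
  \<comment> \<open>At an end point of \<open>I\<close> the germs continue the curve beyond \<open>I\<close>; for an analytic surface the
    identity theorem carries the Cauchy data along.\<close>
  obtain gx where gx: "real_germ gx s0" "\<forall>\<^sub>F t in nhds s0. t \<in> T \<longrightarrow> gx t = fst ((snd c \<circ> \<beta>) t)"
    by (rule real_analytic_on_extends[OF anT s0T(1) limT bounded_linear_fst]) 
  obtain gy where gy: "real_germ gy s0" "\<forall>\<^sub>F t in nhds s0. t \<in> T \<longrightarrow> gy t = snd ((snd c \<circ> \<beta>) t)"
    by (rule real_analytic_on_extends[OF anT s0T(1) limT bounded_linear_snd]) 
  define \<gamma> where "\<gamma> t = (gx t, gy t)" for t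
  have ev\<gamma>: "\<forall>\<^sub>F t in nhds s0. t \<in> I \<longrightarrow> \<beta> t \<in> fst c \<and> \<gamma> t = snd c (\<beta> t)"
    using gx(2) gy(2) evK
  proof eventually_elim
    case (elim t)
    show ?case
    proof
      assume "t \<in> I"
      then have "t \<in> T" using elim(3) K(2) by simp
      then show "\<beta> t \<in> fst c \<and> \<gamma> t = snd c (\<beta> t)" using elim(1,2) by (simp add: \<gamma>_def T_def)
    qed
  qed
  have \<gamma>0: "\<gamma> s0 = snd c (\<beta> s0)" using eventually_nhds_x_imp_x[OF ev\<gamma>] s0 by blast
  have \<gamma>S: "\<gamma> s0 \<in> ?S" using \<gamma>0 c(2) by (auto simp: chart_range_def)
  obtain gx' where gx': "\<forall>\<^sub>F t in nhds s0. (gx has_real_derivative gx' t) (at t)" by (rule real_germ_deriv[OF gx(1)])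
  obtain gy' where gy': "\<forall>\<^sub>F t in nhds s0. (gy has_real_derivative gy' t) (at t)" by (rule real_germ_deriv[OF gy(1)])
  have der\<gamma>: "(\<gamma> has_vector_derivative (gx' s0, gy' s0)) (at s0)"
    unfolding \<gamma>_def[abs_def] using eventually_nhds_x_imp_x[OF gx'] eventually_nhds_x_imp_x[OF gy']
    by (intro has_vector_derivative_Pair) (simp_all add: has_real_derivative_iff_has_vector_derivative)
  have ev\<gamma>S: "\<forall>\<^sub>F t in nhds s0. \<gamma> t \<in> ?S"
  proof -
    have "isCont \<gamma> s0" using der\<gamma> has_vector_derivative_continuous by blast
    then have "filterlim \<gamma> (nhds (\<gamma> s0)) (nhds s0)"
      using tendsto_at_iff_tendsto_nhds[of \<gamma> s0] by (simp add: isCont_def)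
    from topological_tendstoD[OF this ch(2) \<gamma>S] show ?thesis .
  qed
  have s0J: "s0 \<in> J" using s0 I(3) by blast
  have evJ: "\<forall>\<^sub>F t in nhds s0. t \<in> J" by (rule eventually_nhds_in_open[OF J s0J])
  have onI: "conormal_of \<xi> ?F (\<gamma> t) = a t + b t \<and> ?F (\<gamma> t) \<times> \<xi> = a t - b t" 
    if "t \<in> I" "\<beta> t \<in> fst c" "\<gamma> t = snd c (\<beta> t)" for t
  proof
    have tJ: "(t, t) \<in> null_dom" using that(1) I(3) by (auto simp: null_dom_def)
    show "conormal_of \<xi> ?F (\<gamma> t) = a t + b t"
      using sphere_conormal[OF sph c(1) that(2)] sol'(2)[OF that(1)] data(2)[OF that(1)] that(3) by (simp add: conormal_def)
    show "?F (\<gamma> t) \<times> \<xi> = a t - b t"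
      using surf_cross_xi[OF base I(4) tJ] data(1)[OF that(1)] sol'(1)[OF that(1)] in_chart_apply[OF ch(1) that(2), of \<psi>] that(3) by simp
  qed
  have ev: "\<forall>\<^sub>F t in nhds s0. conormal_of \<xi> ?F (\<gamma> t) = a t + b t \<and> ?F (\<gamma> t) \<times> \<xi> = a t - b t"
    using an
  proof
    assume "open I"
    from eventually_nhds_in_open[OF this s0] ev\<gamma> show ?thesis by eventually_elim (use onI in blast)
  next
    assume "analytic_map A \<psi>"
    then have anF: "real_analytic2_on ?S ?F" using c(1) by (simp add: analytic_map_def)
    have \<gamma>S': "(gx s0, gy s0) \<in> ?S" using \<gamma>S by (simp add: \<gamma>_def)
    note an2 = real_analytic2_on_germ[OF ch(2) anF ch(3) gx(1) gy(1) \<gamma>S']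
    have gF: "vec_germ (\<lambda>t. ?F (\<gamma> t)) s0" "vec_germ (\<lambda>t. fderiv ?F (\<gamma> t) (1, 0)) s0" "vec_germ (\<lambda>t. fderiv ?F (\<gamma> t) (0, 1)) s0"
      unfolding vec_germ_def \<gamma>_def using an2 by blast+
    have position: "\<forall>\<^sub>F t in nhds s0. ?F (\<gamma> t) \<times> \<xi> = a t - b t"
      by (rule vec_germ_identity[OF vec_germ_cross[OF gF(1) vec_germ_const] vec_germ_diff[OF germ(1,2)[OF s0J]]])
        (rule freq, use ev\<gamma> onI in \<open>auto elim!: eventually_mono\<close>)
    \<comment> \<open>Instead of the conormal, which contains a quotient, the identity theorem is
      applied to the orthogonality of \<open>a t + b t\<close> to the tangent vectors. With the
      normalisation by \<xi> this characterises the conormal.\<close>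
    have zero: "\<forall>\<^sub>F t in nhds s0. (a t + b t) \<bullet> fderiv ?F (\<gamma> t) v = 0" 
      if "vec_germ (\<lambda>t. fderiv ?F (\<gamma> t) v) s0" for v
    proof (rule real_germ_identity[OF vec_germ_inner[OF vec_germ_add[OF germ(1,2)[OF s0J]] that] real_germ_const])
      show "\<exists>\<^sub>F t in at s0. (a t + b t) \<bullet> fderiv ?F (\<gamma> t) v = 0"
      proof (rule freq)
        show "\<forall>\<^sub>F t in nhds s0. t \<in> I \<longrightarrow> (a t + b t) \<bullet> fderiv ?F (\<gamma> t) v = 0"
          using ev\<gamma> ev\<gamma>S
        proof eventually_elim
          case (elim t)
          then show ?case using onI[of t] conormal_of_fderiv[OF ch(7)[OF elim(2)], of \<xi> v] by auto
        qed
      qed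
    qed
    show ?thesis using position zero[OF gF(2)] zero[OF gF(3)] ev\<gamma>S evJ
    proof eventually_elim
      case (elim t)
      have "(a t + b t) \<bullet> \<xi> = 1" using half[OF elim(5)] by (simp add: inner_add_left)
      then have "a t + b t = conormal_of \<xi> ?F (\<gamma> t)"
        using conormal_unique[OF ch(4)[OF elim(4)] ch(7)[OF elim(4)] conormal_of_xi[OF ch(4)[OF elim(4)]] conormal_of_fderiv[OF ch(7)[OF elim(4)]]] elim(2,3)
        by blast
      then show ?case using elim(1) by simp
    qed
  qed
  have init: "?F (\<gamma> s0) = surf (s0, s0)"
    using data(1)[OF s0] sol'(1)[OF s0] in_chart_apply[OF ch(1) c(2), of \<psi>] \<gamma>0 by simp
  obtain W \<Theta> where W: "open W" "(s0, s0) \<in> W" "W \<subseteq> null_dom" "continuous_on W \<Theta>" "\<Theta> ` W \<subseteq> ?S"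
    "\<And>p. p \<in> W \<Longrightarrow> ?F (\<Theta> p) = surf p" "\<forall>\<^sub>F t in nhds s0. \<Theta> (t, t) = \<gamma> t"
  proof (rule local_normal_form[OF I(4) s0J base data(3)[OF s0] sphere_chart(2)[OF sph c(1)] der\<gamma> \<gamma>S ev init])
    fix W \<Theta>
    assume "open W" "(s0, s0) \<in> W" "W \<subseteq> null_dom" "continuous_on W \<Theta>" "\<Theta> ` W \<subseteq> ?S"
      "\<And>p. p \<in> W \<Longrightarrow> ?F (\<Theta> p) = surf p" "\<forall>\<^sub>F t in nhds s0. \<Theta> (t, t) = \<gamma> t"
    then show thesis by (rule that)
  qed
  have op: "open (null_coords -` (W \<inter> reg_dom))"
    by (rule open_vimage[OF open_Int[OF W(1) open_reg_dom]]) 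
      (rule linear_continuous_on[OF bounded_linear_null_coords])
  have "(s0, 0) \<in> null_coords -` (W \<inter> reg_dom)"
    using W(2,3) data(3)[OF s0] by (auto simp: null_coords_def reg_dom_def)
  then obtain r1 where r1: "r1 > 0" "ball (s0, 0) r1 \<subseteq> null_coords -` (W \<inter> reg_dom)" using op open_contains_ball by blast
  from eventually_conj[OF W(7) ev\<gamma>] obtain r2 where r2: "r2 > 0"
    "\<And>t. \<bar>t - s0\<bar> < r2 \<Longrightarrow> \<Theta> (t, t) = \<gamma> t \<and> (t \<in> I \<longrightarrow> \<beta> t \<in> fst c \<and> \<gamma> t = snd c (\<beta> t))"
    unfolding eventually_nhds_metric dist_real_def by blast
  let ?r = "min r1 r2"
  let ?\<Theta> = "\<lambda>p. inv_into (fst c) (snd c) (\<Theta> (null_coords p))"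
  have inW: "null_coords p \<in> W" "null_coords p \<in> reg_dom" if "p \<in> ball (s0, 0) ?r" for p using that r1(2) by auto
  show ?thesis
  proof (rule that[of ?r ?\<Theta>])
    show "?r > 0" using r1(1) r2(1) by simp
    show "ball (s0, 0) ?r \<subseteq> null_coords -` reg_dom" using inW(2) by blast
    have "continuous_on (ball (s0, 0) ?r) (\<lambda>p. \<Theta> (null_coords p))"
      by (rule continuous_on_compose2[OF W(4) linear_continuous_on[OF bounded_linear_null_coords]]) (use inW(1) in blast)
    then have "continuous_map (top_of_set (ball (s0, 0) ?r)) (top_of_set ?S) (\<lambda>p. \<Theta> (null_coords p))"
      using W(5) inW(1) by (auto simp: continuous_map_in_subtopology)
    from continuous_map_compose[OF this chart_inv_continuous[OF ch(1)]]
    show "continuous_map (top_of_set (ball (s0, 0) ?r)) X ?\<Theta>" by (simp add: o_def)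
    show "\<psi> (?\<Theta> p) = surf (null_coords p)" if "p \<in> ball (s0, 0) ?r" for p
      using W(6)[OF inW(1)[OF that]] by (simp add: in_chart_def)
    show "?\<Theta> (s, 0) = \<beta> s" if "s \<in> I" "\<bar>s - s0\<bar> < ?r" for s
      using r2(2)[of s] that inv_into_f_f[OF chart_inj[OF ch(1)]] by (simp add: null_coords_def)
  qed
qed

end

lemma local_diffeo_subset:
  assumes "local_diffeo W X A \<Phi>" "open V" "V \<subseteq> W"
  shows "local_diffeo V X A \<Phi>"
  unfolding local_diffeo_def
proof (intro conjI ballI impI)
  have W: "continuous_map (top_of_set W) X \<Phi>"
    and sm: "\<And>c. c \<in> A \<Longrightarrow> smooth_on {p \<in> W. \<Phi> p \<in> fst c} (snd c \<circ> \<Phi>)"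
    and inj: "\<And>c p. c \<in> A \<Longrightarrow> p \<in> W \<Longrightarrow> \<Phi> p \<in> fst c \<Longrightarrow> inj (fderiv (snd c \<circ> \<Phi>) p)"
    using assms(1) by (auto simp: local_diffeo_def)
  show "open V" by fact
  show "continuous_map (top_of_set V) X \<Phi>"
    using continuous_map_from_subtopology[OF W, of V] assms(3) by (simp add: subtopology_subtopology Int_absorb1)
  show "smooth_on {p \<in> V. \<Phi> p \<in> fst c} (snd c \<circ> \<Phi>)" if "c \<in> A" for c
    by (rule smooth_on_subset[OF sm[OF that]]) (use assms(3) in blast)
  show "inj (fderiv (snd c \<circ> \<Phi>) p)" if "c \<in> A" "p \<in> V" "\<Phi> p \<in> fst c" for c p
    using inj that assms(3) by blast
qed

context null_data
begin

text \<open>Local lifts over balls centred on the axis are glued. Two of these balls meet in a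
  convex, hence connected, set that contains an axis point over \<open>I\<close>, where both lifts
  give \<open>\<beta>\<close>; uniqueness of lifts does the rest.\<close>

lemma global_lift:
  fixes \<beta> :: "real \<Rightarrow> 'b"
  assumes I: "is_interval I" "interior I \<noteq> {}" "I \<subseteq> J" "is_interval J"
    and data: "\<And>s. s \<in> I \<Longrightarrow> surf (s, s) = \<alpha> s" "\<And>s. s \<in> I \<Longrightarrow> conormal (s, s) = U s" 
      "\<And>s. s \<in> I \<Longrightarrow> null_det (s, s) \<noteq> 0"
    and base: "s1 \<in> J" "surf (s1, s1) \<times> \<xi> = a s1 - b s1"
    and sol: "cauchy_solution \<xi> I \<alpha> U X A \<psi> \<beta>" and an: "open I \<or> analytic_map A \<psi>"
  obtains W \<Phi> where "local_diffeo W X A \<Phi>" "\<And>s. s \<in> I \<Longrightarrow> (s, 0) \<in> W \<and> \<Phi> (s, 0) = \<beta> s"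
    "\<And>p. p \<in> W \<Longrightarrow> \<psi> (\<Phi> p) = surf (null_coords p)"
proof -
  have sph: "indefinite_improper_affine_sphere \<xi> X A \<psi>" using sol by (simp add: cauchy_solution_def)
  define lifts where "lifts s r \<Theta> \<longleftrightarrow> r > 0 \<and> ball (s, 0) r \<subseteq> null_coords -` reg_dom \<and>
    continuous_map (top_of_set (ball (s, 0) r)) X \<Theta> \<and> (\<forall>p\<in>ball (s, 0) r. \<psi> (\<Theta> p) = surf (null_coords p)) \<and>
    (\<forall>t\<in>I. \<bar>t - s\<bar> < r \<longrightarrow> \<Theta> (t, 0) = \<beta> t)" for s r \<Theta>
  have "\<exists>r \<Theta>. lifts s r \<Theta>" if s: "s \<in> I" for s
  proof (rule local_lift[OF I data base sol an s])
    fix r \<Theta>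
    assume "r > 0" "ball (s, 0) r \<subseteq> null_coords -` reg_dom" "continuous_map (top_of_set (ball (s, 0) r)) X \<Theta>"
      "\<And>p. p \<in> ball (s, 0) r \<Longrightarrow> \<psi> (\<Theta> p) = surf (null_coords p)"
      "\<And>t. t \<in> I \<Longrightarrow> \<bar>t - s\<bar> < r \<Longrightarrow> \<Theta> (t, 0) = \<beta> t"
    then show ?thesis unfolding lifts_def by (intro exI[of _ r] exI[of _ \<Theta>]) simp
  qed
  then obtain r \<Theta> where "\<And>s. s \<in> I \<Longrightarrow> lifts s (r s) (\<Theta> s)" by metis
  then have r: "\<And>s. s \<in> I \<Longrightarrow> r s > 0" 
    and reg: "\<And>s. s \<in> I \<Longrightarrow> ball (s, 0) (r s) \<subseteq> null_coords -` reg_dom"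
    and cont: "\<And>s. s \<in> I \<Longrightarrow> continuous_map (top_of_set (ball (s, 0) (r s))) X (\<Theta> s)"
    and lift: "\<And>s p. s \<in> I \<Longrightarrow> p \<in> ball (s, 0) (r s) \<Longrightarrow> \<psi> (\<Theta> s p) = surf (null_coords p)"
    and curve: "\<And>s t. s \<in> I \<Longrightarrow> t \<in> I \<Longrightarrow> \<bar>t - s\<bar> < r s \<Longrightarrow> \<Theta> s (t, 0) = \<beta> t"
    unfolding lifts_def by blast+
  let ?B = "\<lambda>s. ball (s, 0 :: real) (r s)"
  have dist_axis: "dist (s, 0 :: real) (t, 0 :: real) = \<bar>t - s\<bar>" for s t :: real
    by (simp add: dist_Pair_Pair dist_real_def abs_minus_commute)
  have agree: "\<Theta> s p = \<Theta> t p" if st: "s \<in> I" "t \<in> I" and p: "p \<in> ?B s" "p \<in> ?B t" for s t p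
  proof -
    \<comment> \<open>The first coordinate of \<open>p\<close>, clamped to the segment between
      \<open>s\<close> and \<open>t\<close>. Clamping keeps \<open>m\<close> in \<open>I\<close> and
      \<open>(m, 0)\<close> in both balls.\<close>
    define m where "m = max (min s t) (min (max s t) (fst p))"
    have ps: "\<bar>fst p - s\<bar> < r s" "\<bar>fst p - t\<bar> < r t"
      using p dist_fst_le[of "(s, 0)" p] dist_fst_le[of "(t, 0)" p] by (auto simp: dist_real_def abs_minus_commute)
    have m: "\<bar>m - s\<bar> < r s" "\<bar>m - t\<bar> < r t"
      using ps r[OF st(1)] r[OF st(2)] unfolding m_def by (auto simp: max_def min_def)
    have mI: "m \<in> I"
    proof -
      have "min s t \<in> I" "max s t \<in> I" using st by (auto simp: min_def max_def)
      moreover have "min s t \<le> m" "m \<le> max s t" by (auto simp: m_def)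
      ultimately show ?thesis using I(1)[unfolded is_interval_1, rule_format, of "min s t" "max s t" m] by blast
    qed
    have sub: "continuous_map (top_of_set (?B s \<inter> ?B t)) X (\<Theta> s)" "continuous_map (top_of_set (?B s \<inter> ?B t)) X (\<Theta> t)"
      using continuous_map_from_subtopology[OF cont[OF st(1)], of "?B s \<inter> ?B t"] 
        continuous_map_from_subtopology[OF cont[OF st(2)], of "?B s \<inter> ?B t"]
      by (simp_all add: subtopology_subtopology Int_absorb1)
    show ?thesis
    proof (rule sphere_lift_unique[OF sph _ _ sub])
      show "open (?B s \<inter> ?B t)" by (intro open_Int open_ball)
      show "connected (?B s \<inter> ?B t)" by (intro convex_connected convex_Int convex_ball)
      show "\<psi> (\<Theta> s q) = \<psi> (\<Theta> t q)" if "q \<in> ?B s \<inter> ?B t" for q using lift st that by auto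
      show "(m, 0) \<in> ?B s \<inter> ?B t" using m by (simp add: dist_axis)
      show "\<Theta> s (m, 0) = \<Theta> t (m, 0)" using curve st mI m by simp
      show "p \<in> ?B s \<inter> ?B t" using p by blast
    qed
  qed
  define W where "W = (\<Union>s\<in>I. ?B s)"
  define ctr where "ctr p = (SOME s. s \<in> I \<and> p \<in> ?B s)" for p
  have ctr: "ctr p \<in> I \<and> p \<in> ?B (ctr p)" if "p \<in> W" for p
    unfolding ctr_def by (rule someI_ex) (use that W_def in blast)
  define \<Phi> where "\<Phi> p = \<Theta> (ctr p) p" for p
  have \<Phi>: "\<Phi> p = \<Theta> s p" if "s \<in> I" "p \<in> ?B s" for s p
    unfolding \<Phi>_def using agree ctr[of p] that W_def by blast
  have oW: "open W" unfolding W_def by blast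
  have contW: "continuous_map (top_of_set W) X \<Phi>"
  proof (rule pasting_lemma[where I=I and T="?B" and f=\<Theta>])
    show "openin (top_of_set W) (?B s)" if "s \<in> I" for s
      by (rule open_subset) (use that W_def in auto)
    show "continuous_map (subtopology (top_of_set W) (?B s)) X (\<Theta> s)" if "s \<in> I" for s
    proof -
      have "W \<inter> ?B s = ?B s" using that W_def by blast
      then show ?thesis using cont[OF that] by (simp add: subtopology_subtopology)
    qed
    show "\<Theta> s p = \<Theta> t p" if "s \<in> I" "t \<in> I" "p \<in> topspace (top_of_set W) \<inter> ?B s \<inter> ?B t" for s t p
      using agree that by blast
    show "\<exists>s. s \<in> I \<and> p \<in> ?B s \<and> \<Phi> p = \<Theta> s p" if "p \<in> topspace (top_of_set W)" for p
      using ctr[of p] that \<Phi>_def by auto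
  qed
  have E: "\<psi> (\<Phi> p) = surf (null_coords p)" if "p \<in> W" for p
    unfolding \<Phi>_def using lift ctr[OF that] by blast
  have regW: "null_coords p \<in> reg_dom" if "p \<in> W" for p using reg that W_def by blast
  have smE: "smooth_on W (\<lambda>p. surf (null_coords p))"
    by (rule smooth_on_compose[OF oW open_null_dom _ smooth_surf smooth_on_linear[OF bounded_linear_null_coords]])
      (use regW reg_dom_subset in blast)
  have "local_diffeo W X A \<Phi>"
    unfolding local_diffeo_def
  proof (intro conjI ballI impI oW contW)
    fix c assume c: "c \<in> A"
    show sm: "smooth_on {p \<in> W. \<Phi> p \<in> fst c} (snd c \<circ> \<Phi>)"
      by (rule sphere_lift_smooth(1)[OF sph c oW contW smE E])
    fix p assume p: "p \<in> W" "\<Phi> p \<in> fst c"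
    let ?d = "fderiv (snd c \<circ> \<Phi>) p"
    note ch = sphere_chart(1)[OF sph c] sphere_patchD[OF sphere_chart(2)[OF sph c]]
    have q: "snd c (\<Phi> p) \<in> chart_range c" using p(2) by (auto simp: chart_range_def)
    have V: "p \<in> {p \<in> W. \<Phi> p \<in> fst c}" using p by blast
    have lin: "linear ?d" by (rule has_derivative_linear[OF smooth_on_has_derivative[OF sm V]])
    have pd: "null_coords p \<in> null_dom" "null_det (null_coords p) \<noteq> 0" using regW[OF p(1)] by (auto simp: reg_dom_def)
    have dE: "fderiv (\<lambda>p. surf (null_coords p)) p v = fderiv surf (null_coords p) (null_coords v)" for v
    proof -
      have "((\<lambda>p. surf (null_coords p)) has_derivative (\<lambda>v. fderiv surf (null_coords p) (null_coords v))) (at p)"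
        by (rule has_derivative_compose[OF bounded_linear_imp_has_derivative[OF bounded_linear_null_coords] 
            smooth_on_has_derivative[OF smooth_surf pd(1)]])
      then show ?thesis by (simp add: fderiv_eq)
    qed
    have lin2: "linear (fderiv surf (null_coords p))"
      by (rule has_derivative_linear[OF smooth_on_has_derivative[OF smooth_surf pd(1)]])
    have inj2: "inj (fderiv surf (null_coords p))"
      using transversal_iff[OF lin2, of \<xi>] jac_surf[OF pd(1)] pd(2) by (auto simp: jac_def)
    \<comment> \<open>By the chain rule the differential of the immersion composed with
      \<open>?d\<close> is that of \<open>surf\<close> composed with the invertible map
      \<open>null_coords\<close>, which is injective at regular points.\<close>
    show "inj ?d"
      unfolding linear_injective_0[OF lin]
    proof (intro allI impI)
      fix v assume "?d v = 0"
      moreover have "fderiv (in_chart c \<psi>) (snd c (\<Phi> p)) (?d v) = fderiv (\<lambda>p. surf (null_coords p)) p v"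
        by (rule sphere_lift_smooth(2)[OF sph c oW contW smE E p])
      ultimately have "fderiv surf (null_coords p) (null_coords v) = 0"
        using linear_0[OF ch(7)[OF q]] dE by simp
      then have "null_coords v = 0" using inj2 linear_injective_0[OF lin2] by blast
      then show "v = 0" by (auto simp: null_coords_def zero_prod_def prod_eq_iff)
    qed
  qed
  moreover have "(s, 0) \<in> W \<and> \<Phi> (s, 0) = \<beta> s" if "s \<in> I" for s
  proof -
    have "(s, 0) \<in> ?B s" using r[OF that] by simp
    moreover from this have "(s, 0) \<in> W" using that unfolding W_def by blast
    ultimately show ?thesis using \<Phi>[OF that] curve[OF that that] r[OF that] by simp
  qed
  ultimately show ?thesis using that E by blast
qed

text \<open>The solutions are not compared directly: each is lifted over the same explicit surface,
  and on the intersection of the two strips both immersions equal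
  \<open>surf (null_coords p)\<close>.\<close>

lemma cauchy_solutions_agree:
  assumes I: "is_interval I" "interior I \<noteq> {}" "I \<subseteq> J" "is_interval J"
    and data: "\<And>s. s \<in> I \<Longrightarrow> surf (s, s) = \<alpha> s" "\<And>s. s \<in> I \<Longrightarrow> conormal (s, s) = U s" 
      "\<And>s. s \<in> I \<Longrightarrow> null_det (s, s) \<noteq> 0"
    and base: "s1 \<in> J" "surf (s1, s1) \<times> \<xi> = a s1 - b s1"
    and sol: "cauchy_solution \<xi> I \<alpha> U X\<^sub>1 A\<^sub>1 \<psi>\<^sub>1 \<beta>\<^sub>1" "cauchy_solution \<xi> I \<alpha> U X\<^sub>2 A\<^sub>2 \<psi>\<^sub>2 \<beta>\<^sub>2"
    and an: "open I \<or> (analytic_map A\<^sub>1 \<psi>\<^sub>1 \<and> analytic_map A\<^sub>2 \<psi>\<^sub>2)"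
  shows "agree_near_curve I X\<^sub>1 A\<^sub>1 \<psi>\<^sub>1 \<beta>\<^sub>1 X\<^sub>2 A\<^sub>2 \<psi>\<^sub>2 \<beta>\<^sub>2"
proof -
  have an': "open I \<or> analytic_map A\<^sub>1 \<psi>\<^sub>1" "open I \<or> analytic_map A\<^sub>2 \<psi>\<^sub>2" using an by auto
  obtain W1 \<Phi>1 where 1: "local_diffeo W1 X\<^sub>1 A\<^sub>1 \<Phi>1" "\<And>s. s \<in> I \<Longrightarrow> (s, 0) \<in> W1 \<and> \<Phi>1 (s, 0) = \<beta>\<^sub>1 s"
    "\<And>p. p \<in> W1 \<Longrightarrow> \<psi>\<^sub>1 (\<Phi>1 p) = surf (null_coords p)"
  proof (rule global_lift[OF I data base sol(1) an'(1)])
    fix W \<Phi>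
    assume "local_diffeo W X\<^sub>1 A\<^sub>1 \<Phi>" "\<And>s. s \<in> I \<Longrightarrow> (s, 0) \<in> W \<and> \<Phi> (s, 0) = \<beta>\<^sub>1 s"
      "\<And>p. p \<in> W \<Longrightarrow> \<psi>\<^sub>1 (\<Phi> p) = surf (null_coords p)"
    then show thesis by (rule that)
  qed
  obtain W2 \<Phi>2 where 2: "local_diffeo W2 X\<^sub>2 A\<^sub>2 \<Phi>2" "\<And>s. s \<in> I \<Longrightarrow> (s, 0) \<in> W2 \<and> \<Phi>2 (s, 0) = \<beta>\<^sub>2 s"
    "\<And>p. p \<in> W2 \<Longrightarrow> \<psi>\<^sub>2 (\<Phi>2 p) = surf (null_coords p)"
  proof (rule global_lift[OF I data base sol(2) an'(2)])
    fix W \<Phi>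
    assume "local_diffeo W X\<^sub>2 A\<^sub>2 \<Phi>" "\<And>s. s \<in> I \<Longrightarrow> (s, 0) \<in> W \<and> \<Phi> (s, 0) = \<beta>\<^sub>2 s"
      "\<And>p. p \<in> W \<Longrightarrow> \<psi>\<^sub>2 (\<Phi> p) = surf (null_coords p)"
    then show thesis by (rule that)
  qed
  have o: "open (W1 \<inter> W2)" using 1(1) 2(1) by (auto simp: local_diffeo_def)
  show ?thesis
    unfolding agree_near_curve_def
  proof (intro exI[of _ "W1 \<inter> W2"] exI[of _ \<Phi>1] exI[of _ \<Phi>2] conjI ballI)
    show "Sigma I (\<lambda>_. {0}) \<subseteq> W1 \<inter> W2" using 1(2) 2(2) by auto
    show "local_diffeo (W1 \<inter> W2) X\<^sub>1 A\<^sub>1 \<Phi>1" "local_diffeo (W1 \<inter> W2) X\<^sub>2 A\<^sub>2 \<Phi>2"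
      by (rule local_diffeo_subset[OF 1(1) o], simp, rule local_diffeo_subset[OF 2(1) o], simp)
  qed (use 1(2,3) 2(2,3) in auto)
qed

end

section \<open>The Cauchy problem\<close>

text \<open>The formulas for \<open>a\<close> and \<open>b\<close> are applied to continuations of
  \<alpha> and \<open>U\<close> to an open interval, since the null data need two-sided derivatives.
  The relations between \<alpha> and \<open>U\<close> are given on \<open>I\<close>, so the
  statements about the diagonal are made there.\<close>

lemma null_data_of_admissible_pair:
  assumes I: "is_interval I" "interior I \<noteq> {}" and adm: "admissible_pair \<xi> I \<alpha> U" and \<xi>: "\<xi> \<noteq> 0"
  obtains J a b a' b' P Q where "null_data \<xi> J a b a' b' P Q" "I \<subseteq> J" "is_interval J"
    "\<And>s. s \<in> I \<Longrightarrow> null_data.surf a b P Q (s, s) = \<alpha> s" "\<And>s. s \<in> I \<Longrightarrow> null_data.conormal a b (s, s) = U s" 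
    "\<And>s. s \<in> I \<Longrightarrow> null_data.null_det a b a' b' (s, s) \<noteq> 0"
    "\<And>s. s \<in> I \<Longrightarrow> null_data.surf a b P Q (s, s) \<times> \<xi> = a s - b s"
proof -
  let ?D = "\<lambda>f s. vector_derivative f (at s within I)"
  have an: "real_analytic_on I \<alpha>" "real_analytic_on I U"
    using adm by (auto simp: admissible_pair_def regular_analytic_space_curve_def)
  obtain L where L: "\<And>s. s \<in> I \<Longrightarrow> L s > 0 \<and> ?D \<alpha> s \<bullet> U s = 0 \<and> \<xi> \<bullet> U s = 1 \<and> L s = - (?D \<alpha> s \<bullet> ?D U s)"
    using adm by (auto simp: admissible_pair_def Let_def)
  obtain J1 x where J1: "open J1" "is_interval J1" "I \<subseteq> J1" "\<And>t. t \<in> J1 \<Longrightarrow> vec_germ x t" "\<And>t. t \<in> I \<Longrightarrow> x t = \<alpha> t"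
    by (rule vec_extension[OF I an(1)]) blast
  obtain J2 n0 where J2: "open J2" "is_interval J2" "I \<subseteq> J2" "\<And>t. t \<in> J2 \<Longrightarrow> vec_germ n0 t" "\<And>t. t \<in> I \<Longrightarrow> n0 t = U t"
    by (rule vec_extension[OF I an(2)]) blast
  define J where "J = J1 \<inter> J2"
  have J: "open J" "is_interval J" "I \<subseteq> J" using J1 J2 by (auto simp: J_def is_interval_Int)
  \<comment> \<open>The correction vanishes on \<open>I\<close> and makes \<open>n \<bullet> \<xi> = 1\<close> hold beyond \<open>I\<close> as well.\<close>
  define n where "n t = n0 t + ((1 - n0 t \<bullet> \<xi>) / (\<xi> \<bullet> \<xi>)) *\<^sub>R \<xi>" for t
  have n_xi: "n t \<bullet> \<xi> = 1" for t using \<xi> by (simp add: n_def inner_add_left)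
  have nI: "n t = U t" if "t \<in> I" for t using J2(5)[OF that] L[OF that] by (simp add: n_def inner_commute)
  have gx: "vec_germ x t" if "t \<in> J" for t using J1(4) that by (simp add: J_def)
  have gn: "vec_germ n t" if "t \<in> J" for t
    unfolding n_def divide_inverse using J2(4)[of t] that
    by (intro vec_germ_add vec_germ_scaleR real_germ_mult real_germ_diff real_germ_const vec_germ_inner vec_germ_const)
      (auto simp: J_def)
  define a where "a t = (1/2) *\<^sub>R (n t + x t \<times> \<xi>)" for t
  define b where "b t = (1/2) *\<^sub>R (n t - x t \<times> \<xi>)" for t
  define a' where "a' t = vector_derivative a (at t)" for t
  define b' where "b' t = vector_derivative b (at t)" for t
  have ga: "vec_germ a t" and gb: "vec_germ b t" if "t \<in> J" for t
    unfolding a_def b_def 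
    by (intro vec_germ_scaleR real_germ_const vec_germ_add vec_germ_diff vec_germ_cross vec_germ_const gx[OF that] gn[OF that])+
  have ga': "vec_germ a' t" "(a has_vector_derivative a' t) (at t)" 
    and gb': "vec_germ b' t" "(b has_vector_derivative b' t) (at t)" if "t \<in> J" for t
    unfolding a'_def b'_def using vec_germ_vector_derivative[OF ga[OF that]] vec_germ_vector_derivative[OF gb[OF that]] by blast+
  obtain s0 where s0: "s0 \<in> I" using I(2) interior_subset by blast
  then have s0J: "s0 \<in> J" using J(3) by blast
  have gp: "vec_germ (\<lambda>t. a t \<times> a' t) t" "vec_germ (\<lambda>t. - (b t \<times> b' t)) t" if "t \<in> J" for t
    using vec_germ_cross[OF ga[OF that] ga'(1)[OF that]] 
      vec_germ_diff[OF vec_germ_const[of 0] vec_germ_cross[OF gb[OF that] gb'(1)[OF that]]] by simp_all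
  have cont: "continuous_on J f" if "\<And>t. t \<in> J \<Longrightarrow> vec_germ f t" for f
    using vec_germ_isCont[OF that] by (simp add: continuous_at_imp_continuous_on)
  obtain P0 where P0: "\<And>t. t \<in> J \<Longrightarrow> (P0 has_vector_derivative a t \<times> a' t) (at t)"
  proof (rule open_interval_primitive[OF J(1,2) s0J cont[OF gp(1)]])
    fix R assume "\<And>t. t \<in> J \<Longrightarrow> (R has_vector_derivative a t \<times> a' t) (at t)"
    then show thesis by (rule that)
  qed
  obtain Q where Q: "\<And>t. t \<in> J \<Longrightarrow> (Q has_vector_derivative - (b t \<times> b' t)) (at t)"
  proof (rule open_interval_primitive[OF J(1,2) s0J cont[OF gp(2)]])
    fix R assume "\<And>t. t \<in> J \<Longrightarrow> (R has_vector_derivative - (b t \<times> b' t)) (at t)"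
    then show thesis by (rule that)
  qed
  \<comment> \<open>The constant of integration is chosen such that the surface passes through
    \<open>\<alpha> s0\<close> at the diagonal point over \<open>s0\<close>.\<close>
  define P where "P t = P0 t + (\<alpha> s0 - (P0 s0 + Q s0 + b s0 \<times> a s0))" for t
  have P: "(P has_vector_derivative a t \<times> a' t) (at t)" if "t \<in> J" for t
    unfolding P_def[abs_def] using has_vector_derivative_add[OF P0[OF that] has_vector_derivative_const] by simp
  have evJ: "\<forall>\<^sub>F u in nhds t. u \<in> J" if "t \<in> J" for t by (rule eventually_nhds_in_open[OF J(1) that])
  have gP: "vec_germ P t" and gQ: "vec_germ Q t" if "t \<in> J" for t
    by (rule vec_germ_primitive[OF gp(1)[OF that]], rule eventually_mono[OF evJ[OF that]], erule P)
      (rule vec_germ_primitive[OF gp(2)[OF that]], rule eventually_mono[OF evJ[OF that]], erule Q)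
  interpret N: null_data \<xi> J a b a' b' P Q
  proof
    show "a t \<bullet> \<xi> = 1/2" "b t \<bullet> \<xi> = 1/2" for t
      using n_xi[of t] by (simp_all add: a_def b_def inner_add_left inner_diff_left dot_cross_self)
  qed (use J(1) ga gb ga' gb' gP gQ P Q in auto)
  have con: "N.conormal (s, s) = n s" for s by (simp add: N.conormal_def a_def b_def flip: scaleR_2 scaleR_add_right)
  have not_bot: "at s within I \<noteq> bot" if "s \<in> I" for s
    using interval_islimpt[OF I that] trivial_limit_within by blast
  \<comment> \<open>At a limit point of \<open>I\<close> the derivative within \<open>I\<close> is
    unique, so it equals the derivative of the continuation.\<close>
  have D: "?D f s = vector_derivative g (at s)" 
    if "s \<in> I" "vec_germ g s" "\<And>t. t \<in> I \<Longrightarrow> g t = f t" for f g s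
  proof (rule vector_derivative_within[OF not_bot[OF that(1)]])
    show "(f has_vector_derivative vector_derivative g (at s)) (at s within I)"
      by (rule has_vector_derivative_transform[OF that(1) _ has_vector_derivative_at_within[OF vec_germ_vector_derivative(1)[OF that(2)]]])
        (use that(3) in auto)
  qed
  define x' where "x' t = vector_derivative x (at t)" for t
  define n' where "n' t = vector_derivative n (at t)" for t
  have Dx: "?D \<alpha> s = x' s" and Dn: "?D U s = n' s" if "s \<in> I" for s
    unfolding x'_def n'_def using D[OF that gx J1(5)] D[OF that gn nI] J(3) that by blast+
  have dx: "(x has_vector_derivative x' t) (at t)" and dn: "(n has_vector_derivative n' t) (at t)" if "t \<in> J" for t
    unfolding x'_def n'_def using vec_germ_vector_derivative(1) gx[OF that] gn[OF that] by blast+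
  have dcr: "((\<lambda>t. x t \<times> \<xi>) has_vector_derivative x' t \<times> \<xi>) (at t)" if "t \<in> J" for t
    by (rule bounded_linear.has_vector_derivative[OF bounded_bilinear.bounded_linear_left[OF bounded_bilinear_cross3] dx[OF that]])
  have a'_eq: "a' t = (1/2) *\<^sub>R (n' t + x' t \<times> \<xi>)" and b'_eq: "b' t = (1/2) *\<^sub>R (n' t - x' t \<times> \<xi>)" if "t \<in> J" for t
    unfolding a'_def b'_def a_def[abs_def] b_def[abs_def]
    by (intro vector_derivative_at bounded_linear.has_vector_derivative[OF bounded_linear_scaleR_right] 
        has_vector_derivative_add has_vector_derivative_diff dn dcr that)+
  have rel: "x' s \<bullet> n s = 0" "x' s \<bullet> n' s < 0" if "s \<in> I" for s
    using L[OF that] Dx[OF that] Dn[OF that] nI[OF that] by auto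
  \<comment> \<open>Along the diagonal the derivative of the surface is
    \<open>n \<times> (a' - b')\<close>, that is \<open>n \<times> (x' \<times> \<xi>)\<close>. By
    the Lagrange formula this is \<open>x'\<close>, because \<open>n \<bullet> \<xi> = 1\<close> and
    \<open>x' \<bullet> n = 0\<close>.\<close>
  have surf_x: "N.surf (s, s) = x s" if s: "s \<in> I" for s
  proof -
    have "\<exists>c. \<forall>s\<in>I. N.surf (s, s) - x s = c"
    proof (rule has_derivative_zero_constant)
      show "convex I" using I(1) is_interval_convex by blast
      fix s assume s: "s \<in> I"
      then have sJ: "s \<in> J" and sd: "(s, s) \<in> N.null_dom" using J(3) by (auto simp: N.null_dom_def)
      have "((\<lambda>s. (s, s)) has_derivative (\<lambda>h. (h, h))) (at s)" by (auto intro!: derivative_eq_intros)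
      from has_derivative_compose[OF this smooth_on_has_derivative[OF N.smooth_surf sd]]
      have "((\<lambda>s. N.surf (s, s)) has_derivative (\<lambda>h. fderiv N.surf (s, s) (h, h))) (at s)" .
      moreover have "fderiv N.surf (s, s) (h, h) = h *\<^sub>R x' s" for h
      proof -
        have "a' s - b' s = x' s \<times> \<xi>"
          unfolding a'_eq[OF sJ] b'_eq[OF sJ] by (simp flip: scaleR_2 scaleR_diff_right)
        moreover have "n s \<times> (x' s \<times> \<xi>) = x' s"
          using rel(1)[OF s] n_xi by (simp add: Lagrange inner_commute)
        ultimately show ?thesis
          by (simp add: N.fderiv_surf[OF sd] con flip: scaleR_diff_right Cross3.right_diff_distrib)
      qed
      ultimately have "((\<lambda>s. N.surf (s, s)) has_vector_derivative x' s) (at s)" by (simp add: has_vector_derivative_def)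
      from has_vector_derivative_diff[OF this dx[OF sJ]]
      show "((\<lambda>s. N.surf (s, s) - x s) has_derivative (\<lambda>h. 0)) (at s within I)"
        by (simp add: has_vector_derivative_def has_derivative_at_withinI)
    qed
    then have "N.surf (s, s) - x s = N.surf (s0, s0) - x s0" using s s0 by metis
    moreover have "N.surf (s0, s0) = x s0" using J1(5)[OF s0] by (simp add: N.surf_def P_def)
    ultimately show ?thesis by simp
  qed
  show ?thesis
  proof (rule that[OF N.null_data_axioms J(3,2)])
    fix s assume s: "s \<in> I"
    then have sJ: "s \<in> J" using J(3) by blast
    show "N.surf (s, s) = \<alpha> s" using surf_x[OF s] J1(5)[OF s] by simp
    show "N.conormal (s, s) = U s" using con nI[OF s] by simp
    show "N.surf (s, s) \<times> \<xi> = a s - b s"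
      unfolding surf_x[OF s] a_def b_def by (simp flip: scaleR_2 scaleR_diff_right)
    have n'_xi: "n' s \<bullet> \<xi> = 0"
    proof -
      have "((\<lambda>t. n t \<bullet> \<xi>) has_vector_derivative n' s \<bullet> \<xi>) (at s)"
        by (rule bounded_linear.has_vector_derivative[OF bounded_linear_inner_left dn[OF sJ]])
      then have "((\<lambda>t. 1) has_vector_derivative n' s \<bullet> \<xi>) (at s)" by (simp add: n_xi)
      then show ?thesis by (rule vector_derivative_unique_at[OF _ has_vector_derivative_const])
    qed
    \<comment> \<open>This computation ends in half of \<open>x' s \<bullet> n' s\<close>, which is
      minus half of \<lambda>, so admissibility makes the diagonal over \<open>I\<close>
      regular.\<close>
    have "a' s \<times> b' s = (1/4) *\<^sub>R ((n' s + x' s \<times> \<xi>) \<times> (n' s - x' s \<times> \<xi>))"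
      unfolding a'_eq[OF sJ] b'_eq[OF sJ] by (simp add: cross_mult_left cross_mult_right)
    also have "(n' s + x' s \<times> \<xi>) \<times> (n' s - x' s \<times> \<xi>) = - 2 *\<^sub>R (n' s \<times> (x' s \<times> \<xi>))"
      using cross_skew[of "x' s \<times> \<xi>" "n' s"] 
      by (simp add: cross_add_left Cross3.right_diff_distrib scaleR_2)
    also have "n' s \<times> (x' s \<times> \<xi>) = - (x' s \<bullet> n' s) *\<^sub>R \<xi>"
      using n'_xi by (simp add: Lagrange inner_commute)
    finally have "N.null_det (s, s) = (1/2) * (x' s \<bullet> n' s)"
      using n_xi by (simp add: N.null_det_def con inner_commute)
    then show "N.null_det (s, s) \<noteq> 0" using rel(2)[OF s] by simp
  qed
qed

text \<open>The solution constructed is analytic, so for every kind of interval it belongs to the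
  class within which uniqueness is asserted.\<close>

theorem theorem3p1:
  fixes I :: "real set" and \<xi> :: "real^3" and \<alpha> U :: "real \<Rightarrow> real^3"
  assumes "is_interval I" and "interior I \<noteq> {}"
    and "\<xi> \<noteq> 0"
    and "admissible_pair \<xi> I \<alpha> U"
  shows "(\<exists>(X :: (real \<times> real) topology) A \<psi> \<beta>.
            cauchy_solution \<xi> I \<alpha> U X A \<psi> \<beta> \<and> analytic_map A \<psi>) \<and>
         (\<forall>(X\<^sub>1 :: 'a topology) A\<^sub>1 \<psi>\<^sub>1 \<beta>\<^sub>1 (X\<^sub>2 :: 'b topology) A\<^sub>2 \<psi>\<^sub>2 \<beta>\<^sub>2.
            cauchy_solution \<xi> I \<alpha> U X\<^sub>1 A\<^sub>1 \<psi>\<^sub>1 \<beta>\<^sub>1 \<longrightarrow>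
            cauchy_solution \<xi> I \<alpha> U X\<^sub>2 A\<^sub>2 \<psi>\<^sub>2 \<beta>\<^sub>2 \<longrightarrow>
            open I \<or> (analytic_map A\<^sub>1 \<psi>\<^sub>1 \<and> analytic_map A\<^sub>2 \<psi>\<^sub>2) \<longrightarrow>
            agree_near_curve I X\<^sub>1 A\<^sub>1 \<psi>\<^sub>1 \<beta>\<^sub>1 X\<^sub>2 A\<^sub>2 \<psi>\<^sub>2 \<beta>\<^sub>2)"
proof -
  obtain J a b a' b' P Q where N: "null_data \<xi> J a b a' b' P Q" and J: "I \<subseteq> J" "is_interval J"
    and data: "\<And>s. s \<in> I \<Longrightarrow> null_data.surf a b P Q (s, s) = \<alpha> s" "\<And>s. s \<in> I \<Longrightarrow> null_data.conormal a b (s, s) = U s" 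
      "\<And>s. s \<in> I \<Longrightarrow> null_data.null_det a b a' b' (s, s) \<noteq> 0"
    and base: "\<And>s. s \<in> I \<Longrightarrow> null_data.surf a b P Q (s, s) \<times> \<xi> = a s - b s"
    by (rule null_data_of_admissible_pair[OF assms(1,2,4,3)]) blast
  interpret N: null_data \<xi> J a b a' b' P Q by (rule N)
  obtain s1 where s1: "s1 \<in> I" using assms(2) interior_subset by blast
  then have s1J: "s1 \<in> J" using J(1) by blast
  show ?thesis
  proof (intro conjI allI impI)
    show "\<exists>(X :: (real \<times> real) topology) A \<psi> \<beta>. cauchy_solution \<xi> I \<alpha> U X A \<psi> \<beta> \<and> analytic_map A \<psi>"
      using N.cauchy_solution_surf[OF assms(1,2) J(1) assms(3) data] by blast
  qed (rule N.cauchy_solutions_agree[OF assms(1,2) J data s1J base[OF s1]])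
qed

end
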